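(* Let $X$ be standard Brownian motion from $0$ under $P_0$ (expectation $E_0$), let $\tau_1=\inf\{t:X_t=1\}$ be the first hitting time of $1$ by $X$, and let $\mathfrak{a}$ be the Brownian ascent. For any measurable $F:\mathcal{C}([0,1];\mathbb{R})\to\mathbb{R}_+$, $$E[F(\mathfrak{a}_\bullet)]=\sqrt{\frac\pi2}\;E_0\left[F\left(\frac{X_{\bullet\tau_1}}{\sqrt{\tau_1}}\right)\frac1{\sqrt{\tau_1}}\right].$$
   Context: The bullet $\bullet$ stands for a time parameter ranging over $[0,1]$; thus $X_{\bullet\tau_1}/\sqrt{\tau_1}$ is the path $s\mapsto X_{s\tau_1}/\sqrt{\tau_1}$, $0\le s\le1$. The Brownian ascent $\mathfrak{a}=(\mathfrak{a}_s:0\le s\le1)$ is Brownian motion on $[0,1]$ from $0$ conditioned to end at its maximum: with $S_1=\sup_{s\le1}X_s$, its law is the weak limit, as $\epsilon\searrow0$, of the law of $(X_s:0\le s\le1)$ under $P_0(\,\cdot\mid S_1-X_1<\epsilon)$ on $\mathcal{C}([0,1];\mathbb{R})$ with the uniform topology. *)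

theory Defs
  imports "HOL-Probability.Probability"
begin

section \<open>The path space C([0,1])\<close>

text \<open>Paths are represented by functions that are extensional outside the unit interval.\<close>

definition C01 :: "(real \<Rightarrow> real) metric" where
  "C01 = cfunspace (top_of_set {0..1}) euclidean_metric"

lemma mspace_C01: "mspace C01 = {f \<in> extensional {0..1}. continuous_on {0..1} f}"
proof -
  have "Metric_space.mbounded UNIV dist (f ` {0..1})"
    if "continuous_on {0..1} f" for f :: "real \<Rightarrow> real"
    using compact_imp_bounded[OF compact_continuous_image[OF that]]
    by (simp add: Met_TC.mbounded bounded_def)
  then show ?thesis
    by (auto simp: C01_def)
qed

lemma mdist_C01:
  assumes "f \<in> mspace C01" "g \<in> mspace C01"
  shows "mdist C01 f g = (SUP s\<in>{0..1}. \<bar>f s - g s\<bar>)"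
  using assms
  by (simp add: C01_def mdist_cfunspace_eq_mdist_funspace Met_TC.fdist_def Met_TC.fspace_def
      dist_real_def)

text \<open>The Borel sigma-algebra of an abstract topology.\<close>

definition borel_of :: "'a topology \<Rightarrow> 'a measure" where
  "borel_of T = sigma (topspace T) {U. openin T U}"

abbreviation borel_C01 :: "(real \<Rightarrow> real) measure" where
  "borel_C01 \<equiv> borel_of (mtopology_of C01)"

definition unit_path :: "(real \<Rightarrow> 'a \<Rightarrow> real) \<Rightarrow> 'a \<Rightarrow> real \<Rightarrow> real" where
  "unit_path Y \<omega> = (\<lambda>s\<in>{0..1}. Y s \<omega>)"

definition weakly_converges ::
  "'a topology \<Rightarrow> ('i \<Rightarrow> 'a measure) \<Rightarrow> 'a measure \<Rightarrow> 'i filter \<Rightarrow> bool" where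
  "weakly_converges T \<mu> \<nu> \<F> \<longleftrightarrow>
     (\<forall>f. continuous_map T euclideanreal f \<and> bounded (f ` topspace T) \<longrightarrow>
        ((\<lambda>i. \<integral>x. f x \<partial>\<mu> i) \<longlongrightarrow> (\<integral>x. f x \<partial>\<nu>)) \<F>)"


section \<open>Brownian motion and the Brownian ascent\<close>

locale standard_brownian_motion = prob_space M for M :: "'a measure" +
  fixes X :: "real \<Rightarrow> 'a \<Rightarrow> real"
  assumes rv: "\<And>t. 0 \<le> t \<Longrightarrow> random_variable borel (X t)"
    and start: "AE \<omega> in M. X 0 \<omega> = 0"
    and indep_increments:
      "\<And>(n::nat) (t::nat \<Rightarrow> real). 0 \<le> t 0 \<Longrightarrow> (\<And>i. i < n \<Longrightarrow> t i \<le> t (Suc i)) \<Longrightarrow>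
         indep_vars (\<lambda>_. borel) (\<lambda>i \<omega>. X (t (Suc i)) \<omega> - X (t i) \<omega>) {..<n}"
    and normal_increments:
      "\<And>s t. 0 \<le> s \<Longrightarrow> s < t \<Longrightarrow>
         distributed M lborel (\<lambda>\<omega>. X t \<omega> - X s \<omega>)
           (\<lambda>x. ennreal (normal_density 0 (sqrt (t - s)) x))"
    and continuous_paths: "\<And>\<omega>. \<omega> \<in> space M \<Longrightarrow> continuous_on {0..} (\<lambda>t. X t \<omega>)"

text \<open>
  As a real infimum this is unspecified when the path never reaches \<open>a\<close>. For standard
  Brownian motion that event is null, so it contributes nothing to an expectation.
\<close>

definition hitting_time :: "(real \<Rightarrow> 'a \<Rightarrow> real) \<Rightarrow> real \<Rightarrow> 'a \<Rightarrow> real" where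
  "hitting_time X a \<omega> = Inf {t. 0 \<le> t \<and> X t \<omega> = a}"

definition running_sup :: "(real \<Rightarrow> 'a \<Rightarrow> real) \<Rightarrow> real \<Rightarrow> 'a \<Rightarrow> real" where
  "running_sup X t \<omega> = (SUP s\<in>{0..t}. X s \<omega>)"

definition near_max_law :: "'a measure \<Rightarrow> (real \<Rightarrow> 'a \<Rightarrow> real) \<Rightarrow> real \<Rightarrow> (real \<Rightarrow> real) measure" where
  "near_max_law M X \<epsilon> =
     distr (uniform_measure M {\<omega> \<in> space M. running_sup X 1 \<omega> - X 1 \<omega> < \<epsilon>})
       borel_C01 (unit_path X)"

text \<open>
  A process \<open>a\<close> on a probability space \<open>N\<close>, which need not be the space \<open>M\<close> carrying the
  Brownian motion \<open>X\<close>: only the law of \<open>a\<close> is prescribed.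
\<close>

definition brownian_ascent ::
  "'a measure \<Rightarrow> (real \<Rightarrow> 'a \<Rightarrow> real) \<Rightarrow> 'b measure \<Rightarrow> (real \<Rightarrow> 'b \<Rightarrow> real) \<Rightarrow> bool" where
  "brownian_ascent M X N a \<longleftrightarrow>
     prob_space N \<and> unit_path a \<in> measurable N borel_C01 \<and>
     weakly_converges (mtopology_of C01) (near_max_law M X) (distr N borel_C01 (unit_path a))
       (at_right 0)"

end

theory Submission
  imports Defs
begin

text \<open>
  Let \<open>S\<close> be the running maximum of \<open>X\<close>. The Stieltjes integral of
  \<open>G\<^sub>t = F (X\<^bsub>\<bullet>t\<^esub> / \<surd>t)\<close> against \<open>dS\<close> over the time window \<open>(1, 4]\<close> is computed in two ways.
  On the one hand \<open>dS\<close> is Lebesgue measure on the levels \<open>x\<close>, with \<open>t\<close> the hitting time of \<open>x\<close>;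
  after Brownian scaling its expectation is \<open>E [F (X\<^bsub>\<bullet>\<tau>\<^esub> / \<surd>\<tau>) / \<surd>\<tau>]\<close>.
  On the other hand it is the limit of the sums of \<open>G\<^sub>t (S\<^bsub>t+h\<^esub> - S\<^sub>t)\<close> over a time grid of mesh
  \<open>h\<close>. By the Markov property at the deterministic time \<open>t\<close> the expectation of such a term is a mixture
  of the quantities \<open>E [G\<^sub>t; S\<^sub>t - X\<^sub>t < u]\<close> with \<open>u\<close> of order \<open>\<surd>h\<close>, that is, of conditional
  expectations that converge to \<open>E [F (\<aa>)]\<close>. The total mass is
  \<open>E [S\<^sub>4 - S\<^sub>1] = E [S\<^sub>1] = \<surd>(2 / \<pi>)\<close> by the reflection principle. No strong Markov
  property is needed, because all conditioning takes place at deterministic times.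
\<close>

section \<open>Measures on metric spaces and on the path space\<close>

text \<open>The hypothesis on the ascent controls \<open>E [F; S - X < v] / P (S - X < v)\<close>
  only for small \<open>v\<close> and bounded continuous \<open>F\<close>, and without a rate. So
  drawdowns above a fixed \<open>\<eta>\<close> must be cheap: to raise the maximum within time
  \<open>h\<close> after such a drawdown, the next segment has to climb by at least
  \<open>\<eta>\<close>. A third Gaussian moment bounds the resulting gain by order \<open>h\<close>
  to the power 3/2, so that the sum over about \<open>1 / h\<close> grid steps vanishes. Starting
  the window at 1 makes this uniform in \<open>t\<close>, because a normalised drawdown is
  multiplied by \<open>sqrt t >= 1\<close>. The end point 4 is chosen for
  \<open>sqrt 4 - sqrt 1 = 1\<close>: for a fixed path the levels \<open>x\<close> with
  \<open>x^2 * tau\<close> in the window then form an interval of length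
  \<open>1 / sqrt tau\<close>, and the mean mass is that of one unit of time. Only an upper estimate
  is proved directly. The lower one is the upper one for \<open>1 - F\<close>, since the total
  masses agree. As the hypothesis sees continuous functions only, the result is first an equality of
  two finite Borel measures on path space, and measurable \<open>F\<close> enters last.\<close>

lemma space_borel_of [simp]: "space (borel_of T) = topspace T"
  by (simp add: borel_of_def space_measure_of_conv)

lemma sets_borel_of: "sets (borel_of T) = sigma_sets (topspace T) {U. openin T U}"
  unfolding borel_of_def by (intro sets_measure_of) (auto dest: openin_subset)

lemma openin_sets_borel_of: "openin T U \<Longrightarrow> U \<in> sets (borel_of T)"
  by (auto simp: sets_borel_of)

lemma borel_measurable_continuous_map:
  fixes f :: "'a \<Rightarrow> 'b::topological_space"
  assumes "continuous_map T euclidean f"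
  shows "f \<in> borel_measurable (borel_of T)"
proof (rule borel_measurableI)
  fix S :: "'b set" assume "open S"
  then have "openin T {x \<in> topspace T. f x \<in> S}"
    using openin_continuous_map_preimage[OF assms] by simp
  then show "f -` S \<inter> space (borel_of T) \<in> sets (borel_of T)"
    by (simp add: openin_sets_borel_of vimage_def Int_def conj_commute)
qed

lemma continuous_map_metric_real_Lipschitz:
  assumes "\<And>x y. x \<in> mspace m \<Longrightarrow> y \<in> mspace m \<Longrightarrow> f x - f y \<le> B * mdist m x y"
  shows "continuous_map (mtopology_of m) euclideanreal f"
proof -
  have "Lipschitz_continuous_map m euclidean_metric f"
    unfolding Lipschitz_continuous_map_def
  proof (intro conjI exI[of _ B] ballI)
    fix x y assume "x \<in> mspace m" "y \<in> mspace m"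
    then show "mdist euclidean_metric (f x) (f y) \<le> B * mdist m x y"
      using assms[of x y] assms[of y x]
      by (simp add: dist_real_def mdist_commute abs_le_iff)
  qed auto
  from Lipschitz_continuous_imp_continuous_map[OF this] show ?thesis by simp
qed

section \<open>Continuous approximations of indicators of open sets\<close>

definition dist_to_set :: "'a metric \<Rightarrow> 'a set \<Rightarrow> 'a \<Rightarrow> real" where
  "dist_to_set m C x = (INF y\<in>C. mdist m x y)"

lemma dist_to_set_nonneg: "C \<noteq> {} \<Longrightarrow> 0 \<le> dist_to_set m C x"
  unfolding dist_to_set_def by (intro cINF_greatest) auto

lemma dist_to_set_lower: "y \<in> C \<Longrightarrow> dist_to_set m C x \<le> mdist m x y"
  unfolding dist_to_set_def by (intro cINF_lower bdd_belowI[of _ 0]) auto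

lemma continuous_map_dist_to_set:
  assumes "C \<noteq> {}" "C \<subseteq> mspace m"
  shows "continuous_map (mtopology_of m) euclideanreal (dist_to_set m C)"
proof (rule continuous_map_metric_real_Lipschitz[where B = 1])
  fix x y assume xy: "x \<in> mspace m" "y \<in> mspace m"
  have "dist_to_set m C x - mdist m x y \<le> dist_to_set m C y"
    unfolding dist_to_set_def[of _ _ y]
  proof (intro cINF_greatest assms)
    fix z assume z: "z \<in> C"
    then have "dist_to_set m C x \<le> mdist m x z" by (rule dist_to_set_lower)
    also have "\<dots> \<le> mdist m x y + mdist m y z"
      using xy z assms by (intro mdist_triangle) auto
    finally show "dist_to_set m C x - mdist m x y \<le> mdist m y z" by simp
  qed
  then show "dist_to_set m C x - dist_to_set m C y \<le> 1 * mdist m x y" by simp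
qed

lemma dist_to_set_eq_0_iff:
  assumes C: "C \<noteq> {}" "C \<subseteq> mspace m" "openin (mtopology_of m) (mspace m - C)" and x: "x \<in> mspace m"
  shows "dist_to_set m C x = 0 \<longleftrightarrow> x \<in> C"
proof
  assume "x \<in> C"
  then have "dist_to_set m C x \<le> 0" using dist_to_set_lower[of x C m x] Metric_space.mdist_zero[OF Metric_space_mspace_mdist x] by simp
  then show "dist_to_set m C x = 0" using dist_to_set_nonneg[OF C(1), of m x] by simp
next
  assume 0: "dist_to_set m C x = 0"
  show "x \<in> C"
  proof (rule ccontr)
    assume "x \<notin> C"
    then obtain r where r: "r > 0" "Metric_space.mball (mspace m) (mdist m) x r \<subseteq> mspace m - C"
      using C(3) x
      by (auto simp: mtopology_of_def Metric_space.openin_mtopology)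
    have "r \<le> dist_to_set m C x"
      unfolding dist_to_set_def
    proof (intro cINF_greatest C)
      fix y assume "y \<in> C"
      then have "y \<notin> Metric_space.mball (mspace m) (mdist m) x r" using r by auto
      then show "r \<le> mdist m x y"
        using x C(2) \<open>y \<in> C\<close> by (auto simp: Metric_space.in_mball)
    qed
    with 0 r show False by simp
  qed
qed

text \<open>Truncated multiples of the distance to the complement do this: inside \<open>U\<close>
  that distance is positive, so the multiples eventually exceed 1, and outside it is 0.\<close>

lemma open_indicator_limit:
  assumes U: "openin (mtopology_of m) U"
  obtains F :: "nat \<Rightarrow> 'a \<Rightarrow> real" where
    "\<And>n. continuous_map (mtopology_of m) euclideanreal (F n)"
    "\<And>n x. 0 \<le> F n x" "\<And>n x. F n x \<le> 1"
    "\<And>x. x \<in> mspace m \<Longrightarrow> (\<lambda>n. F n x) \<longlonglongrightarrow> indicator U x"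
\<comment> \<open>For the whole space the complement is empty, and the infimum defining the distance
  to it is unspecified.\<close>
proof (cases "U = mspace m")
  case True
  then show ?thesis by (intro that[of "\<lambda>_ _. 1"]) auto
next
  case False
  define C where "C = mspace m - U"
  have sub: "U \<subseteq> mspace m" using openin_subset[OF U] by simp
  have C: "C \<noteq> {}" "C \<subseteq> mspace m" "openin (mtopology_of m) (mspace m - C)"
    using False sub U by (auto simp: C_def double_diff)
  define F where "F n x = min 1 (real n * dist_to_set m C x)" for n x
  show ?thesis
  proof (rule that[of F])
    show "continuous_map (mtopology_of m) euclideanreal (F n)" for n
      unfolding F_def
      by (intro continuous_map_real_min continuous_map_real_mult continuous_map_dist_to_set C)
        auto
    show "0 \<le> F n x" "F n x \<le> 1" for n x
      using dist_to_set_nonneg[OF C(1), of m x] by (auto simp: F_def)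
    fix x assume x: "x \<in> mspace m"
    show "(\<lambda>n. F n x) \<longlonglongrightarrow> indicator U x"
    proof (cases "x \<in> U")
      case False
      then have "dist_to_set m C x = 0" using dist_to_set_eq_0_iff[OF C x] x by (auto simp: C_def)
      then show ?thesis using False by (simp add: F_def)
    next
      case True
      then have "dist_to_set m C x \<noteq> 0" using dist_to_set_eq_0_iff[OF C x] by (auto simp: C_def)
      then have d: "dist_to_set m C x > 0" using dist_to_set_nonneg[OF C(1), of m x] by simp
      obtain k :: nat where k: "1 < real k * dist_to_set m C x" using reals_Archimedean3[OF d] by blast
      have "F n x = 1" if "n \<ge> k" for n
      proof -
        have "real k * dist_to_set m C x \<le> real n * dist_to_set m C x"
          using that d by (intro mult_right_mono) auto
        with k show ?thesis by (simp add: F_def)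
      qed
      then have "\<forall>\<^sub>F n in sequentially. F n x = 1" by (auto simp: eventually_sequentially)
      then show ?thesis using True by (simp add: tendsto_eventually)
    qed
  qed
qed

text \<open>The open sets are an intersection-stable generator, and dominated convergence recovers
  the mass of an open set from the integrals of its continuous approximations. Weak convergence
  gives information on such test functions only.\<close>

lemma measure_eqI_continuous:
  fixes P Q :: "'a measure" and m :: "'a metric"
  assumes sets: "sets P = sets (borel_of (mtopology_of m))" "sets Q = sets (borel_of (mtopology_of m))"
    and fin: "finite_measure P" "finite_measure Q"
    and eq: "\<And>F. continuous_map (mtopology_of m) euclideanreal F \<Longrightarrow> (\<And>x. 0 \<le> F x) \<Longrightarrow>
      (\<And>x. F x \<le> 1) \<Longrightarrow> (\<integral>\<^sup>+x. ennreal (F x) \<partial>P) = (\<integral>\<^sup>+x. ennreal (F x) \<partial>Q)"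
  shows "P = Q"
proof -
  let ?T = "mtopology_of m"
  have spaces: "space P = mspace m" "space Q = mspace m"
    using sets_eq_imp_space_eq[OF sets(1)] sets_eq_imp_space_eq[OF sets(2)] by auto
  have lim: "(\<lambda>n. \<integral>\<^sup>+x. ennreal (F n x) \<partial>R) \<longlonglongrightarrow> emeasure R U"
    if "sets R = sets (borel_of ?T)" "finite_measure R" "openin ?T U" 
      and F: "\<And>n. continuous_map ?T euclideanreal (F n)"
      "\<And>n x. F n x \<le> 1" "\<And>x. x \<in> mspace m \<Longrightarrow> (\<lambda>n. F n x) \<longlonglongrightarrow> indicator U x"
    for R U and F :: "nat \<Rightarrow> 'a \<Rightarrow> real"
  proof -
    have sp: "space R = mspace m" using sets_eq_imp_space_eq[OF that(1)] by simp
    have UR: "U \<in> sets R" using that openin_sets_borel_of by metis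
    have "(\<lambda>n. \<integral>\<^sup>+x. ennreal (F n x) \<partial>R) \<longlonglongrightarrow> (\<integral>\<^sup>+x. ennreal (indicator U x) \<partial>R)"
    proof (rule nn_integral_dominated_convergence[where w = "\<lambda>_. 1"])
      show "(\<lambda>x. ennreal (F n x)) \<in> borel_measurable R" for n
        using borel_measurable_continuous_map[OF F(1)]
        by (simp add: measurable_cong_sets[OF that(1) refl])
      show "(\<lambda>x. ennreal (indicator U x)) \<in> borel_measurable R" using UR by simp
      show "(\<integral>\<^sup>+x. 1 \<partial>R) < \<infinity>" using finite_measure.emeasure_finite[OF that(2), of "space R"]
        by (simp add: top.not_eq_extremum)
      show "AE x in R. (\<lambda>n. ennreal (F n x)) \<longlonglongrightarrow> ennreal (indicator U x)"
        using F(3) sp by (intro AE_I2 tendsto_ennrealI) auto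
      show "AE x in R. ennreal (F n x) \<le> 1" for n
        using F(2) by (intro AE_I2) (metis ennreal_1 ennreal_leI)
    qed simp
    then show ?thesis using UR by (simp add: ennreal_indicator)
  qed
  show ?thesis
  proof (rule measure_eqI_generator_eq[where E = "{U. openin ?T U}" and \<Omega> = "mspace m" and A = "\<lambda>_. mspace m"])
    show "Int_stable {U. openin ?T U}" by (auto simp: Int_stable_def)
    show "{U. openin ?T U} \<subseteq> Pow (mspace m)" using openin_subset[of ?T] by auto
    show "sets P = sigma_sets (mspace m) {U. openin ?T U}" "sets Q = sigma_sets (mspace m) {U. openin ?T U}"
      using sets by (auto simp: sets_borel_of)
    show "emeasure P (mspace m) \<noteq> \<infinity>" for i :: nat
      using finite_measure.emeasure_finite[OF fin(1)] by simp
    show "range (\<lambda>_. mspace m) \<subseteq> {U. openin ?T U}"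
      using openin_topspace[of ?T] by auto
  next
    fix U assume "U \<in> {U. openin ?T U}"
    then have U: "openin ?T U" by simp
    obtain F :: "nat \<Rightarrow> 'a \<Rightarrow> real" where F: "\<And>n. continuous_map (mtopology_of m) euclideanreal (F n)"
      "\<And>n x. 0 \<le> F n x" "\<And>n x. F n x \<le> 1"
      "\<And>x. x \<in> mspace m \<Longrightarrow> (\<lambda>n. F n x) \<longlonglongrightarrow> indicator U x"
      using open_indicator_limit[OF U] by metis
    have "(\<lambda>n. \<integral>\<^sup>+x. ennreal (F n x) \<partial>P) \<longlonglongrightarrow> emeasure P U"
      by (rule lim) (use sets fin U F in auto)
    moreover have "(\<lambda>n. \<integral>\<^sup>+x. ennreal (F n x) \<partial>Q) \<longlonglongrightarrow> emeasure Q U"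
      by (rule lim) (use sets fin U F in auto)
    ultimately show "emeasure P U = emeasure Q U"
      using eq[of "F _"] F by (simp add: LIMSEQ_unique)
  qed auto
qed

text \<open>Indicators of preimages of open sets are pointwise limits of functions
  \<open>F (Z \<omega>)\<close>, so that measurability too can be tested against continuous
  functions.\<close>

lemma measurable_borel_ofI:
  fixes m :: "'a metric"
  assumes sp: "\<And>\<omega>. \<omega> \<in> space M \<Longrightarrow> Z \<omega> \<in> mspace m"
    and meas: "\<And>F. continuous_map (mtopology_of m) euclideanreal F \<Longrightarrow> (\<And>x. 0 \<le> F x) \<Longrightarrow>
      (\<And>x. F x \<le> 1) \<Longrightarrow> (\<lambda>\<omega>. F (Z \<omega>)) \<in> borel_measurable M"
  shows "Z \<in> measurable M (borel_of (mtopology_of m))"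
  unfolding borel_of_def
proof (rule measurable_measure_of)
  show "{U. openin (mtopology_of m) U} \<subseteq> Pow (topspace (mtopology_of m))"
    using openin_subset by fastforce
  show "Z \<in> space M \<rightarrow> topspace (mtopology_of m)" using sp by auto
  fix U assume "U \<in> {U. openin (mtopology_of m) U}"
  then have U: "openin (mtopology_of m) U" by simp
  obtain F :: "nat \<Rightarrow> 'a \<Rightarrow> real" where F: "\<And>n. continuous_map (mtopology_of m) euclideanreal (F n)"
    "\<And>n x. 0 \<le> F n x" "\<And>n x. F n x \<le> 1"
    "\<And>x. x \<in> mspace m \<Longrightarrow> (\<lambda>n. F n x) \<longlonglongrightarrow> indicator U x"
    using open_indicator_limit[OF U] by metis
  have "(\<lambda>\<omega>. indicator U (Z \<omega>) :: real) \<in> borel_measurable M"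
    by (rule borel_measurable_LIMSEQ_real[where u = "\<lambda>n \<omega>. F n (Z \<omega>)"])
      (use F sp meas in auto)
  then have "(\<lambda>\<omega>. indicator U (Z \<omega>) :: real) -` {1} \<inter> space M \<in> sets M"
    by (rule measurable_sets) simp
  moreover have "(\<lambda>\<omega>. indicator U (Z \<omega>) :: real) -` {1} \<inter> space M = Z -` U \<inter> space M"
    by (auto simp: indicator_def)
  ultimately show "Z -` U \<inter> space M \<in> sets M" by simp
qed

subsection \<open>The uniform metric\<close>

lemma mdist_C01_le:
  assumes "f \<in> mspace C01" "g \<in> mspace C01" "\<And>s. 0 \<le> s \<Longrightarrow> s \<le> 1 \<Longrightarrow> \<bar>f s - g s\<bar> \<le> B"
  shows "mdist C01 f g \<le> B"
  unfolding mdist_C01[OF assms(1,2)] by (intro cSUP_least) (use assms in auto)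

lemma abs_diff_le_mdist_C01:
  assumes f: "f \<in> mspace C01" and g: "g \<in> mspace C01" and s: "0 \<le> s" "s \<le> 1"
  shows "\<bar>f s - g s\<bar> \<le> mdist C01 f g"
  unfolding mdist_C01[OF assms(1,2)]
proof (rule cSUP_upper)
  have "continuous_on {0..1} (\<lambda>s. \<bar>f s - g s\<bar>)"
    using f g by (intro continuous_intros) (auto simp: mspace_C01)
  then have "compact ((\<lambda>s. \<bar>f s - g s\<bar>) ` {0..1})" by (intro compact_continuous_image) auto
  then show "bdd_above ((\<lambda>s. \<bar>f s - g s\<bar>) ` {0..1})"
    by (intro bounded_imp_bdd_above compact_imp_bounded)
qed (use s in auto)

lemma C01_tendstoI:
  assumes F: "continuous_map (mtopology_of C01) euclideanreal F"
    and f: "f \<in> mspace C01" and fn: "\<And>n. fn n \<in> mspace C01"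
    and lim: "\<And>e. 0 < e \<Longrightarrow> \<forall>\<^sub>F n in sequentially. \<forall>s\<in>{0..1}. \<bar>fn n s - f s\<bar> < e"
  shows "(\<lambda>n. F (fn n)) \<longlonglongrightarrow> F f"
proof -
  interpret C: Metric_space "mspace C01" "mdist C01" by (rule Metric_space_mspace_mdist)
  have "limitin (mtopology_of C01) fn f sequentially"
    unfolding mtopology_of_def C.limitin_metric
  proof (intro conjI allI impI f)
    fix e :: real assume e: "0 < e"
    from lim[of "e/2"] e have "\<forall>\<^sub>F n in sequentially. \<forall>s\<in>{0..1}. \<bar>fn n s - f s\<bar> < e/2" by simp
    then show "\<forall>\<^sub>F n in sequentially. fn n \<in> mspace C01 \<and> mdist C01 (fn n) f < e"
    proof eventually_elim
      case (elim n)
      then have "mdist C01 (fn n) f \<le> e/2"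
        by (intro mdist_C01_le fn f) (auto intro: less_imp_le)
      with e fn show ?case by auto
    qed
  qed
  from continuous_map_limit[OF F this] show ?thesis by (simp add: o_def)
qed

lemma measurable_eval_C01:
  assumes "0 \<le> s" "s \<le> 1"
  shows "(\<lambda>f. f s) \<in> borel_measurable borel_C01"
  by (intro borel_measurable_continuous_map continuous_map_metric_real_Lipschitz[where B = 1])
    (use abs_diff_le_mdist_C01[OF _ _ assms] in \<open>force simp: abs_le_iff\<close>)

definition psup :: "(real \<Rightarrow> real) \<Rightarrow> real" where
  "psup f = (SUP s\<in>{0..1}. f s)"

lemma psup_attained:
  assumes "f \<in> mspace C01"
  obtains s where "0 \<le> s" "s \<le> 1" "psup f = f s" "\<And>r. 0 \<le> r \<Longrightarrow> r \<le> 1 \<Longrightarrow> f r \<le> psup f"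
proof -
  have c: "continuous_on {0..1} f" using assms by (simp add: mspace_C01)
  obtain s where s: "s \<in> {0..1}" "\<forall>r\<in>{0..1}. f r \<le> f s"
    using continuous_attains_sup[of "{0..1}" f] c by auto
  have "psup f = f s" unfolding psup_def by (rule cSup_eq_maximum) (use s in auto)
  with s that[of s] show ?thesis by auto
qed

lemma psup_le: "f \<in> mspace C01 \<Longrightarrow> (\<And>r. 0 \<le> r \<Longrightarrow> r \<le> 1 \<Longrightarrow> f r \<le> c) \<Longrightarrow> psup f \<le> c"
  by (metis psup_attained)

lemma le_psup: "f \<in> mspace C01 \<Longrightarrow> 0 \<le> r \<Longrightarrow> r \<le> 1 \<Longrightarrow> f r \<le> psup f"
  by (metis psup_attained)

lemma continuous_map_psup: "continuous_map (mtopology_of C01) euclideanreal psup"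
proof (rule continuous_map_metric_real_Lipschitz[where B = 1])
  fix f g assume fg: "f \<in> mspace C01" "g \<in> mspace C01"
  have "psup f \<le> psup g + mdist C01 f g"
  proof (rule psup_le[OF fg(1)])
    fix r :: real assume r: "0 \<le> r" "r \<le> 1"
    show "f r \<le> psup g + mdist C01 f g"
      using abs_diff_le_mdist_C01[OF fg r] le_psup[OF fg(2) r] by (simp add: abs_le_iff)
  qed
  then show "psup f - psup g \<le> 1 * mdist C01 f g" by simp
qed

lemmas measurable_psup [measurable] = borel_measurable_continuous_map[OF continuous_map_psup]

subsection \<open>Bernstein approximation of paths\<close>

text \<open>Fed with the values of a path at \<open>k / n\<close>, it approximates the path
  uniformly while depending on finitely many values. Path functionals thereby become functions of
  finitely many Gaussian increments.\<close>

definition bernstein_path :: "nat \<Rightarrow> (nat \<Rightarrow> real) \<Rightarrow> real \<Rightarrow> real" where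
  "bernstein_path n v = (\<lambda>s\<in>{0..1}. \<Sum>k\<le>n. v k * Bernstein n k s)"

lemma bernstein_path_in_C01: "bernstein_path n v \<in> mspace C01"
proof -
  have "continuous_on {0..1} (\<lambda>s. \<Sum>k\<le>n. v k * Bernstein n k s)"
    unfolding Bernstein_def by (intro continuous_intros)
  then show ?thesis
    unfolding mspace_C01 bernstein_path_def
    by (auto cong: continuous_on_cong_simp)
qed

lemma bernstein_path_tendsto:
  assumes F: "continuous_map (mtopology_of C01) euclideanreal F" and f: "f \<in> mspace C01"
  shows "(\<lambda>n. F (bernstein_path n (\<lambda>k. f (real k / real n)))) \<longlonglongrightarrow> F f"
proof (rule C01_tendstoI[OF F f bernstein_path_in_C01])
  fix e :: real assume e: "0 < e"
  have "continuous_on {0..1} f" using f by (simp add: mspace_C01)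
  from Bernstein_Weierstrass[OF this e] obtain N where
    N: "\<And>n x. N \<le> n \<Longrightarrow> x \<in> {0..1} \<Longrightarrow> \<bar>f x - (\<Sum>k\<le>n. f(k/n) * Bernstein n k x)\<bar> < e" by blast
  show "\<forall>\<^sub>F n in sequentially. \<forall>s\<in>{0..1}. \<bar>bernstein_path n (\<lambda>k. f (real k / real n)) s - f s\<bar> < e"
    unfolding eventually_sequentially
    by (intro exI[of _ N]) (use N in \<open>auto simp: bernstein_path_def abs_minus_commute\<close>)
qed

lemma bernstein_path_cong: "(\<And>k. k \<le> n \<Longrightarrow> v k = w k) \<Longrightarrow> bernstein_path n v = bernstein_path n w"
  by (simp add: bernstein_path_def)

text \<open>The Bernstein weights lie between 0 and 1, so the uniform distance of two such paths is
  at most the sum of the coefficient differences. Hence the path depends continuously on its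
  coefficients in the product topology.\<close>

lemma measurable_bernstein_path:
  assumes F: "continuous_map (mtopology_of C01) euclideanreal F"
    and v: "\<And>k. k \<le> n \<Longrightarrow> (\<lambda>\<omega>. v \<omega> k) \<in> borel_measurable M"
  shows "(\<lambda>\<omega>. F (bernstein_path n (v \<omega>))) \<in> borel_measurable M"
proof -
  interpret C: Metric_space "mspace C01" "mdist C01" by (rule Metric_space_mspace_mdist)
  have "continuous_map euclidean (mtopology_of C01) (bernstein_path n)"
    unfolding mtopology_of_def C.continuous_map_to_metric
  proof (intro ballI allI impI)
    fix v :: "nat \<Rightarrow> real" and e :: real assume e: "0 < e"
    let ?U = "{w. (\<Sum>k\<le>n. \<bar>v k - w k\<bar>) < e}"
    have "continuous_on UNIV (\<lambda>w :: nat \<Rightarrow> real. (\<Sum>k\<le>n. \<bar>v k - w k\<bar>))"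
      by (intro continuous_intros continuous_on_product_coordinates)
    then have "open ?U" by (intro open_Collect_less) auto
    moreover have "bernstein_path n w \<in> C.mball (bernstein_path n v) e" if w: "w \<in> ?U" for w
    proof -
      have "mdist C01 (bernstein_path n v) (bernstein_path n w) \<le> (\<Sum>k\<le>n. \<bar>v k - w k\<bar>)"
      proof (intro mdist_C01_le bernstein_path_in_C01)
        fix s :: real assume s: "0 \<le> s" "s \<le> 1"
        have B: "0 \<le> Bernstein n k s" "Bernstein n k s \<le> 1" if "k \<le> n" for k
          using sum_Bernstein[of n s] member_le_sum[of k "{..n}" "\<lambda>k. Bernstein n k s"] s that
          by (auto simp: Bernstein_nonneg)
        have "\<bar>bernstein_path n v s - bernstein_path n w s\<bar> = \<bar>\<Sum>k\<le>n. (v k - w k) * Bernstein n k s\<bar>"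
          using s by (simp add: bernstein_path_def sum_subtractf left_diff_distrib)
        also have "\<dots> \<le> (\<Sum>k\<le>n. \<bar>(v k - w k) * Bernstein n k s\<bar>)" by (rule sum_abs)
        also have "\<dots> \<le> (\<Sum>k\<le>n. \<bar>v k - w k\<bar>)"
          using B by (intro sum_mono) (auto simp: abs_mult intro!: mult_left_le)
        finally show "\<bar>bernstein_path n v s - bernstein_path n w s\<bar> \<le> (\<Sum>k\<le>n. \<bar>v k - w k\<bar>)" .
      qed
      with w show ?thesis by (auto simp: C.in_mball bernstein_path_in_C01)
    qed
    ultimately show "\<exists>U. openin euclidean U \<and> v \<in> U \<and> (\<forall>w\<in>U. bernstein_path n w \<in> C.mball (bernstein_path n v) e)"
      using e by (intro exI[of _ ?U]) auto
  qed
  from continuous_map_compose[OF this F]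
  have cont: "continuous_on UNIV (\<lambda>v. F (bernstein_path n v))" by (simp add: o_def)
  \<comment> \<open>Coordinates above \<open>n\<close> are replaced by 0, since measurability is
    given only up to \<open>n\<close>.\<close>
  have "(\<lambda>\<omega> k. if k \<le> n then v \<omega> k else 0) \<in> borel_measurable M"
  proof (rule measurable_coordinatewise_then_product)
    show "(\<lambda>\<omega>. if k \<le> n then v \<omega> k else 0) \<in> borel_measurable M" for k
      using v[of k] by (cases "k \<le> n") auto
  qed
  from measurable_compose[OF this borel_measurable_continuous_onI[OF cont]]
  have "(\<lambda>\<omega>. F (bernstein_path n (\<lambda>k. if k \<le> n then v \<omega> k else 0))) \<in> borel_measurable M" .
  also have "(\<lambda>\<omega>. bernstein_path n (\<lambda>k. if k \<le> n then v \<omega> k else 0)) = (\<lambda>\<omega>. bernstein_path n (v \<omega>))"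
    by (intro ext bernstein_path_cong) auto
  then have "(\<lambda>\<omega>. F (bernstein_path n (\<lambda>k. if k \<le> n then v \<omega> k else 0))) = (\<lambda>\<omega>. F (bernstein_path n (v \<omega>)))"
    by metis
  finally show ?thesis .
qed

text \<open>A continuous functional of the path is a limit of functions of finitely many
  evaluations, by Bernstein approximation. Evaluations therefore determine the Borel sets of the
  uniform topology.\<close>

lemma measurable_C01I:
  assumes Z: "\<And>\<omega>. \<omega> \<in> space M \<Longrightarrow> Z \<omega> \<in> mspace C01"
    and meas: "\<And>s. 0 \<le> s \<Longrightarrow> s \<le> 1 \<Longrightarrow> (\<lambda>\<omega>. Z \<omega> s) \<in> borel_measurable M"
  shows "Z \<in> measurable M borel_C01"
proof (rule measurable_borel_ofI[OF Z])
  fix F assume F: "continuous_map (mtopology_of C01) euclideanreal F"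
  show "(\<lambda>\<omega>. F (Z \<omega>)) \<in> borel_measurable M"
  proof (rule borel_measurable_LIMSEQ_real[where u = "\<lambda>n \<omega>. F (bernstein_path n (\<lambda>k. Z \<omega> (real k / real n)))"])
    show "(\<lambda>n. F (bernstein_path n (\<lambda>k. Z \<omega> (real k / real n)))) \<longlonglongrightarrow> F (Z \<omega>)" if "\<omega> \<in> space M" for \<omega>
      by (rule bernstein_path_tendsto[OF F Z[OF that]])
    show "(\<lambda>\<omega>. F (bernstein_path n (\<lambda>k. Z \<omega> (real k / real n)))) \<in> borel_measurable M" for n
      by (rule measurable_bernstein_path[OF F]) (auto intro!: meas simp: divide_le_eq_1)
  qed
qed

text \<open>The factorisation is upgraded from continuous functions to indicators one factor at a
  time. The factor held fixed serves as a density, so each upgrade is an equality of two finite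
  measures tested on continuous functions of the other variable.\<close>

lemma (in prob_space) pair_law_eqI:
  fixes m :: "'b metric"
  defines "B \<equiv> borel_of (mtopology_of m)"
  assumes Z [measurable]: "Z \<in> measurable M B" and Z' [measurable]: "Z' \<in> measurable M B"
    and eq: "\<And>F G. continuous_map (mtopology_of m) euclideanreal F \<Longrightarrow>
      continuous_map (mtopology_of m) euclideanreal G \<Longrightarrow>
      (\<And>x. 0 \<le> F x) \<Longrightarrow> (\<And>x. F x \<le> 1) \<Longrightarrow> (\<And>x. 0 \<le> G x) \<Longrightarrow> (\<And>x. G x \<le> 1) \<Longrightarrow>
      (\<integral>\<^sup>+\<omega>. ennreal (F (Z \<omega>)) * ennreal (G (Z' \<omega>)) \<partial>M) =
      (\<integral>\<^sup>+\<omega>. ennreal (F (Z \<omega>)) \<partial>M) * (\<integral>\<^sup>+\<omega>. ennreal (G (Z' \<omega>)) \<partial>M)"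
  shows "distr M (B \<Otimes>\<^sub>M B) (\<lambda>\<omega>. (Z \<omega>, Z' \<omega>)) = distr M B Z \<Otimes>\<^sub>M distr M B Z'"
proof -
  let ?T = "mtopology_of m"
  have meas: "(\<lambda>x. ennreal (F x)) \<in> borel_measurable B" if "continuous_map ?T euclideanreal F" for F
    using borel_measurable_continuous_map[OF that] by (simp add: B_def)
  have meas0: "F \<in> borel_measurable B" if "continuous_map ?T euclideanreal F" for F
    using borel_measurable_continuous_map[OF that] by (simp add: B_def)
  have bnd: "(\<integral>\<^sup>+\<omega>. f \<omega> \<partial>M) < \<infinity>" if "\<And>\<omega>. f \<omega> \<le> 1" for f
  proof -
    have "(\<integral>\<^sup>+\<omega>. f \<omega> \<partial>M) \<le> (\<integral>\<^sup>+\<omega>. 1 \<partial>M)" by (intro nn_integral_mono that)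
    then show ?thesis by (simp add: emeasure_space_1 order_le_less_trans)
  qed
  have fin: "finite_measure (distr (density M f) B V)" "finite_measure (scale_measure (\<integral>\<^sup>+\<omega>. f \<omega> \<partial>M) (distr M B V))"
    if [measurable]: "f \<in> borel_measurable M" "V \<in> measurable M B" and le: "\<And>\<omega>. f \<omega> \<le> 1" for f V
  proof -
    show "finite_measure (distr (density M f) B V)"
    proof (intro finite_measure.finite_measure_distr finite_measureI)
      show "emeasure (density M f) (space (density M f)) \<noteq> \<infinity>"
        using bnd[of f] le by (simp add: emeasure_density cong: nn_integral_cong)
    qed simp
    have "emeasure (distr M B V) (space (distr M B V)) = 1"
      using prob_space.emeasure_space_1[OF prob_space_distr[OF that(2)]] .
    then show "finite_measure (scale_measure (\<integral>\<^sup>+\<omega>. f \<omega> \<partial>M) (distr M B V))"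
      using bnd[of f] le by (intro finite_measureI) (simp add: space_scale_measure top.not_eq_extremum)
  qed
  have step1: "(\<integral>\<^sup>+\<omega>. indicator A (Z \<omega>) * ennreal (G (Z' \<omega>)) \<partial>M) =
      emeasure (distr M B Z) A * (\<integral>\<^sup>+\<omega>. ennreal (G (Z' \<omega>)) \<partial>M)"
    if A: "A \<in> sets B" and G: "continuous_map ?T euclideanreal G" "\<And>x. 0 \<le> G x" "\<And>x. G x \<le> 1" for A G
  proof -
    note [measurable] = meas0[OF G(1)] A
    have "distr (density M (\<lambda>\<omega>. ennreal (G (Z' \<omega>)))) B Z =
        scale_measure (\<integral>\<^sup>+\<omega>. ennreal (G (Z' \<omega>)) \<partial>M) (distr M B Z)"
    proof (rule measure_eqI_continuous[where m = m])
      fix F :: "'b \<Rightarrow> real" assume F: "continuous_map ?T euclideanreal F" "\<And>x. 0 \<le> F x" "\<And>x. F x \<le> 1"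
      note [measurable] = meas[OF F(1)]
      show "(\<integral>\<^sup>+x. ennreal (F x) \<partial>distr (density M (\<lambda>\<omega>. ennreal (G (Z' \<omega>)))) B Z) =
        (\<integral>\<^sup>+x. ennreal (F x) \<partial>scale_measure (\<integral>\<^sup>+\<omega>. ennreal (G (Z' \<omega>)) \<partial>M) (distr M B Z))"
        using eq[OF F(1) G(1) F(2,3) G(2,3)]
        by (simp add: nn_integral_distr nn_integral_density nn_integral_scale_measure mult.commute)
    qed (use G in \<open>auto simp: B_def[symmetric] ennreal_le_1 intro!: fin\<close>)
    from arg_cong[OF this, of "\<lambda>R. emeasure R A"] show ?thesis
      by (simp add: emeasure_distr emeasure_density mult.commute space_density
          indicator_vimage[symmetric] vimage_Int indicator_inter_arith
          cong: nn_integral_cong_simp)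
  qed
  have step2: "emeasure (distr M B Z) A * emeasure (distr M B Z') C =
      (\<integral>\<^sup>+\<omega>. indicator A (Z \<omega>) * indicator C (Z' \<omega>) \<partial>M)"
    if A: "A \<in> sets B" and C: "C \<in> sets B" for A C
  proof -
    note [measurable] = A C
    have "distr (density M (\<lambda>\<omega>. indicator A (Z \<omega>))) B Z' =
        scale_measure (\<integral>\<^sup>+\<omega>. indicator A (Z \<omega>) \<partial>M) (distr M B Z')"
    proof (rule measure_eqI_continuous[where m = m])
      fix F :: "'b \<Rightarrow> real" assume F: "continuous_map ?T euclideanreal F" "\<And>x. 0 \<le> F x" "\<And>x. F x \<le> 1"
      note [measurable] = meas[OF F(1)]
      have "(\<integral>\<^sup>+\<omega>. indicator A (Z \<omega>) \<partial>M) = emeasure (distr M B Z) A"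
      proof -
        have "emeasure (distr M B Z) A = (\<integral>\<^sup>+x. indicator A x \<partial>distr M B Z)" by simp
        also have "\<dots> = (\<integral>\<^sup>+\<omega>. indicator A (Z \<omega>) \<partial>M)" by (subst nn_integral_distr) auto
        finally show ?thesis by simp
      qed
      then show "(\<integral>\<^sup>+x. ennreal (F x) \<partial>distr (density M (\<lambda>\<omega>. indicator A (Z \<omega>))) B Z') =
        (\<integral>\<^sup>+x. ennreal (F x) \<partial>scale_measure (\<integral>\<^sup>+\<omega>. indicator A (Z \<omega>) \<partial>M) (distr M B Z'))"
        using step1[OF A F]
        by (simp add: nn_integral_distr nn_integral_density nn_integral_scale_measure)
    qed (auto simp: B_def[symmetric] indicator_def intro!: fin)
    from arg_cong[OF this, of "\<lambda>R. \<integral>\<^sup>+x. indicator C x \<partial>R"]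
    have "(\<integral>\<^sup>+\<omega>. indicator A (Z \<omega>) * indicator C (Z' \<omega>) \<partial>M) =
        (\<integral>\<^sup>+\<omega>. indicator A (Z \<omega>) \<partial>M) * emeasure (distr M B Z') C"
      using A C by (subst (asm) nn_integral_distr) (auto simp: nn_integral_density)
    moreover have "(\<integral>\<^sup>+\<omega>. indicator A (Z \<omega>) \<partial>M) = (\<integral>\<^sup>+x. indicator A x \<partial>distr M B Z)"
      by (subst nn_integral_distr) auto
    ultimately show ?thesis by simp
  qed
  show ?thesis
  proof (rule pair_measure_eqI[symmetric])
    show "sigma_finite_measure (distr M B Z)" "sigma_finite_measure (distr M B Z')"
      by (auto intro!: prob_space_imp_sigma_finite prob_space_distr)
    fix A C assume "A \<in> sets (distr M B Z)" "C \<in> sets (distr M B Z')"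
    then have [measurable]: "A \<in> sets B" "C \<in> sets B" by auto
    have "emeasure (distr M (B \<Otimes>\<^sub>M B) (\<lambda>\<omega>. (Z \<omega>, Z' \<omega>))) (A \<times> C) =
       (\<integral>\<^sup>+x. indicator (A \<times> C) x \<partial>distr M (B \<Otimes>\<^sub>M B) (\<lambda>\<omega>. (Z \<omega>, Z' \<omega>)))"
      by simp
    also have "\<dots> = (\<integral>\<^sup>+\<omega>. indicator A (Z \<omega>) * indicator C (Z' \<omega>) \<partial>M)"
      by (subst nn_integral_distr) (auto simp: indicator_times)
    finally show "emeasure (distr M B Z) A * emeasure (distr M B Z') C =
        emeasure (distr M (B \<Otimes>\<^sub>M B) (\<lambda>\<omega>. (Z \<omega>, Z' \<omega>))) (A \<times> C)"
      using step2[of A C] by simp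
  qed simp
qed

section \<open>Rescaled segments of Brownian motion\<close>

abbreviation std_gauss :: "real measure" where
  "std_gauss \<equiv> density lborel (\<lambda>x. ennreal (std_normal_density x))"

text \<open>The values on the grid \<open>k / n\<close> of a path with normalised increments \<open>v\<close>.\<close>

definition walk :: "nat \<Rightarrow> (nat \<Rightarrow> real) \<Rightarrow> nat \<Rightarrow> real" where
  "walk n v k = (\<Sum>i<k. v i) / sqrt (real n)"

lemma measurable_bernstein_walk:
  assumes F: "continuous_map (mtopology_of C01) euclideanreal F"
  shows "(\<lambda>v. F (bernstein_path n (walk n (\<lambda>i. v (j + i))))) \<in> borel_measurable (PiM {j..<j + n} (\<lambda>_. borel))"
proof (rule measurable_bernstein_path[OF F])
  fix k assume k: "k \<le> n"
  have "(\<lambda>v. v (j + i)) \<in> borel_measurable (PiM {j..<j + n} (\<lambda>_. borel :: real measure))" if "i < k" for i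
    using that k by (intro measurable_component_singleton) auto
  then show "(\<lambda>v. walk n (\<lambda>i. v (j + i)) k) \<in> borel_measurable (PiM {j..<j + n} (\<lambda>_. borel))"
    unfolding walk_def by (intro borel_measurable_divide borel_measurable_sum) auto
qed

context standard_brownian_motion
begin

text \<open>Brownian scaling is built in: for \<open>h > 0\<close> the law depends neither on
  \<open>s\<close> nor on \<open>h\<close>. Subtracting \<open>X s\<close> makes segments over
  adjacent intervals independent. With \<open>s = 0\<close> and \<open>h\<close> the hitting time it
  agrees almost surely with the path in the theorem.\<close>

definition seg :: "real \<Rightarrow> real \<Rightarrow> 'a \<Rightarrow> real \<Rightarrow> real" where
  "seg s h \<omega> = (\<lambda>r\<in>{0..1}. (X (s + h * r) \<omega> - X s \<omega>) / sqrt h)"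

lemma seg_in_C01:
  assumes "\<omega> \<in> space M" "0 \<le> s" "0 \<le> h"
  shows "seg s h \<omega> \<in> mspace C01"
proof -
  have "continuous_on {0..1} (\<lambda>r. X (s + h * r) \<omega>)"
    by (rule continuous_on_compose2[OF continuous_paths[OF assms(1)]])
      (use assms in \<open>auto intro!: continuous_intros\<close>)
  then have "continuous_on {0..1} (\<lambda>r. (X (s + h * r) \<omega> - X s \<omega>) / sqrt h)"
    unfolding divide_inverse by (intro continuous_intros)
  then show ?thesis by (simp add: mspace_C01 seg_def cong: continuous_on_cong_simp)
qed

lemma measurable_seg:
  assumes "0 \<le> s" "0 \<le> h"
  shows "seg s h \<in> measurable M borel_C01"
proof (rule measurable_C01I)
  fix r :: real assume "0 \<le> r" "r \<le> 1"
  then show "(\<lambda>\<omega>. seg s h \<omega> r) \<in> borel_measurable M"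
    using assms rv by (simp add: seg_def)
qed (use assms seg_in_C01 in auto)

definition incr :: "(nat \<Rightarrow> real) \<Rightarrow> nat \<Rightarrow> 'a \<Rightarrow> real" where
  "incr u i \<omega> = (X (u (Suc i)) \<omega> - X (u i) \<omega>) / sqrt (u (Suc i) - u i)"

lemma indep_incr:
  assumes "0 \<le> u 0" "\<And>i. i < K \<Longrightarrow> u i < u (Suc i)"
  shows "indep_vars (\<lambda>_. borel) (incr u) {..<K}"
proof -
  have "indep_vars (\<lambda>_. borel) (\<lambda>i \<omega>. X (u (Suc i)) \<omega> - X (u i) \<omega>) {..<K}"
    by (rule indep_increments) (use assms in \<open>auto intro: less_imp_le\<close>)
  from indep_vars_compose2[OF this, where Y = "\<lambda>i x. x / sqrt (u (Suc i) - u i)" and N = "\<lambda>_. borel"]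
  show ?thesis by (simp add: incr_def[abs_def])
qed

lemma incr_law:
  assumes "0 \<le> u i" "u i < u (Suc i)"
  shows "distr M borel (incr u i) = std_gauss"
proof -
  let ?\<sigma> = "sqrt (u (Suc i) - u i)"
  have "distributed M lborel (\<lambda>\<omega>. 0 + (1 / ?\<sigma>) * (X (u (Suc i)) \<omega> - X (u i) \<omega>))
      (normal_density (0 + (1 / ?\<sigma>) * 0) (\<bar>1 / ?\<sigma>\<bar> * ?\<sigma>))"
    by (rule normal_density_affine[OF normal_increments[OF assms]]) (use assms in auto)
  then have "distributed M lborel (incr u i) (\<lambda>x. ennreal (std_normal_density x))"
    using assms by (simp add: incr_def[abs_def])
  from distributed_distr_eq_density[OF this] show ?thesis
    by (metis distr_cong sets_lborel)
qed

lemma seg_grid: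
  assumes n: "0 < n" and h: "0 < h" and u: "\<And>i. i \<le> n \<Longrightarrow> u (j + i) = s + h * (real i / real n)"
    and k: "k \<le> n"
  shows "seg s h \<omega> (real k / real n) = walk n (\<lambda>i. incr u (j + i) \<omega>) k"
proof -
  have "incr u (j + i) \<omega> / sqrt (real n) =
      (X (s + h * (real (Suc i) / real n)) \<omega> - X (s + h * (real i / real n)) \<omega>) / sqrt h" if "i < k" for i
  proof -
    have "u (Suc (j + i)) = s + h * (real (Suc i) / real n)" "u (j + i) = s + h * (real i / real n)"
      using u[of "Suc i"] u[of i] that k by auto
    moreover have "h * (real (Suc i) / real n) - h * (real i / real n) = h / real n"
      using n by (simp add: add_divide_distrib ring_distribs)
    ultimately show ?thesis using n by (simp add: incr_def real_sqrt_divide)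
  qed
  then have "walk n (\<lambda>i. incr u (j + i) \<omega>) k =
      (\<Sum>i<k. X (s + h * (real (Suc i) / real n)) \<omega> - X (s + h * (real i / real n)) \<omega>) / sqrt h"
    by (simp add: walk_def sum_divide_distrib)
  also have "\<dots> = (X (s + h * (real k / real n)) \<omega> - X s \<omega>) / sqrt h"
    by (subst sum_lessThan_telescope) simp
  also have "\<dots> = seg s h \<omega> (real k / real n)"
    using k n by (simp add: seg_def)
  finally show ?thesis by simp
qed

definition grid_fun :: "((real \<Rightarrow> real) \<Rightarrow> real) \<Rightarrow> nat \<Rightarrow> real \<Rightarrow> real \<Rightarrow> 'a \<Rightarrow> real" where
  "grid_fun F n s h \<omega> = F (bernstein_path n (\<lambda>k. seg s h \<omega> (real k / real n)))"

lemma measurable_grid_fun: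
  assumes "continuous_map (mtopology_of C01) euclideanreal F" "0 \<le> s" "0 \<le> h"
  shows "grid_fun F n s h \<in> borel_measurable M"
  unfolding grid_fun_def
proof (rule measurable_bernstein_path[OF assms(1)])
  fix k assume "k \<le> n"
  then show "(\<lambda>\<omega>. seg s h \<omega> (real k / real n)) \<in> borel_measurable M"
    by (intro measurable_compose[OF measurable_seg measurable_eval_C01] assms)
      (auto simp: divide_le_eq_1)
qed

lemma grid_fun_eq:
  assumes n: "0 < n" and h: "0 < h" and u: "\<And>i. i \<le> n \<Longrightarrow> u (j + i) = s + h * (real i / real n)"
  shows "grid_fun F n s h \<omega> = F (bernstein_path n (walk n (\<lambda>i. (\<lambda>i\<in>{j..<j + n}. incr u i \<omega>) (j + i))))"
  unfolding grid_fun_def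
proof (intro arg_cong[of _ _ F] bernstein_path_cong)
  fix k assume k: "k \<le> n"
  have "seg s h \<omega> (real k / real n) = walk n (\<lambda>i. incr u (j + i) \<omega>) k"
    by (rule seg_grid[OF n h u k])
  then show "seg s h \<omega> (real k / real n) = walk n (\<lambda>i. (\<lambda>i\<in>{j..<j + n}. incr u i \<omega>) (j + i)) k"
    using k by (simp add: walk_def)
qed

text \<open>Normalised increments are independent standard Gaussians whatever \<open>s\<close> and
  \<open>h\<close> are, and neither parameter occurs on the right. This yields stationarity and
  Brownian scaling at once.\<close>

lemma nn_integral_grid_fun:
  assumes n: "0 < n" and s: "0 \<le> s" and h: "0 < h"
    and F: "continuous_map (mtopology_of C01) euclideanreal F"
  shows "(\<integral>\<^sup>+\<omega>. ennreal (grid_fun F n s h \<omega>) \<partial>M) =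
    (\<integral>\<^sup>+v. ennreal (F (bernstein_path n (walk n v))) \<partial>PiM {..<n} (\<lambda>_. std_gauss))"
proof -
  define u where "u = (\<lambda>i. s + h * (real i / real n))"
  have u: "u i < u (Suc i)" "0 \<le> u i" for i using n s h by (auto simp: u_def field_simps)
  let ?V = "\<lambda>\<omega>. \<lambda>i\<in>{..<n}. incr u i \<omega>"
  have rv': "random_variable borel (incr u i)" for i
    using rv u unfolding incr_def by simp
  have ind: "indep_vars (\<lambda>_. borel) (incr u) {..<n}"
    by (rule indep_incr) (use u in auto)
  have "distr M (PiM {..<n} (\<lambda>_. borel)) ?V = PiM {..<n} (\<lambda>i. distr M borel (incr u i))"
    using indep_vars_iff_distr_eq_PiM[where I = "{..<n}" and M' = "\<lambda>_. borel" and X = "incr u"] ind rv' n by auto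
  also have "\<dots> = PiM {..<n} (\<lambda>i. std_gauss)"
    using incr_law u by (intro PiM_cong) auto
  finally have law: "distr M (PiM {..<n} (\<lambda>_. borel)) ?V = PiM {..<n} (\<lambda>i. std_gauss)" .
  have m: "(\<lambda>v. F (bernstein_path n (walk n v))) \<in> borel_measurable (PiM {..<n} (\<lambda>_. borel))"
    using measurable_bernstein_walk[OF F, of n 0] by (simp add: atLeast0LessThan)
  have mV: "?V \<in> measurable M (PiM {..<n} (\<lambda>_. borel))"
    by (intro measurable_restrict rv')
  have "(\<integral>\<^sup>+v. ennreal (F (bernstein_path n (walk n v))) \<partial>PiM {..<n} (\<lambda>_. std_gauss)) =
      (\<integral>\<^sup>+\<omega>. ennreal (F (bernstein_path n (walk n (?V \<omega>)))) \<partial>M)"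
    unfolding law[symmetric] using m mV by (subst nn_integral_distr) auto
  also have "\<dots> = (\<integral>\<^sup>+\<omega>. ennreal (grid_fun F n s h \<omega>) \<partial>M)"
  proof -
    have "u (0 + i) = s + h * (real i / real n)" for i by (simp add: u_def)
    then have "grid_fun F n s h \<omega> = F (bernstein_path n (walk n (?V \<omega>)))" for \<omega>
      using grid_fun_eq[OF n h, of u 0 s F \<omega>] by (simp only: add_0 atLeast0LessThan)
    then show ?thesis by simp
  qed
  finally show ?thesis by simp
qed

text \<open>Both discretised segments are functions of disjoint blocks of increments of one common
  grid.\<close>

lemma indep_grid_fun:
  assumes n: "0 < n" and t: "0 < t" and h: "0 < h"
    and F: "continuous_map (mtopology_of C01) euclideanreal F" "continuous_map (mtopology_of C01) euclideanreal G"
  shows "indep_var borel (grid_fun F n 0 t) borel (grid_fun G n t h)"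
proof -
  \<comment> \<open>The grid takes \<open>n\<close> steps of length \<open>t / n\<close> and then
    steps of length \<open>h / n\<close>; the normalisation in \<open>incr\<close> absorbs the
    change of step length.\<close>
  define u where "u = (\<lambda>i. if i \<le> n then t * (real i / real n) else t + h * (real (i - n) / real n))"
  have u_step: "u i < u (Suc i)" for i
  proof -
    consider "Suc i \<le> n" | "i = n" | "i > n" by linarith
    then show ?thesis
    proof cases
      case 3
      then have "real (Suc i - n) = real (i - n) + 1" by simp
      with 3 show ?thesis using n h by (simp add: u_def divide_strict_right_mono)
    qed (use n t h in \<open>auto simp: u_def field_simps\<close>)
  qed
  have u: "u (0 + i) = 0 + t * (real i / real n)" "u (n + i) = t + h * (real i / real n)" if "i \<le> n" for i
    using that n by (auto simp: u_def)
  let ?I = "\<lambda>j \<omega>. \<lambda>i\<in>{j..<j + n}. incr u i \<omega>"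
  let ?B = "\<lambda>j. PiM {j..<j + n} (\<lambda>_. borel :: real measure)"
  have "indep_vars (\<lambda>_. borel) (incr u) {..<n + n}"
    by (rule indep_incr) (use u_step in \<open>auto simp: u_def\<close>)
  then have "indep_var (?B 0) (?I 0) (?B n) (?I n)"
    by (rule indep_var_restrict) auto
  from indep_var_compose[OF this measurable_bernstein_walk[OF F(1)] measurable_bernstein_walk[OF F(2)]]
  show ?thesis
    by (simp only: comp_def grid_fun_eq[OF n t u(1), symmetric] grid_fun_eq[OF n h u(2), symmetric])
qed

lemma grid_fun_tendsto:
  assumes F: "continuous_map (mtopology_of C01) euclideanreal F"
    and "\<omega> \<in> space M" "0 \<le> s" "0 \<le> h"
  shows "(\<lambda>n. grid_fun F n s h \<omega>) \<longlonglongrightarrow> F (seg s h \<omega>)"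
  unfolding grid_fun_def by (rule bernstein_path_tendsto[OF F seg_in_C01[OF assms(2-)]])

text \<open>Products are treated with the joint law in view; the constant \<open>G = 1\<close> gives
  the laws of single segments.\<close>

lemma nn_integral_grid_fun_tendsto:
  assumes F: "continuous_map (mtopology_of C01) euclideanreal F" "\<And>f. 0 \<le> F f" "\<And>f. F f \<le> 1"
    and G: "continuous_map (mtopology_of C01) euclideanreal G" "\<And>f. 0 \<le> G f" "\<And>f. G f \<le> 1"
    and [simp]: "0 \<le> s" "0 \<le> h" "0 \<le> s'" "0 \<le> h'"
  shows "(\<lambda>n. \<integral>\<^sup>+\<omega>. ennreal (grid_fun F n s h \<omega> * grid_fun G n s' h' \<omega>) \<partial>M) \<longlonglongrightarrow>
    (\<integral>\<^sup>+\<omega>. ennreal (F (seg s h \<omega>) * G (seg s' h' \<omega>)) \<partial>M)"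
proof (rule nn_integral_dominated_convergence[where w = "\<lambda>_. 1"])
  note [measurable] = measurable_seg measurable_grid_fun
    borel_measurable_continuous_map[OF F(1)] borel_measurable_continuous_map[OF G(1)]
  show "(\<lambda>\<omega>. ennreal (grid_fun F n s h \<omega> * grid_fun G n s' h' \<omega>)) \<in> borel_measurable M" for n
    using F G by measurable
  show "(\<lambda>\<omega>. ennreal (F (seg s h \<omega>) * G (seg s' h' \<omega>))) \<in> borel_measurable M"
    by measurable
  show "AE \<omega> in M. ennreal (grid_fun F n s h \<omega> * grid_fun G n s' h' \<omega>) \<le> 1" for n
    using F G by (intro AE_I2) (auto simp: grid_fun_def intro!: mult_le_one)
  show "AE \<omega> in M. (\<lambda>n. ennreal (grid_fun F n s h \<omega> * grid_fun G n s' h' \<omega>)) \<longlonglongrightarrow>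
      ennreal (F (seg s h \<omega>) * G (seg s' h' \<omega>))"
    using F G by (intro AE_I2 tendsto_ennrealI tendsto_mult grid_fun_tendsto) auto
qed (auto simp: emeasure_space_1)

section \<open>Wiener measure and the joint law of adjacent segments\<close>

definition wiener :: "(real \<Rightarrow> real) measure" where
  "wiener = distr M borel_C01 (seg 0 1)"

lemma sets_wiener [simp, measurable_cong]: "sets wiener = sets borel_C01"
  by (simp add: wiener_def)

lemma space_wiener [simp]: "space wiener = mspace C01"
  by (simp add: wiener_def)

lemma prob_space_wiener: "prob_space wiener"
  unfolding wiener_def by (intro prob_space_distr measurable_seg) auto

lemma seg_law:
  assumes s: "0 \<le> s" and h: "0 < h"
  shows "distr M borel_C01 (seg s h) = wiener"
  unfolding wiener_def
proof (rule measure_eqI_continuous[where m = C01])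
  fix F :: "(real \<Rightarrow> real) \<Rightarrow> real"
  assume F: "continuous_map (mtopology_of C01) euclideanreal F" "\<And>x. 0 \<le> F x" "\<And>x. F x \<le> 1"
  note [measurable] = measurable_seg borel_measurable_continuous_map[OF F(1)]
  have lim: "(\<lambda>n. \<integral>\<^sup>+\<omega>. ennreal (grid_fun F n s h \<omega>) \<partial>M) \<longlonglongrightarrow> (\<integral>\<^sup>+\<omega>. ennreal (F (seg s h \<omega>)) \<partial>M)"
    if "0 \<le> s" "0 < h" for s h
    using nn_integral_grid_fun_tendsto[OF F, of "\<lambda>_. 1" s h s h] that by (simp add: grid_fun_def)
  have "(\<lambda>n. \<integral>\<^sup>+\<omega>. ennreal (grid_fun F n s h \<omega>) \<partial>M) \<longlonglongrightarrow> (\<integral>\<^sup>+\<omega>. ennreal (F (seg 0 1 \<omega>)) \<partial>M)"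
  proof (rule Lim_transform_eventually[OF lim])
    show "\<forall>\<^sub>F n in sequentially. (\<integral>\<^sup>+\<omega>. ennreal (grid_fun F n 0 1 \<omega>) \<partial>M) =
        (\<integral>\<^sup>+\<omega>. ennreal (grid_fun F n s h \<omega>) \<partial>M)"
      using eventually_gt_at_top[of 0]
      by eventually_elim (use s h F in \<open>simp add: nn_integral_grid_fun\<close>)
  qed auto
  with lim[OF s h] show "(\<integral>\<^sup>+x. ennreal (F x) \<partial>distr M borel_C01 (seg s h)) =
      (\<integral>\<^sup>+x. ennreal (F x) \<partial>distr M borel_C01 (seg 0 1))"
    using s h by (simp add: nn_integral_distr LIMSEQ_unique)
qed (use s h in \<open>auto intro!: prob_space.finite_measure prob_space_distr measurable_seg\<close>)

text \<open>This is the Markov property at the fixed time \<open>t\<close>. Discretised functionals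
  factorise by independence of increments, and the factorisation survives the limit in the grid
  size.\<close>

lemma seg_joint_law:
  assumes t: "0 < t" and h: "0 < h"
  shows "distr M (borel_C01 \<Otimes>\<^sub>M borel_C01) (\<lambda>\<omega>. (seg 0 t \<omega>, seg t h \<omega>)) = wiener \<Otimes>\<^sub>M wiener"
proof -
  have "distr M (borel_C01 \<Otimes>\<^sub>M borel_C01) (\<lambda>\<omega>. (seg 0 t \<omega>, seg t h \<omega>)) =
      distr M borel_C01 (seg 0 t) \<Otimes>\<^sub>M distr M borel_C01 (seg t h)"
  proof (rule pair_law_eqI)
    show "seg 0 t \<in> measurable M borel_C01" "seg t h \<in> measurable M borel_C01"
      using t h by (auto intro!: measurable_seg)
    fix F G :: "(real \<Rightarrow> real) \<Rightarrow> real"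
    assume F: "continuous_map (mtopology_of C01) euclideanreal F"
      and G: "continuous_map (mtopology_of C01) euclideanreal G"
      and bnd: "\<And>x. 0 \<le> F x" "\<And>x. F x \<le> 1" "\<And>x. 0 \<le> G x" "\<And>x. G x \<le> 1"
    let ?E = "\<lambda>F n s h. \<integral>\<^sup>+\<omega>. ennreal (grid_fun F n s h \<omega>) \<partial>M"
    have prod: "(\<integral>\<^sup>+\<omega>. ennreal (grid_fun F n 0 t \<omega> * grid_fun G n t h \<omega>) \<partial>M) = ?E F n 0 t * ?E G n t h"
      if n: "0 < n" for n
    proof -
      have m: "grid_fun F n 0 t \<in> borel_measurable M" "grid_fun G n t h \<in> borel_measurable M"
        using measurable_grid_fun[OF F] measurable_grid_fun[OF G] t h by auto
      have i: "integrable M (grid_fun F n 0 t)" "integrable M (grid_fun G n t h)"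
        using m bnd by (auto intro!: integrable_const_bound[where B = 1] simp: grid_fun_def)
      note ind = indep_grid_fun[OF n t h F G]
      have pos: "0 \<le> grid_fun F n 0 t \<omega>" "0 \<le> grid_fun G n t h \<omega>" for \<omega>
        using bnd by (auto simp: grid_fun_def)
      have "(\<integral>\<^sup>+\<omega>. ennreal (grid_fun F n 0 t \<omega> * grid_fun G n t h \<omega>) \<partial>M) =
          ennreal ((\<integral>\<omega>. grid_fun F n 0 t \<omega> \<partial>M) * (\<integral>\<omega>. grid_fun G n t h \<omega> \<partial>M))"
        unfolding indep_var_lebesgue_integral[OF ind i, symmetric]
        by (intro nn_integral_eq_integral indep_var_integrable[OF ind i]) (simp add: pos)
      also have "\<dots> = ?E F n 0 t * ?E G n t h"
        using i pos by (simp add: nn_integral_eq_integral ennreal_mult integral_nonneg)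
      finally show ?thesis .
    qed
    have F1: "(\<lambda>n. ?E F n 0 t) \<longlonglongrightarrow> (\<integral>\<^sup>+\<omega>. ennreal (F (seg 0 t \<omega>)) \<partial>M)"
      using nn_integral_grid_fun_tendsto[OF F bnd(1,2), of "\<lambda>_. 1" 0 t 0 t] t by (simp add: grid_fun_def)
    have G1: "(\<lambda>n. ?E G n t h) \<longlonglongrightarrow> (\<integral>\<^sup>+\<omega>. ennreal (G (seg t h \<omega>)) \<partial>M)"
      using nn_integral_grid_fun_tendsto[OF G bnd(3,4), of "\<lambda>_. 1" t h t h] t h by (simp add: grid_fun_def)
    have fin: "(\<integral>\<^sup>+\<omega>. ennreal (F (f \<omega>)) \<partial>M) \<noteq> \<infinity>" if "\<And>x. F x \<le> 1" for f F
    proof -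
      have "(\<integral>\<^sup>+\<omega>. ennreal (F (f \<omega>)) \<partial>M) \<le> (\<integral>\<^sup>+\<omega>. 1 \<partial>M)" by (intro nn_integral_mono) (use that in simp)
      then show ?thesis by (auto simp: emeasure_space_1 top_unique)
    qed
    have "(\<lambda>n. ?E F n 0 t * ?E G n t h) \<longlonglongrightarrow>
        (\<integral>\<^sup>+\<omega>. ennreal (F (seg 0 t \<omega>)) \<partial>M) * (\<integral>\<^sup>+\<omega>. ennreal (G (seg t h \<omega>)) \<partial>M)"
      by (intro tendsto_mult_ennreal F1 G1) (use fin bnd in auto)
    then have "(\<lambda>n. \<integral>\<^sup>+\<omega>. ennreal (grid_fun F n 0 t \<omega> * grid_fun G n t h \<omega>) \<partial>M) \<longlonglongrightarrow>
        (\<integral>\<^sup>+\<omega>. ennreal (F (seg 0 t \<omega>)) \<partial>M) * (\<integral>\<^sup>+\<omega>. ennreal (G (seg t h \<omega>)) \<partial>M)"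
    proof (rule Lim_transform_eventually)
      show "\<forall>\<^sub>F n in sequentially. ?E F n 0 t * ?E G n t h =
          (\<integral>\<^sup>+\<omega>. ennreal (grid_fun F n 0 t \<omega> * grid_fun G n t h \<omega>) \<partial>M)"
        using eventually_gt_at_top[of 0] by eventually_elim (simp add: prod)
    qed
    moreover have "(\<lambda>n. \<integral>\<^sup>+\<omega>. ennreal (grid_fun F n 0 t \<omega> * grid_fun G n t h \<omega>) \<partial>M) \<longlonglongrightarrow>
        (\<integral>\<^sup>+\<omega>. ennreal (F (seg 0 t \<omega>) * G (seg t h \<omega>)) \<partial>M)"
      using nn_integral_grid_fun_tendsto[OF F bnd(1,2) G bnd(3,4)] t h by simp
    ultimately show "(\<integral>\<^sup>+\<omega>. ennreal (F (seg 0 t \<omega>)) * ennreal (G (seg t h \<omega>)) \<partial>M) =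
      (\<integral>\<^sup>+\<omega>. ennreal (F (seg 0 t \<omega>)) \<partial>M) * (\<integral>\<^sup>+\<omega>. ennreal (G (seg t h \<omega>)) \<partial>M)"
      using bnd by (simp add: LIMSEQ_unique ennreal_mult)
  qed
  then show ?thesis using t h by (simp add: seg_law)
qed

end

section \<open>Layer-cake formula, a Fatou bound and Gaussian integrals\<close>

lemma (in sigma_finite_measure) nn_integral_excess:
  fixes Y :: "'a \<Rightarrow> real"
  assumes [measurable]: "Y \<in> borel_measurable M"
  shows "(\<integral>\<^sup>+\<omega>. ennreal (Y \<omega> - K) \<partial>M) =
      (\<integral>\<^sup>+x. indicator {K<..} x * emeasure M {\<omega> \<in> space M. x < Y \<omega>} \<partial>lborel)"
    and "(\<integral>\<^sup>+\<omega>. ennreal (Y \<omega> - K) \<partial>M) =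
      (\<integral>\<^sup>+x. indicator {K<..} x * emeasure M {\<omega> \<in> space M. x \<le> Y \<omega>} \<partial>lborel)"
proof -
  interpret P: pair_sigma_finite M lborel ..
  have "(\<integral>\<^sup>+\<omega>. ennreal (Y \<omega> - K) \<partial>M) =
      (\<integral>\<^sup>+\<omega>. \<integral>\<^sup>+x. indicator {K<..} x * indicator {\<omega> \<in> space M. x < Y \<omega>} \<omega> \<partial>lborel \<partial>M)"
  proof (rule nn_integral_cong)
    fix \<omega> assume "\<omega> \<in> space M"
    then have "(\<integral>\<^sup>+x. indicator {K<..} x * indicator {\<omega> \<in> space M. x < Y \<omega>} \<omega> \<partial>lborel) =
        (\<integral>\<^sup>+x. indicator {K<..<Y \<omega>} x \<partial>lborel)"
      by (intro nn_integral_cong) (auto simp: indicator_def)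
    then show "ennreal (Y \<omega> - K) =
        (\<integral>\<^sup>+x. indicator {K<..} x * indicator {\<omega> \<in> space M. x < Y \<omega>} \<omega> \<partial>lborel)"
      by (cases "K \<le> Y \<omega>") (auto simp: ennreal_neg)
  qed
  also have "\<dots> = (\<integral>\<^sup>+x. \<integral>\<^sup>+\<omega>. indicator {K<..} x * indicator {\<omega> \<in> space M. x < Y \<omega>} \<omega> \<partial>M \<partial>lborel)"
    by (rule P.Fubini'[symmetric]) measurable
  also have "\<dots> = (\<integral>\<^sup>+x. indicator {K<..} x * emeasure M {\<omega> \<in> space M. x < Y \<omega>} \<partial>lborel)"
    by (simp add: nn_integral_cmult)
  finally show "(\<integral>\<^sup>+\<omega>. ennreal (Y \<omega> - K) \<partial>M) =
      (\<integral>\<^sup>+x. indicator {K<..} x * emeasure M {\<omega> \<in> space M. x < Y \<omega>} \<partial>lborel)" .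
  \<comment> \<open>The added end point of the interval is Lebesgue null. Strict level sets go with
    the upper reflection bound, weak ones with the lower.\<close>
  have "(\<integral>\<^sup>+\<omega>. ennreal (Y \<omega> - K) \<partial>M) =
      (\<integral>\<^sup>+\<omega>. \<integral>\<^sup>+x. indicator {K<..} x * indicator {\<omega> \<in> space M. x \<le> Y \<omega>} \<omega> \<partial>lborel \<partial>M)"
  proof (rule nn_integral_cong)
    fix \<omega> assume "\<omega> \<in> space M"
    then have "(\<integral>\<^sup>+x. indicator {K<..} x * indicator {\<omega> \<in> space M. x \<le> Y \<omega>} \<omega> \<partial>lborel) =
        (\<integral>\<^sup>+x. indicator {K<..Y \<omega>} x \<partial>lborel)"
      by (intro nn_integral_cong) (auto simp: indicator_def)
    then show "ennreal (Y \<omega> - K) =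
        (\<integral>\<^sup>+x. indicator {K<..} x * indicator {\<omega> \<in> space M. x \<le> Y \<omega>} \<omega> \<partial>lborel)"
      by (cases "K \<le> Y \<omega>") (auto simp: ennreal_neg)
  qed
  also have "\<dots> = (\<integral>\<^sup>+x. \<integral>\<^sup>+\<omega>. indicator {K<..} x * indicator {\<omega> \<in> space M. x \<le> Y \<omega>} \<omega> \<partial>M \<partial>lborel)"
    by (rule P.Fubini'[symmetric]) measurable
  also have "\<dots> = (\<integral>\<^sup>+x. indicator {K<..} x * emeasure M {\<omega> \<in> space M. x \<le> Y \<omega>} \<partial>lborel)"
    by (simp add: nn_integral_cmult)
  finally show "(\<integral>\<^sup>+\<omega>. ennreal (Y \<omega> - K) \<partial>M) =
      (\<integral>\<^sup>+x. indicator {K<..} x * emeasure M {\<omega> \<in> space M. x \<le> Y \<omega>} \<partial>lborel)" .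
qed

text \<open>Fatou's lemma for indicators: that of \<open>A\<close> is at most the lower limit of
  those of \<open>U n\<close>. It carries estimates on a time grid over to continuous paths.\<close>

lemma emeasure_le_if_eventually_in:
  assumes [measurable]: "A \<in> sets M" "\<And>n. U n \<in> sets M"
    and ev: "\<And>\<omega>. \<omega> \<in> A \<Longrightarrow> \<forall>\<^sub>F n in sequentially. \<omega> \<in> U n"
    and le: "\<And>n. 0 < n \<Longrightarrow> emeasure M (U n) \<le> c"
  shows "emeasure M A \<le> c"
proof -
  have "emeasure M A = (\<integral>\<^sup>+\<omega>. indicator A \<omega> \<partial>M)" by simp
  also have "\<dots> \<le> (\<integral>\<^sup>+\<omega>. liminf (\<lambda>n. indicator (U n) \<omega> :: ennreal) \<partial>M)"
  proof (intro nn_integral_mono)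
    fix \<omega>
    have "1 \<le> liminf (\<lambda>n. indicator (U n) \<omega> :: ennreal)" if "\<omega> \<in> A"
      by (intro Liminf_bounded eventually_mono[OF ev[OF that]]) auto
    then show "indicator A \<omega> \<le> liminf (\<lambda>n. indicator (U n) \<omega> :: ennreal)"
      by (cases "\<omega> \<in> A") auto
  qed
  also have "\<dots> \<le> liminf (\<lambda>n. \<integral>\<^sup>+\<omega>. indicator (U n) \<omega> \<partial>M)"
    by (intro nn_integral_liminf) auto
  also have "\<dots> \<le> limsup (\<lambda>n. \<integral>\<^sup>+\<omega>. indicator (U n) \<omega> \<partial>M)"
    by (intro Liminf_le_Limsup) auto
  also have "\<dots> \<le> c"
  proof (intro Limsup_bounded)
    show "\<forall>\<^sub>F n in sequentially. (\<integral>\<^sup>+\<omega>. indicator (U n) \<omega> \<partial>M) \<le> c"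
      using eventually_gt_at_top[of 0] by eventually_elim (simp add: le)
  qed
  finally show ?thesis .
qed

lemma std_gauss_symmetric: "emeasure std_gauss {0<..} = emeasure std_gauss {..<0}"
proof -
  have "emeasure std_gauss {0<..} =
      (\<integral>\<^sup>+x. ennreal (std_normal_density x) * indicator {0<..} x \<partial>lborel)"
    by (simp add: emeasure_density)
  also have "\<dots> = ennreal \<bar>-1\<bar> *
      (\<integral>\<^sup>+x. ennreal (std_normal_density (0 + -1 * x)) * indicator {0<..} (0 + -1 * x) \<partial>lborel)"
    by (rule nn_integral_real_affine) auto
  also have "\<dots> = emeasure std_gauss {..<0}"
  proof -
    have "ennreal (std_normal_density (0 + -1 * x)) * indicator {0<..} (0 + -1 * x) =
        ennreal (std_normal_density x) * indicator {..<0} x" for x :: real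
      by (simp add: std_normal_density_def indicator_def)
    then show ?thesis by (simp add: emeasure_density)
  qed
  finally show ?thesis .
qed

lemma std_gauss_point: "emeasure std_gauss {x} = 0"
proof -
  have "(\<integral>\<^sup>+y. ennreal (std_normal_density y) * indicator {x} y \<partial>lborel) = (\<integral>\<^sup>+y. 0 \<partial>(lborel :: real measure))"
  proof (rule nn_integral_cong_AE)
    show "AE y in lborel. ennreal (std_normal_density y) * indicator {x} y = 0"
      using AE_lborel_singleton[of x] by eventually_elim simp
  qed
  then show ?thesis by (simp add: emeasure_density)
qed

text \<open>Since \<open>ennreal\<close> truncates negative values, the left side is the mean of
  \<open>\<bar>x\<bar> + x\<close>, and the second summand is odd.\<close>

lemma std_gauss_pos_part: "2 * (\<integral>\<^sup>+x. ennreal x \<partial>std_gauss) = ennreal (sqrt (2 / pi))"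
proof -
  have "has_bochner_integral lborel (\<lambda>x. std_normal_density x * (\<bar>x\<bar> + x)) (sqrt (2 / pi) + 0)"
    using has_bochner_integral_add[OF std_normal_moment_abs_odd[of 0] std_normal_moment_odd[of 0]]
    by (simp add: ring_distribs)
  then have "ennreal (sqrt (2 / pi)) = (\<integral>\<^sup>+x. ennreal (std_normal_density x * (\<bar>x\<bar> + x)) \<partial>lborel)"
    using nn_integral_eq_integral[of lborel "\<lambda>x. std_normal_density x * (\<bar>x\<bar> + x)"]
    by (simp add: has_bochner_integral_iff)
  also have "\<dots> = (\<integral>\<^sup>+x. 2 * ennreal x \<partial>std_gauss)"
  proof (subst nn_integral_density, simp, simp, intro nn_integral_cong)
    fix x :: real
    show "ennreal (std_normal_density x * (\<bar>x\<bar> + x)) = ennreal (std_normal_density x) * (2 * ennreal x)"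
    proof (cases "0 \<le> x")
      case True
      then have "2 * ennreal x = ennreal (\<bar>x\<bar> + x)"
        using ennreal_mult[of 2 x] by simp
      moreover have "ennreal (std_normal_density x * (\<bar>x\<bar> + x)) = ennreal (std_normal_density x) * ennreal (\<bar>x\<bar> + x)"
        by (rule ennreal_mult) auto
      ultimately show ?thesis by metis
    qed (simp add: ennreal_neg)
  qed
  finally show ?thesis by (simp add: nn_integral_cmult)
qed

text \<open>For \<open>x > K\<close> the bound \<open>x - K \<le> x ^ 3 / K ^ 2\<close> reduces the
  tail to the third absolute moment \<open>2 * sqrt (2 / pi)\<close>, which is below 2. Later
  \<open>K\<close> is of order \<open>1 / sqrt h\<close>, and decay faster than \<open>1 / K\<close>
  is what makes the summed errors vanish.\<close>

lemma std_gauss_tail: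
  assumes K: "0 < K"
  shows "2 * (\<integral>\<^sup>+x. ennreal (x - K) \<partial>std_gauss) \<le> ennreal (4 / K\<^sup>2)"
proof -
  have "has_bochner_integral lborel (\<lambda>x. std_normal_density x * \<bar>x\<bar> ^ 3) (sqrt (2 / pi) * 2)"
    using std_normal_moment_abs_odd[of 1] by (simp add: numeral_3_eq_3 numeral_2_eq_2)
  then have *: "(\<integral>\<^sup>+x. ennreal (std_normal_density x * \<bar>x\<bar> ^ 3) \<partial>lborel) = ennreal (sqrt (2 / pi) * 2)"
    using nn_integral_eq_integral[of lborel "\<lambda>x. std_normal_density x * \<bar>x\<bar> ^ 3"]
    by (simp add: has_bochner_integral_iff)
  have "(\<integral>\<^sup>+x. ennreal (x - K) \<partial>std_gauss) =
      (\<integral>\<^sup>+x. ennreal (std_normal_density x) * ennreal (x - K) \<partial>lborel)"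
    by (subst nn_integral_density) auto
  also have "\<dots> \<le> (\<integral>\<^sup>+x. ennreal (1 / K\<^sup>2) * ennreal (std_normal_density x * \<bar>x\<bar> ^ 3) \<partial>lborel)"
  proof (intro nn_integral_mono)
    fix x :: real
    have "x - K \<le> \<bar>x\<bar> ^ 3 / K\<^sup>2"
    proof (cases "x \<le> K")
      case False
      then have "1 \<le> (x / K)\<^sup>2" using K by (intro one_le_power) simp
      then have "x * 1 \<le> x * (x / K)\<^sup>2" using False K by (intro mult_left_mono) auto
      also have "\<dots> = \<bar>x\<bar> ^ 3 / K\<^sup>2"
      proof -
        have "\<bar>x\<bar> = x" using False K by simp
        then show ?thesis by (simp add: power3_eq_cube power2_eq_square)
      qed
      finally show ?thesis using K by simp
    next
      case True
      then have "x - K \<le> 0" by simp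
      also have "0 \<le> \<bar>x\<bar> ^ 3 / K\<^sup>2" by simp
      finally show ?thesis .
    qed
    then have "std_normal_density x * (x - K) \<le> std_normal_density x * (\<bar>x\<bar> ^ 3 / K\<^sup>2)"
      by (intro mult_left_mono) auto
    then have "std_normal_density x * (x - K) \<le> 1 / K\<^sup>2 * (std_normal_density x * \<bar>x\<bar> ^ 3)"
      by simp
    then have "ennreal (std_normal_density x * (x - K)) \<le> ennreal (1 / K\<^sup>2 * (std_normal_density x * \<bar>x\<bar> ^ 3))"
      by (rule ennreal_leI)
    moreover have "ennreal (std_normal_density x * (x - K)) = ennreal (std_normal_density x) * ennreal (x - K)"
      by (rule ennreal_mult') simp
    moreover have "ennreal (1 / K\<^sup>2 * (std_normal_density x * \<bar>x\<bar> ^ 3)) =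
        ennreal (1 / K\<^sup>2) * ennreal (std_normal_density x * \<bar>x\<bar> ^ 3)"
      by (rule ennreal_mult') simp
    ultimately show "ennreal (std_normal_density x) * ennreal (x - K) \<le>
        ennreal (1 / K\<^sup>2) * ennreal (std_normal_density x * \<bar>x\<bar> ^ 3)" by simp
  qed
  also have "\<dots> = ennreal (1 / K\<^sup>2) * ennreal (sqrt (2 / pi) * 2)"
    by (subst nn_integral_cmult) (auto simp: *)
  also have "\<dots> \<le> ennreal (1 / K\<^sup>2) * ennreal 2"
  proof (intro mult_left_mono ennreal_leI)
    have "2 / pi \<le> 1" using pi_gt3 by simp
    then show "sqrt (2 / pi) * 2 \<le> 2" by simp
  qed simp
  also have "\<dots> = ennreal (2 / K\<^sup>2)" by (subst ennreal_mult[symmetric]) auto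
  finally have "2 * (\<integral>\<^sup>+x. ennreal (x - K) \<partial>std_gauss) \<le> 2 * ennreal (2 / K\<^sup>2)"
    by (intro mult_left_mono) auto
  also have "\<dots> = ennreal (4 / K\<^sup>2)"
    using ennreal_mult[of 2 "2 / K\<^sup>2"] by simp
  finally show ?thesis .
qed

context standard_brownian_motion
begin

subsection \<open>The running maximum\<close>

text \<open>The running maximum of \<open>X - X 0\<close>, written with \<open>seg\<close> so that
  scaling reduces its law to Wiener measure. The initial value is subtracted because it vanishes
  only almost surely.\<close>

definition bmax :: "real \<Rightarrow> 'a \<Rightarrow> real" where
  "bmax t \<omega> = sqrt t * psup (seg 0 t \<omega>)"

lemma sqrt_mult_seg: "0 < h \<Longrightarrow> 0 \<le> r \<Longrightarrow> r \<le> 1 \<Longrightarrow> sqrt h * seg s h \<omega> r = X (s + h * r) \<omega> - X s \<omega>"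
  by (simp add: seg_def)

lemma segment_max:
  assumes \<omega>: "\<omega> \<in> space M" and s: "0 \<le> s" and h: "0 < h"
  shows segment_max_upper: "\<And>u. s \<le> u \<Longrightarrow> u \<le> s + h \<Longrightarrow> X u \<omega> - X s \<omega> \<le> sqrt h * psup (seg s h \<omega>)"
    and segment_max_attained: "\<exists>u. s \<le> u \<and> u \<le> s + h \<and> X u \<omega> - X s \<omega> = sqrt h * psup (seg s h \<omega>)"
proof -
  have C: "seg s h \<omega> \<in> mspace C01" using seg_in_C01 \<omega> s h by simp
  show "X u \<omega> - X s \<omega> \<le> sqrt h * psup (seg s h \<omega>)" if "s \<le> u" "u \<le> s + h" for u
  proof -
    define r where "r = (u - s) / h"
    have r: "0 \<le> r" "r \<le> 1" "s + h * r = u" using that h by (auto simp: r_def)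
    have "X u \<omega> - X s \<omega> = sqrt h * seg s h \<omega> r" using sqrt_mult_seg[OF h r(1,2), of s \<omega>] r by simp
    also have "\<dots> \<le> sqrt h * psup (seg s h \<omega>)"
      using le_psup[OF C r(1,2)] h by (intro mult_left_mono) auto
    finally show ?thesis .
  qed
  obtain r where r: "0 \<le> r" "r \<le> 1" "psup (seg s h \<omega>) = seg s h \<omega> r" using psup_attained[OF C] by metis
  show "\<exists>u. s \<le> u \<and> u \<le> s + h \<and> X u \<omega> - X s \<omega> = sqrt h * psup (seg s h \<omega>)"
    by (rule exI[of _ "s + h * r"])
      (use r h sqrt_mult_seg[OF h r(1,2), of s \<omega>] in \<open>auto simp: mult_left_le\<close>)
qed

lemma bmax_upper: "\<omega> \<in> space M \<Longrightarrow> 0 < t \<Longrightarrow> 0 \<le> u \<Longrightarrow> u \<le> t \<Longrightarrow> X u \<omega> - X 0 \<omega> \<le> bmax t \<omega>"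
  unfolding bmax_def using segment_max_upper[of \<omega> 0 t u] by simp

lemma bmax_attained:
  assumes "\<omega> \<in> space M" "0 < t"
  obtains u where "0 \<le> u" "u \<le> t" "X u \<omega> - X 0 \<omega> = bmax t \<omega>"
  unfolding bmax_def using segment_max_attained[of \<omega> 0 t] assms by auto

lemma bmax_split:
  assumes \<omega>: "\<omega> \<in> space M" and t: "0 < t" and h: "0 < h"
  shows "bmax (t + h) \<omega> = max (bmax t \<omega>) (X t \<omega> - X 0 \<omega> + sqrt h * psup (seg t h \<omega>))"
proof (rule antisym)
  obtain u where u: "0 \<le> u" "u \<le> t + h" "X u \<omega> - X 0 \<omega> = bmax (t + h) \<omega>"
    using bmax_attained[OF \<omega>, of "t + h"] t h by auto
  show "bmax (t + h) \<omega> \<le> max (bmax t \<omega>) (X t \<omega> - X 0 \<omega> + sqrt h * psup (seg t h \<omega>))"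
  proof (cases "u \<le> t")
    case True
    then show ?thesis using bmax_upper[OF \<omega> t u(1)] u(3) by (simp add: max.coboundedI1)
  next
    case False
    then show ?thesis using segment_max_upper[OF \<omega> _ h, of t u] t u by (simp add: max.coboundedI2)
  qed
  obtain v where v: "t \<le> v" "v \<le> t + h" "X v \<omega> - X t \<omega> = sqrt h * psup (seg t h \<omega>)"
    using segment_max_attained[OF \<omega> _ h, of t] t by auto
  obtain w where w: "0 \<le> w" "w \<le> t" "X w \<omega> - X 0 \<omega> = bmax t \<omega>" using bmax_attained[OF \<omega> t] by metis
  show "max (bmax t \<omega>) (X t \<omega> - X 0 \<omega> + sqrt h * psup (seg t h \<omega>)) \<le> bmax (t + h) \<omega>"
    using bmax_upper[OF \<omega>, of "t + h" v] bmax_upper[OF \<omega>, of "t + h" w] v w t h by auto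
qed

lemma bmax_nonneg: "\<omega> \<in> space M \<Longrightarrow> 0 < t \<Longrightarrow> 0 \<le> bmax t \<omega>"
  using bmax_upper[of \<omega> t 0] by simp

lemma measurable_bmax: "0 \<le> t \<Longrightarrow> bmax t \<in> borel_measurable M"
  unfolding bmax_def
  by (intro borel_measurable_times borel_measurable_const measurable_compose[OF measurable_seg measurable_psup]) auto

lemma wiener_eval_1: "distr wiener borel (\<lambda>f. f 1) = std_gauss"
proof -
  have "distr wiener borel (\<lambda>f. f 1) = distr M borel (\<lambda>\<omega>. seg 0 1 \<omega> 1)"
    unfolding wiener_def
    by (subst distr_distr) (auto simp: o_def intro!: measurable_seg measurable_eval_C01)
  also have "(\<lambda>\<omega>. seg 0 1 \<omega> 1) = incr real 0"
    by (simp add: seg_def incr_def fun_eq_iff)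
  finally show ?thesis using incr_law[of real 0] by simp
qed

lemma emeasure_eval_1:
  assumes "A \<in> sets borel"
  shows "emeasure wiener {w \<in> mspace C01. w 1 \<in> A} = emeasure std_gauss A"
  unfolding wiener_eval_1[symmetric] using assms
  by (subst emeasure_distr) (auto simp: measurable_cong_sets[OF sets_wiener refl] measurable_eval_C01 vimage_def Int_def conj_commute)

subsection \<open>Reflection at the first passage over a grid\<close>

definition passage :: "real \<Rightarrow> nat \<Rightarrow> nat \<Rightarrow> 'a set" where
  "passage x n k = {\<omega> \<in> space M. (\<forall>j<k. X (real j / real n) \<omega> - X 0 \<omega> < x) \<and>
     x \<le> X (real k / real n) \<omega> - X 0 \<omega>}"

text \<open>With \<open>c\<close> equal to 1 or -1 this fixes the sign of the increment that follows
  the first grid passage. Strictness discards a vanishing increment.\<close>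

definition later :: "real \<Rightarrow> nat \<Rightarrow> nat \<Rightarrow> real \<Rightarrow> 'a set" where
  "later x n k c = {\<omega> \<in> passage x n k. 0 < c * (X 1 \<omega> - X (real k / real n) \<omega>)}"

lemma sets_passage [measurable]: "passage x n k \<in> sets M"
proof -
  have [measurable]: "X (real j / real n) \<in> borel_measurable M" "X 0 \<in> borel_measurable M" for j
    by (auto intro: rv)
  show ?thesis unfolding passage_def by measurable
qed

lemma sets_later [measurable]: "later x n k c \<in> sets M"
proof -
  have [measurable]: "X (real j / real n) \<in> borel_measurable M" "X 1 \<in> borel_measurable M" for j
    by (auto intro: rv)
  have "later x n k c = passage x n k \<inter> {\<omega> \<in> space M. 0 < c * (X 1 \<omega> - X (real k / real n) \<omega>)}"
    by (auto simp: later_def passage_def)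
  also have "\<dots> \<in> sets M" by measurable
  finally show ?thesis .
qed

lemma passage_unique: "\<omega> \<in> passage x n k \<Longrightarrow> \<omega> \<in> passage x n k' \<Longrightarrow> k = k'"
proof -
  assume "\<omega> \<in> passage x n k" "\<omega> \<in> passage x n k'"
  then have "\<not> k < k'" "\<not> k' < k" by (auto simp: passage_def not_less[symmetric])
  then show "k = k'" by simp
qed

text \<open>Given the path up to the grid time \<open>k / n\<close>, the remaining increment is independent and symmetric.\<close>

lemma later_symmetric:
  assumes x: "0 < x" and k: "k \<le> n" and n: "0 < n"
  shows "emeasure M (later x n k 1) = emeasure M (later x n k (-1))"
proof -
  consider "k = 0" | "k = n" | "0 < k" "k < n" using k by linarith
  then show ?thesis
  proof cases
    \<comment> \<open>Both events are empty here, because the increment from \<open>X 0\<close> to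
      itself is 0 and hence below the level. In the next case they are empty because no increment
      remains.\<close>
    case 1
    then show ?thesis using x by (simp add: later_def passage_def)
  next
    case 2
    then show ?thesis using n by (simp add: later_def)
  next
    case 3
    define t where "t = real k / real n"
    have t: "0 < t" "0 < 1 - t" using 3 by (auto simp: t_def)
    \<comment> \<open>The first-passage condition in terms of the normalised path on
      \<open>[0, k / n]\<close>: the original grid time \<open>j / n\<close> becomes
      \<open>j / k\<close>.\<close>
    define A where "A = {f \<in> space borel_C01. (\<forall>j\<in>{..<k}. sqrt t * f (real j / real k) < x) \<and> x \<le> sqrt t * f 1}"
    have [measurable]: "(\<lambda>f. f (real j / real k)) \<in> borel_measurable borel_C01" if "j \<in> {..<k}" for j
      using that by (intro measurable_eval_C01) auto
    have [measurable]: "(\<lambda>f. f 1) \<in> borel_measurable borel_C01"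
      by (intro measurable_eval_C01) auto
    have A [measurable]: "A \<in> sets borel_C01" unfolding A_def by measurable
    interpret W: prob_space wiener by (rule prob_space_wiener)
    have *: "emeasure M (later x n k c) = emeasure wiener A * emeasure wiener {g \<in> mspace C01. 0 < c * g 1}" for c
    proof -
      define C where "C = {g \<in> space borel_C01. 0 < c * g 1}"
      have C [measurable]: "C \<in> sets borel_C01" unfolding C_def by measurable
      have m: "(\<lambda>\<omega>. (seg 0 t \<omega>, seg t (1 - t) \<omega>)) \<in> measurable M (borel_C01 \<Otimes>\<^sub>M borel_C01)"
        using t by (intro measurable_Pair measurable_seg) auto
      have iff: "\<omega> \<in> later x n k c \<longleftrightarrow> seg 0 t \<omega> \<in> A \<and> seg t (1 - t) \<omega> \<in> C" if \<omega>: "\<omega> \<in> space M" for \<omega>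
      proof -
        have 1: "sqrt t * seg 0 t \<omega> (real j / real k) = X (real j / real n) \<omega> - X 0 \<omega>" if "j < k" for j
          using sqrt_mult_seg[OF t(1), of "real j / real k" 0 \<omega>] that 3 by (simp add: t_def)
        have 2: "sqrt t * seg 0 t \<omega> 1 = X (real k / real n) \<omega> - X 0 \<omega>"
          using sqrt_mult_seg[OF t(1), of 1 0 \<omega>] by (simp add: t_def)
        have 3: "sqrt (1 - t) * seg t (1 - t) \<omega> 1 = X 1 \<omega> - X (real k / real n) \<omega>"
          using sqrt_mult_seg[OF t(2), of 1 t \<omega>] by (simp add: t_def)
        have "c * (X 1 \<omega> - X (real k / real n) \<omega>) = sqrt (1 - t) * (c * seg t (1 - t) \<omega> 1)"
          unfolding 3[symmetric] by simp
        moreover have "0 < sqrt (1 - t)" using t by simp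
        ultimately have 4: "0 < c * (X 1 \<omega> - X (real k / real n) \<omega>) \<longleftrightarrow> 0 < c * seg t (1 - t) \<omega> 1"
          by (metis zero_less_mult_pos mult_pos_pos)
        have C01: "seg 0 t \<omega> \<in> mspace C01" "seg t (1 - t) \<omega> \<in> mspace C01"
          using \<omega> t seg_in_C01 by auto
        show ?thesis
          unfolding later_def passage_def A_def C_def mem_Collect_eq 4 2 space_borel_of topspace_mtopology_of
          using \<omega> C01 1 by (auto simp: Ball_def)
      qed
      have "later x n k c = (\<lambda>\<omega>. (seg 0 t \<omega>, seg t (1 - t) \<omega>)) -` (A \<times> C) \<inter> space M"
        using iff by (auto simp: later_def passage_def)
      then have "emeasure M (later x n k c) =
          emeasure (distr M (borel_C01 \<Otimes>\<^sub>M borel_C01) (\<lambda>\<omega>. (seg 0 t \<omega>, seg t (1 - t) \<omega>))) (A \<times> C)"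
        using m A C by (subst emeasure_distr) auto
      also have "\<dots> = emeasure wiener A * emeasure wiener C"
        unfolding seg_joint_law[OF t] by (intro W.emeasure_pair_measure_Times) auto
      finally show ?thesis by (simp add: C_def)
    qed
    have "emeasure wiener {g \<in> mspace C01. 0 < 1 * g 1} = emeasure wiener {g \<in> mspace C01. 0 < -1 * g 1}"
      using emeasure_eval_1[of "{0<..}"] emeasure_eval_1[of "{..<0}"] std_gauss_symmetric by simp
    then show ?thesis unfolding *[of 1] *[of "-1"] by simp
  qed
qed

lemma passage_exists:
  assumes "\<omega> \<in> space M" "k \<le> n" "x \<le> X (real k / real n) \<omega> - X 0 \<omega>"
  shows "\<exists>j\<le>n. \<omega> \<in> passage x n j"
proof -
  let ?P = "\<lambda>j. x \<le> X (real j / real n) \<omega> - X 0 \<omega>"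
  have "?P (LEAST j. ?P j)" "(LEAST j. ?P j) \<le> k" using assms(3) by (auto intro: LeastI Least_le)
  moreover have "\<forall>j<(LEAST j. ?P j). \<not> ?P j" using not_less_Least by blast
  ultimately show ?thesis using assms by (intro exI[of _ "LEAST j. ?P j"]) (auto simp: passage_def)
qed

lemma unif_cont_path:
  assumes "\<omega> \<in> space M" "0 < e"
  obtains d where "0 < d" "\<And>s t. 0 \<le> s \<Longrightarrow> s \<le> 1 \<Longrightarrow> 0 \<le> t \<Longrightarrow> t \<le> 1 \<Longrightarrow> \<bar>s - t\<bar> < d \<Longrightarrow> \<bar>X s \<omega> - X t \<omega>\<bar> < e"
proof -
  have "continuous_on {0..1} (\<lambda>t. X t \<omega>)"
    using continuous_on_subset[OF continuous_paths[OF assms(1)]] by auto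
  then have "uniformly_continuous_on {0..1} (\<lambda>t. X t \<omega>)"
    by (intro compact_uniformly_continuous) auto
  then obtain d where "0 < d" "\<forall>s\<in>{0..1}. \<forall>t\<in>{0..1}. dist t s < d \<longrightarrow> dist (X t \<omega>) (X s \<omega>) < e"
    using assms(2) unfolding uniformly_continuous_on_def by blast
  then show ?thesis by (intro that[of d]) (auto simp: dist_real_def)
qed

text \<open>The first grid passage may overshoot the level, so exact reflection is replaced by two
  inclusions. A path with maximum above \<open>x\<close> and end point below \<open>x\<close>
  eventually lies in \<open>U (-1) n\<close>, whose mirror image \<open>U 1 n\<close> forces the end
  point above \<open>x\<close>. Conversely, an end point above \<open>x\<close> eventually puts the
  path into \<open>U 1 n\<close>; the two events are disjoint, have equal mass, and each makes the
  maximum reach \<open>x\<close>.\<close>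

lemma reflection:
  assumes x: "0 < x"
  shows reflection_upper: "emeasure M {\<omega> \<in> space M. x < bmax 1 \<omega>} \<le> 2 * emeasure std_gauss {x<..}"
    and reflection_lower: "2 * emeasure std_gauss {x<..} \<le> emeasure M {\<omega> \<in> space M. x \<le> bmax 1 \<omega>}"
proof -
  note [measurable] = measurable_bmax[of 1, simplified]
  have [measurable]: "X 1 \<in> borel_measurable M" "X 0 \<in> borel_measurable M" by (auto intro: rv)
  have gauss: "emeasure M {\<omega> \<in> space M. X 1 \<omega> - X 0 \<omega> \<in> A} = emeasure std_gauss A"
    if [measurable]: "A \<in> sets borel" for A
  proof -
    have "incr real 0 = (\<lambda>\<omega>. X 1 \<omega> - X 0 \<omega>)" by (simp add: incr_def fun_eq_iff)
    moreover have "distr M borel (incr real 0) = std_gauss" by (rule incr_law) auto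
    ultimately have "emeasure std_gauss A = emeasure (distr M borel (\<lambda>\<omega>. X 1 \<omega> - X 0 \<omega>)) A" by simp
    also have "\<dots> = emeasure M {\<omega> \<in> space M. X 1 \<omega> - X 0 \<omega> \<in> A}"
      by (subst emeasure_distr) (auto simp: vimage_def Int_def conj_commute)
    finally show ?thesis by simp
  qed
  have gauss_x: "emeasure M {\<omega> \<in> space M. x < X 1 \<omega> - X 0 \<omega>} = emeasure std_gauss {x<..}"
    "emeasure M {\<omega> \<in> space M. X 1 \<omega> - X 0 \<omega> = x} = 0"
    using gauss[of "{x<..}"] gauss[of "{x}"] std_gauss_point by auto
  define U where "U c n = (\<Union>k\<le>n. later x n k c)" for c n
  have sets_U: "U c n \<in> sets M" for c n unfolding U_def by measurable
  have disj: "disjoint_family_on (\<lambda>k. later x n k c) {..n}" for n c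
    unfolding disjoint_family_on_def later_def using passage_unique[of _ x n] by blast
  have U_sum: "emeasure M (U c n) = (\<Sum>k\<le>n. emeasure M (later x n k c))" for c n
    unfolding U_def by (rule sum_emeasure[symmetric]) (use disj sets_later in auto)
  have eq: "emeasure M (U 1 n) = emeasure M (U (-1) n)" if "0 < n" for n
    unfolding U_sum by (intro sum.cong refl later_symmetric x) (use that in auto)
  have grid: "\<forall>\<^sub>F n in sequentially. \<exists>k\<le>n. \<omega> \<in> passage x n k \<and> X (real k / real n) \<omega> - X 0 \<omega> < x + e"
    if \<omega>: "\<omega> \<in> space M" and s: "0 \<le> s" "s \<le> 1" "x < X s \<omega> - X 0 \<omega>" and e: "0 < e" for \<omega> s e
  proof -
    \<comment> \<open>One modulus serves two purposes: a grid point near \<open>s\<close> is still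
      above \<open>x\<close>, and the first grid passage overshoots by less than \<open>e\<close>
      because its predecessor lies below \<open>x\<close>.\<close>
    define \<delta> where "\<delta> = min e (X s \<omega> - X 0 \<omega> - x)"
    have \<delta>: "0 < \<delta>" "\<delta> \<le> e" "\<delta> \<le> X s \<omega> - X 0 \<omega> - x" using s e by (auto simp: \<delta>_def)
    obtain d where d: "0 < d" "\<And>s t. 0 \<le> s \<Longrightarrow> s \<le> 1 \<Longrightarrow> 0 \<le> t \<Longrightarrow> t \<le> 1 \<Longrightarrow> \<bar>s - t\<bar> < d \<Longrightarrow>
        \<bar>X s \<omega> - X t \<omega>\<bar> < \<delta>"
      using unif_cont_path[OF \<omega> \<delta>(1)] by metis
    have "\<forall>\<^sub>F n in sequentially. 1 / d < real n"
      using filterlim_real_sequentially by (simp add: filterlim_at_top_dense)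
    then show ?thesis using eventually_gt_at_top[of 0]
    proof eventually_elim
      case (elim n)
      then have nd: "1 / real n < d" "0 < n" using d(1) by (auto simp: field_simps)
      define k where "k = nat \<lfloor>real n * s\<rfloor>"
      have k: "real k \<le> real n * s" "real n * s < real k + 1"
        using s by (auto simp: k_def)
      have "real n * s \<le> real n" using s by (simp add: mult_left_le)
      then have "real k \<le> real n" using k by linarith
      then have kn: "k \<le> n" by simp
      have frac: "0 \<le> real i / real n" "real i / real n \<le> 1" if "i \<le> n" for i
        using that nd(2) by auto
      have "\<bar>s - real k / real n\<bar> \<le> 1 / real n"
      proof -
        have "s - real k / real n = (real n * s - real k) / real n" using nd(2) by (simp add: field_simps)
        then show ?thesis using k nd(2) by (simp add: divide_right_mono)
      qed
      then have "\<bar>X s \<omega> - X (real k / real n) \<omega>\<bar> < \<delta>"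
        using nd(1) by (intro d(2)[OF s(1,2) frac[OF kn]]) linarith
      then have "x \<le> X (real k / real n) \<omega> - X 0 \<omega>" using \<delta> by linarith
      from passage_exists[OF \<omega> kn this] obtain j where j: "j \<le> n" "\<omega> \<in> passage x n j" by auto
      have "X (real j / real n) \<omega> - X 0 \<omega> < x + e"
      proof (cases j)
        case 0
        then show ?thesis using x e by simp
      next
        case (Suc i)
        have "real j / real n - real i / real n = 1 / real n" by (simp add: Suc diff_divide_distrib[symmetric])
        moreover have "i \<le> n" using j Suc by simp
        ultimately have "\<bar>X (real j / real n) \<omega> - X (real i / real n) \<omega>\<bar> < \<delta>"
          using nd by (intro d(2) frac j) auto
        moreover have "X (real i / real n) \<omega> - X 0 \<omega> < x" using j Suc by (auto simp: passage_def)
        ultimately show ?thesis using \<delta> by linarith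
      qed
      with j show ?case by blast
    qed
  qed
  have "emeasure M {\<omega> \<in> space M. x < bmax 1 \<omega> \<and> X 1 \<omega> - X 0 \<omega> < x} \<le> emeasure std_gauss {x<..}"
  proof (rule emeasure_le_if_eventually_in[where U = "U (-1)"])
    fix \<omega> assume "\<omega> \<in> {\<omega> \<in> space M. x < bmax 1 \<omega> \<and> X 1 \<omega> - X 0 \<omega> < x}"
    then have \<omega>: "\<omega> \<in> space M" "x < bmax 1 \<omega>" "X 1 \<omega> - X 0 \<omega> < x" by auto
    obtain s where s: "0 \<le> s" "s \<le> 1" "X s \<omega> - X 0 \<omega> = bmax 1 \<omega>"
      using bmax_attained[OF \<omega>(1), of 1] by auto
    have "\<forall>\<^sub>F n in sequentially. \<exists>k\<le>n. \<omega> \<in> passage x n k \<and> X (real k / real n) \<omega> - X 0 \<omega> < x + 1"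
      using s \<omega>(2) by (intro grid[OF \<omega>(1) s(1,2)]) auto
    then show "\<forall>\<^sub>F n in sequentially. \<omega> \<in> U (-1) n"
    proof eventually_elim
      case (elim n)
      then obtain k where k: "k \<le> n" "\<omega> \<in> passage x n k" by blast
      then have "x \<le> X (real k / real n) \<omega> - X 0 \<omega>" by (simp add: passage_def)
      then have "\<omega> \<in> later x n k (-1)" using k \<omega>(3) by (simp add: later_def)
      with k show ?case by (auto simp: U_def)
    qed
  next
    fix n :: nat assume n: "0 < n"
    have "emeasure M (U (-1) n) = emeasure M (U 1 n)" using eq[OF n] by simp
    also have "\<dots> \<le> emeasure M {\<omega> \<in> space M. x < X 1 \<omega> - X 0 \<omega>}"
    proof (rule emeasure_mono)
      show "U 1 n \<subseteq> {\<omega> \<in> space M. x < X 1 \<omega> - X 0 \<omega>}"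
        by (auto simp: U_def later_def passage_def)
    qed measurable
    finally show "emeasure M (U (-1) n) \<le> emeasure std_gauss {x<..}" by (simp only: gauss_x)
  next
    show "{\<omega> \<in> space M. x < bmax 1 \<omega> \<and> X 1 \<omega> - X 0 \<omega> < x} \<in> sets M" by measurable
  qed (rule sets_U)
  then have "emeasure M {\<omega> \<in> space M. x < bmax 1 \<omega> \<and> X 1 \<omega> - X 0 \<omega> < x} +
      (emeasure M {\<omega> \<in> space M. x < X 1 \<omega> - X 0 \<omega>} + emeasure M {\<omega> \<in> space M. X 1 \<omega> - X 0 \<omega> = x}) \<le>
      2 * emeasure std_gauss {x<..}"
    unfolding gauss_x by (simp add: mult_2 add_right_mono)
  moreover have "emeasure M {\<omega> \<in> space M. x < bmax 1 \<omega>} \<le>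
      emeasure M {\<omega> \<in> space M. x < bmax 1 \<omega> \<and> X 1 \<omega> - X 0 \<omega> < x} +
      (emeasure M {\<omega> \<in> space M. x < X 1 \<omega> - X 0 \<omega>} + emeasure M {\<omega> \<in> space M. X 1 \<omega> - X 0 \<omega> = x})"
    (is "_ \<le> emeasure M ?A + (emeasure M ?B + emeasure M ?C)")
  proof -
    have m: "?A \<in> sets M" "?B \<in> sets M" "?C \<in> sets M" by measurable
    have "emeasure M {\<omega> \<in> space M. x < bmax 1 \<omega>} \<le> emeasure M (?A \<union> (?B \<union> ?C))"
      using m by (intro emeasure_mono) auto
    also have "\<dots> \<le> emeasure M ?A + emeasure M (?B \<union> ?C)"
      using m by (intro emeasure_subadditive) auto
    also have "\<dots> \<le> emeasure M ?A + (emeasure M ?B + emeasure M ?C)"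
      using m by (intro add_left_mono emeasure_subadditive) auto
    finally show ?thesis .
  qed
  ultimately show "emeasure M {\<omega> \<in> space M. x < bmax 1 \<omega>} \<le> 2 * emeasure std_gauss {x<..}"
    by (rule order_trans[rotated])
  have "emeasure std_gauss {x<..} \<le> emeasure M {\<omega> \<in> space M. x \<le> bmax 1 \<omega>} / 2"
    unfolding gauss_x(1)[symmetric]
  proof (rule emeasure_le_if_eventually_in[where U = "U 1"])
    fix \<omega> assume "\<omega> \<in> {\<omega> \<in> space M. x < X 1 \<omega> - X 0 \<omega>}"
    then have \<omega>: "\<omega> \<in> space M" "x < X 1 \<omega> - X 0 \<omega>" by auto
    \<comment> \<open>The overshoot is kept below \<open>X 1 \<omega> - X 0 \<omega> - x\<close>, so
      that the increment after the passage remains positive.\<close>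
    have "\<forall>\<^sub>F n in sequentially. \<exists>k\<le>n. \<omega> \<in> passage x n k \<and>
        X (real k / real n) \<omega> - X 0 \<omega> < x + (X 1 \<omega> - X 0 \<omega> - x)"
      using \<omega>(2) by (intro grid[OF \<omega>(1), of 1]) auto
    then show "\<forall>\<^sub>F n in sequentially. \<omega> \<in> U 1 n"
      by eventually_elim (auto simp: U_def later_def)
  next
    fix n :: nat assume n: "0 < n"
    have "emeasure M (U 1 n) + emeasure M (U 1 n) = emeasure M (U 1 n) + emeasure M (U (-1) n)"
      using eq[OF n] by simp
    also have "\<dots> = emeasure M (U 1 n \<union> U (-1) n)"
    proof (rule plus_emeasure)
      show "U 1 n \<inter> U (-1) n = {}"
      proof (intro equals0I)
        fix \<omega> assume "\<omega> \<in> U 1 n \<inter> U (-1) n"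
        then obtain k k' where "\<omega> \<in> later x n k 1" "\<omega> \<in> later x n k' (-1)" by (auto simp: U_def)
        moreover from this have "k = k'" by (intro passage_unique[of \<omega> x n]) (auto simp: later_def)
        ultimately show False by (auto simp: later_def)
      qed
    qed (rule sets_U)+
    also have "\<dots> \<le> emeasure M {\<omega> \<in> space M. x \<le> bmax 1 \<omega>}"
    proof (rule emeasure_mono)
      have "x \<le> bmax 1 \<omega>" if "\<omega> \<in> passage x n k" "k \<le> n" for \<omega> k
      proof -
        have "0 \<le> real k / real n" "real k / real n \<le> 1" using that n by auto
        with that show ?thesis using bmax_upper[of \<omega> 1 "real k / real n"] by (simp add: passage_def)
      qed
      then show "U 1 n \<union> U (-1) n \<subseteq> {\<omega> \<in> space M. x \<le> bmax 1 \<omega>}"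
        by (auto simp: U_def later_def passage_def)
    qed measurable
    finally have "2 * emeasure M (U 1 n) \<le> emeasure M {\<omega> \<in> space M. x \<le> bmax 1 \<omega>}"
      by (simp add: mult_2)
    from divide_right_mono_ennreal[OF this, of 2]
    show "emeasure M (U 1 n) \<le> emeasure M {\<omega> \<in> space M. x \<le> bmax 1 \<omega>} / 2"
      by (simp add: mult.commute[of 2] ennreal_mult_divide_eq)
  next
    show "{\<omega> \<in> space M. x < X 1 \<omega> - X 0 \<omega>} \<in> sets M" by measurable
  qed (rule sets_U)
  then have "2 * emeasure std_gauss {x<..} \<le> 2 * (emeasure M {\<omega> \<in> space M. x \<le> bmax 1 \<omega>} / 2)"
    by (intro mult_left_mono) auto
  then show "2 * emeasure std_gauss {x<..} \<le> emeasure M {\<omega> \<in> space M. x \<le> bmax 1 \<omega>}"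
    by (simp add: ennreal_times_divide mult.commute[of 2] ennreal_mult_divide_eq)
qed

end

lemma floor_grid_tendsto:
  fixes t :: real
  assumes "0 \<le> t"
  shows "(\<lambda>n. real (nat \<lfloor>real (Suc n) * t\<rfloor>) / real (Suc n)) \<longlonglongrightarrow> t"
proof (rule real_tendsto_sandwich)
  have "t - 1 / real (Suc n) \<le> real (nat \<lfloor>real (Suc n) * t\<rfloor>) / real (Suc n)" for n
  proof -
    have "real (Suc n) * t - 1 \<le> real (nat \<lfloor>real (Suc n) * t\<rfloor>)" using assms by linarith
    from divide_right_mono[OF this, of "real (Suc n)"] show ?thesis by (simp add: diff_divide_distrib)
  qed
  then show "\<forall>\<^sub>F n in sequentially. t - 1 / real (Suc n) \<le> real (nat \<lfloor>real (Suc n) * t\<rfloor>) / real (Suc n)"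
    by simp
  have "real (nat \<lfloor>real (Suc n) * t\<rfloor>) / real (Suc n) \<le> t" for n
  proof -
    have "real (nat \<lfloor>real (Suc n) * t\<rfloor>) \<le> real (Suc n) * t" using assms by simp
    from divide_right_mono[OF this, of "real (Suc n)"] show ?thesis by simp
  qed
  then show "\<forall>\<^sub>F n in sequentially. real (nat \<lfloor>real (Suc n) * t\<rfloor>) / real (Suc n) \<le> t" by simp
  show "(\<lambda>n. t - 1 / real (Suc n)) \<longlonglongrightarrow> t"
    using tendsto_diff[OF tendsto_const[of t] LIMSEQ_inverse_real_of_nat] by (simp add: inverse_eq_divide)
qed simp

lemma sigma_finite_std_gauss: "sigma_finite_measure std_gauss"
  using prob_space_imp_sigma_finite prob_space_normal_density[of 1 0] by simp

context standard_brownian_motion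
begin

subsection \<open>Moments of the maximum\<close>

lemma measurable_psup_wiener [measurable]: "psup \<in> borel_measurable wiener"
  by (simp add: measurable_cong_sets[OF sets_wiener refl])

lemma emeasure_wiener_psup:
  assumes [measurable]: "Measurable.pred borel P"
  shows "emeasure wiener {w \<in> mspace C01. P (psup w)} = emeasure M {\<omega> \<in> space M. P (bmax 1 \<omega>)}"
proof -
  have "{w \<in> space borel_C01. P (psup w)} \<in> sets borel_C01" by measurable
  then show ?thesis
    using measurable_space[OF measurable_seg[of 0 1]]
    by (subst wiener_def, subst emeasure_distr)
      (auto simp: bmax_def measurable_seg space_wiener vimage_def Int_def conj_commute intro!: arg_cong[of _ _ "emeasure M"])
qed

lemma std_gauss_excess:
  "2 * (\<integral>\<^sup>+x. ennreal (x - K) \<partial>std_gauss) =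
    (\<integral>\<^sup>+x. indicator {K<..} x * (2 * emeasure std_gauss {x<..}) \<partial>lborel)"
proof -
  have [measurable]: "(\<lambda>x. emeasure std_gauss {x<..}) \<in> borel_measurable lborel"
  proof -
    interpret G: sigma_finite_measure std_gauss by (rule sigma_finite_std_gauss)
    have "{p \<in> space (borel \<Otimes>\<^sub>M borel). fst p < (snd p :: real)} \<in> sets (borel \<Otimes>\<^sub>M borel)" by measurable
    then show ?thesis by (intro G.measurable_emeasure) (auto simp: space_pair_measure)
  qed
  have "{y \<in> space std_gauss. x < y} = {x<..}" for x :: real by auto
  then have "(\<integral>\<^sup>+x. ennreal (x - K) \<partial>std_gauss) =
      (\<integral>\<^sup>+x. indicator {K<..} x * emeasure std_gauss {x<..} \<partial>lborel)"
    using sigma_finite_measure.nn_integral_excess(1)[OF sigma_finite_std_gauss, of "\<lambda>x. x" K] by simp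
  also have "2 * \<dots> = (\<integral>\<^sup>+x. 2 * (indicator {K<..} x * emeasure std_gauss {x<..}) \<partial>lborel)"
    by (subst nn_integral_cmult) auto
  finally show ?thesis by (simp add: mult.left_commute)
qed

lemma psup_excess_le:
  assumes "0 \<le> K"
  shows "(\<integral>\<^sup>+w. ennreal (psup w - K) \<partial>wiener) \<le> 2 * (\<integral>\<^sup>+x. ennreal (x - K) \<partial>std_gauss)"
proof -
  interpret W: prob_space wiener by (rule prob_space_wiener)
  show ?thesis
    unfolding std_gauss_excess W.nn_integral_excess(1)[OF measurable_psup_wiener]
    using reflection_upper assms emeasure_wiener_psup[of "\<lambda>y. _ < y"]
    by (intro nn_integral_mono) (auto simp: indicator_def)
qed

text \<open>Integrating over levels erases the gap between strict and weak level sets, so the two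
  one-sided reflection bounds meet in an exact mean.\<close>

lemma psup_mean: "(\<integral>\<^sup>+w. ennreal (psup w) \<partial>wiener) = ennreal (sqrt (2 / pi))"
proof (rule antisym)
  show "(\<integral>\<^sup>+w. ennreal (psup w) \<partial>wiener) \<le> ennreal (sqrt (2 / pi))"
    using psup_excess_le[of 0] by (simp add: std_gauss_pos_part)
  interpret W: prob_space wiener by (rule prob_space_wiener)
  have "2 * (\<integral>\<^sup>+x. ennreal (x - 0) \<partial>std_gauss) \<le> (\<integral>\<^sup>+w. ennreal (psup w - 0) \<partial>wiener)"
    unfolding std_gauss_excess W.nn_integral_excess(2)[OF measurable_psup_wiener]
    using reflection_lower emeasure_wiener_psup[of "\<lambda>y. _ \<le> y"]
    by (intro nn_integral_mono) (auto simp: indicator_def)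
  then show "ennreal (sqrt (2 / pi)) \<le> (\<integral>\<^sup>+w. ennreal (psup w) \<partial>wiener)"
    by (simp add: std_gauss_pos_part)
qed

lemma psup_tail: "0 < K \<Longrightarrow> (\<integral>\<^sup>+w. ennreal (psup w - K) \<partial>wiener) \<le> ennreal (4 / K\<^sup>2)"
  using psup_excess_le[of K] std_gauss_tail[of K] by (intro order_trans[OF psup_excess_le]) auto

lemma nn_integral_seg:
  assumes [measurable]: "f \<in> borel_measurable borel_C01" and "0 \<le> s" "0 < h"
  shows "(\<integral>\<^sup>+\<omega>. f (seg s h \<omega>) \<partial>M) = (\<integral>\<^sup>+w. f w \<partial>wiener)"
  unfolding seg_law[OF assms(2,3), symmetric]
  using assms by (subst nn_integral_distr) (auto intro!: measurable_seg)

lemma bmax_mean: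
  assumes t: "0 < t"
  shows "(\<integral>\<^sup>+\<omega>. ennreal (bmax t \<omega>) \<partial>M) = ennreal (sqrt t * sqrt (2 / pi))"
proof -
  have "(\<integral>\<^sup>+\<omega>. ennreal (bmax t \<omega>) \<partial>M) = (\<integral>\<^sup>+\<omega>. ennreal (sqrt t * psup (seg 0 t \<omega>)) \<partial>M)"
    by (simp add: bmax_def)
  also have "\<dots> = (\<integral>\<^sup>+w. ennreal (sqrt t * psup w) \<partial>wiener)"
    using t by (intro nn_integral_seg) auto
  also have "\<dots> = ennreal (sqrt t) * (\<integral>\<^sup>+w. ennreal (psup w) \<partial>wiener)"
    using t by (subst nn_integral_cmult[symmetric]) (auto simp: ennreal_mult')
  finally show ?thesis using t by (simp add: psup_mean ennreal_mult)
qed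

lemma bmax_scaling:
  assumes t: "0 < t"
  shows "emeasure M {\<omega> \<in> space M. c \<le> bmax t \<omega>} = emeasure M {\<omega> \<in> space M. c / sqrt t \<le> bmax 1 \<omega>}"
proof -
  have "{w \<in> space borel_C01. c \<le> sqrt t * psup w} \<in> sets borel_C01" by measurable
  note m = this[simplified]
  have "emeasure M {\<omega> \<in> space M. c \<le> bmax t \<omega>} = emeasure (distr M borel_C01 (seg 0 t)) {w \<in> space borel_C01. c \<le> sqrt t * psup w}"
    using t measurable_space[OF measurable_seg[of 0 t]]
    by (subst emeasure_distr) (auto simp: bmax_def measurable_seg m intro!: arg_cong[of _ _ "emeasure M"])
  also have "\<dots> = emeasure wiener {w \<in> mspace C01. c / sqrt t \<le> psup w}"
    using t by (simp add: seg_law divide_le_eq mult.commute)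
  also have "\<dots> = emeasure M {\<omega> \<in> space M. c / sqrt t \<le> bmax 1 \<omega>}"
    by (rule emeasure_wiener_psup) measurable
  finally show ?thesis .
qed

text \<open>By scaling, the probability of reaching level 1 by time \<open>n\<close> is at least
  twice the Gaussian mass above \<open>1 / sqrt n\<close>, which tends to 1. This makes the hitting
  time an infimum over a nonempty set almost surely.\<close>

lemma AE_bmax_unbounded: "AE \<omega> in M. \<exists>n. 1 \<le> bmax (real (Suc n)) \<omega>"
proof -
  have [measurable]: "bmax (real (Suc n)) \<in> borel_measurable M" for n by (intro measurable_bmax) simp
  let ?A = "{\<omega> \<in> space M. \<exists>n. 1 \<le> bmax (real (Suc n)) \<omega>}"
  have A: "?A \<in> sets M" by measurable
  have "emeasure std_gauss {0<..} + emeasure std_gauss {0<..} = 1"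
  proof -
    interpret G: prob_space std_gauss using prob_space_normal_density[of 1 0] by simp
    have "1 = emeasure std_gauss (({0<..} \<union> {..<0}) \<union> {0})"
    proof -
      have "({0<..} \<union> {..<0}) \<union> {0} = (UNIV :: real set)" by auto
      then show ?thesis using G.emeasure_space_1 by simp
    qed
    also have "\<dots> = emeasure std_gauss ({0<..} \<union> {..<0})"
      by (rule emeasure_Un_null_set) (auto simp: null_sets_def std_gauss_point)
    also have "\<dots> = emeasure std_gauss {0<..} + emeasure std_gauss {..<0}"
      by (rule plus_emeasure[symmetric]) auto
    finally show ?thesis by (simp add: std_gauss_symmetric)
  qed
  moreover have "2 * emeasure std_gauss {0<..} \<le> emeasure M ?A"
  proof -
    have U: "{0<..} = (\<Union>n. {1 / sqrt (real (Suc n))<..} :: real set)"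
    proof (intro equalityI subsetI)
      fix x :: real assume "x \<in> {0<..}"
      then obtain n where "1 / x\<^sup>2 < real (Suc n)" using reals_Archimedean2 [of "1 / x\<^sup>2"] by (metis lessI less_trans of_nat_less_iff)
      then have "sqrt (1 / x\<^sup>2) < sqrt (real (Suc n))" by simp
      with \<open>x \<in> {0<..}\<close> have "1 / sqrt (real (Suc n)) < x" by (simp add: real_sqrt_divide field_simps)
      then show "x \<in> (\<Union>n. {1 / sqrt (real (Suc n))<..})" by blast
    next
      fix x :: real assume "x \<in> (\<Union>n. {1 / sqrt (real (Suc n))<..})"
      then obtain n where "1 / sqrt (real (Suc n)) < x" by blast
      moreover have "0 < 1 / sqrt (real (Suc n))" by simp
      ultimately have "0 < x" by (rule less_trans[rotated])
      then show "x \<in> {0<..}" by simp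
    qed
    have inc: "incseq (\<lambda>n. {1 / sqrt (real (Suc n))<..})"
      by (intro incseq_SucI) (auto intro!: divide_left_mono elim: le_less_trans[rotated])
    have "range (\<lambda>n. {1 / sqrt (real (Suc n))<..}) \<subseteq> sets std_gauss" by auto
    from Lim_emeasure_incseq[OF this inc]
    have "(\<lambda>n. emeasure std_gauss {1 / sqrt (real (Suc n))<..}) \<longlonglongrightarrow> emeasure std_gauss {0<..}"
      unfolding U .
    then have "(\<lambda>n. 2 * emeasure std_gauss {1 / sqrt (real (Suc n))<..}) \<longlonglongrightarrow> 2 * emeasure std_gauss {0<..}"
      by (intro ennreal_tendsto_cmult) auto
    then show ?thesis
    proof (rule LIMSEQ_le_const2, intro exI[of _ 0] allI impI)
      fix n :: nat
      have "2 * emeasure std_gauss {1 / sqrt (real (Suc n))<..} \<le> emeasure M {\<omega> \<in> space M. 1 / sqrt (real (Suc n)) \<le> bmax 1 \<omega>}"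
        by (rule reflection_lower) simp
      also have "\<dots> = emeasure M {\<omega> \<in> space M. 1 \<le> bmax (real (Suc n)) \<omega>}"
        by (rule bmax_scaling[symmetric]) simp
      also have "\<dots> \<le> emeasure M ?A" using A by (intro emeasure_mono) auto
      finally show "2 * emeasure std_gauss {1 / sqrt (real (Suc n))<..} \<le> emeasure M ?A" .
    qed
  qed
  ultimately have "1 \<le> emeasure M ?A" by (simp add: mult_2)
  then have "emeasure M ?A = 1" using emeasure_le_1[of ?A] by (simp add: antisym)
  then have "prob ?A = 1" by (simp add: measure_def)
  with A show ?thesis by (simp add: prob_Collect_eq_1 del: of_nat_Suc)
qed

subsection \<open>The expected gain of the maximum\<close>

text \<open>The mean of \<open>F\<close> of the normalised path up to \<open>t\<close>, weighted by
  the increase of the maximum during the following time \<open>h\<close>. Truncation of negative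
  values by \<open>ennreal\<close> expresses that the maximum grows only by what the new segment
  achieves beyond the drawdown.\<close>

definition gain :: "((real \<Rightarrow> real) \<Rightarrow> real) \<Rightarrow> real \<Rightarrow> real \<Rightarrow> ennreal" where
  "gain F t h = (\<integral>\<^sup>+g. \<integral>\<^sup>+f. ennreal (F f) * ennreal (sqrt h * psup g - sqrt t * (psup f - f 1)) \<partial>wiener \<partial>wiener)"

text \<open>Brownian paths start at 0, while \<open>C01\<close> also contains paths that start and
  stay below 0.\<close>

lemma AE_wiener_nonneg: "AE f in wiener. 0 \<le> psup f"
proof -
  have "AE \<omega> in M. 0 \<le> psup (seg 0 1 \<omega>)"
    using bmax_nonneg[of _ 1] by (intro AE_I2) (simp add: bmax_def)
  moreover have "{f \<in> space borel_C01. 0 \<le> psup f} \<in> sets borel_C01" by measurable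
  ultimately show ?thesis
    unfolding wiener_def by (subst AE_distr_iff) (auto intro!: measurable_seg)
qed

lemma nn_integral_joint:
  assumes [measurable]: "\<Phi> \<in> borel_measurable (borel_C01 \<Otimes>\<^sub>M borel_C01)" and t: "0 < t" "0 < h"
  shows "(\<integral>\<^sup>+\<omega>. \<Phi> (seg 0 t \<omega>, seg t h \<omega>) \<partial>M) = (\<integral>\<^sup>+p. \<Phi> p \<partial>(wiener \<Otimes>\<^sub>M wiener))"
  unfolding seg_joint_law[OF t, symmetric] using t
  by (subst nn_integral_distr) (auto intro!: measurable_Pair measurable_seg)

lemma gain_pair:
  assumes [measurable]: "F \<in> borel_measurable borel_C01"
  shows "gain F t h = (\<integral>\<^sup>+p. ennreal (F (fst p)) *
      ennreal (sqrt h * psup (snd p) - sqrt t * (psup (fst p) - fst p 1)) \<partial>(wiener \<Otimes>\<^sub>M wiener))"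
proof -
  interpret W: prob_space wiener by (rule prob_space_wiener)
  interpret WW: pair_sigma_finite wiener wiener ..
  have [measurable]: "(\<lambda>f. f 1) \<in> borel_measurable borel_C01" by (intro measurable_eval_C01) auto
  show ?thesis unfolding gain_def by (subst WW.nn_integral_snd[symmetric]) (auto simp: case_prod_beta)
qed

lemma bmax_gain:
  assumes \<omega>: "\<omega> \<in> space M" and t: "0 < t" "0 < h"
  shows "ennreal (sqrt h * psup (seg t h \<omega>) - sqrt t * (psup (seg 0 t \<omega>) - seg 0 t \<omega> 1)) =
    ennreal (bmax (t + h) \<omega> - bmax t \<omega>)"
proof -
  have "sqrt t * seg 0 t \<omega> 1 = X t \<omega> - X 0 \<omega>" using sqrt_mult_seg[of t 1 0] t by simp
  then have "bmax (t + h) \<omega> - bmax t \<omega> =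
      max 0 (sqrt h * psup (seg t h \<omega>) - sqrt t * (psup (seg 0 t \<omega>) - seg 0 t \<omega> 1))"
    unfolding bmax_split[OF assms] by (auto simp: bmax_def right_diff_distrib max_def)
  then show ?thesis by (simp add: max_def ennreal_neg)
qed

lemma gain_eq:
  assumes [measurable]: "F \<in> borel_measurable borel_C01" and t: "0 < t" "0 < h"
  shows "gain F t h = (\<integral>\<^sup>+\<omega>. ennreal (F (seg 0 t \<omega>)) * ennreal (bmax (t + h) \<omega> - bmax t \<omega>) \<partial>M)"
proof -
  have [measurable]: "(\<lambda>f. f 1) \<in> borel_measurable borel_C01" by (intro measurable_eval_C01) auto
  show ?thesis
    unfolding gain_pair[OF assms(1)]
    by (subst nn_integral_joint[OF _ t, symmetric]) (auto simp: bmax_gain[OF _ t] intro!: nn_integral_cong)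
qed

text \<open>Adding the mean of \<open>bmax t\<close> back avoids subtraction of extended reals; the
  result is a difference of two means known from scaling.\<close>

lemma gain_one:
  assumes t: "0 < t" "0 < h"
  shows "gain (\<lambda>_. 1) t h = ennreal (sqrt (2 / pi) * (sqrt (t + h) - sqrt t))"
proof -
  have [measurable]: "bmax (t + h) \<in> borel_measurable M" "bmax t \<in> borel_measurable M"
    using t by (auto intro: measurable_bmax)
  have "gain (\<lambda>_. 1) t h + (\<integral>\<^sup>+\<omega>. ennreal (bmax t \<omega>) \<partial>M) =
      (\<integral>\<^sup>+\<omega>. ennreal (bmax (t + h) \<omega> - bmax t \<omega>) + ennreal (bmax t \<omega>) \<partial>M)"
    by (subst nn_integral_add) (auto simp: gain_eq[OF _ t])
  also have "\<dots> = (\<integral>\<^sup>+\<omega>. ennreal (bmax (t + h) \<omega>) \<partial>M)"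
    using bmax_split t bmax_nonneg
    by (intro nn_integral_cong) (simp add: ennreal_plus[symmetric] del: ennreal_plus)
  finally have "gain (\<lambda>_. 1) t h + ennreal (sqrt t * sqrt (2 / pi)) = ennreal (sqrt (t + h) * sqrt (2 / pi))"
    using t by (simp add: bmax_mean)
  also have "\<dots> = ennreal (sqrt (2 / pi) * (sqrt (t + h) - sqrt t)) + ennreal (sqrt t * sqrt (2 / pi))"
    using t by (subst ennreal_plus[symmetric]) (auto simp: algebra_simps)
  finally show ?thesis by (simp add: add.commute[of _ "ennreal (sqrt t * sqrt (2 / pi))"] ennreal_add_left_cancel)
qed

subsection \<open>The hitting time of level one\<close>

text \<open>On this almost sure event the infimum in \<open>hitting_time\<close> is over a nonempty
  set and is positive. Integer times suffice and keep the event a countable union.\<close>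

definition good :: "'a set" where
  "good = {\<omega> \<in> space M. X 0 \<omega> = 0 \<and> (\<exists>n. 1 \<le> bmax (real (Suc n)) \<omega>)}"

lemma sets_good [measurable]: "good \<in> sets M"
proof -
  have [measurable]: "bmax (real (Suc n)) \<in> borel_measurable M" "X 0 \<in> borel_measurable M" for n
    by (auto intro: rv measurable_bmax)
  show ?thesis unfolding good_def by measurable
qed

lemma AE_good: "AE \<omega> in M. \<omega> \<in> good"
  using AE_bmax_unbounded start AE_space by eventually_elim (auto simp: good_def)

lemma reaches_one:
  assumes "\<omega> \<in> space M" "X 0 \<omega> = 0" "0 \<le> u" "1 \<le> X u \<omega>"
  obtains v where "0 \<le> v" "v \<le> u" "X v \<omega> = 1"
proof -
  have "\<exists>v\<ge>0. v \<le> u \<and> X v \<omega> = 1"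
    by (rule IVT') (use assms in \<open>auto intro: continuous_on_subset[OF continuous_paths]\<close>)
  then show ?thesis using that by blast
qed

text \<open>The level set is closed, so the infimum is attained, and the intermediate value theorem
  gives a hit no later than any time at which the maximum has reached 1. The equivalence translates
  hitting times into maxima at deterministic times.\<close>

lemma hitting_time_good:
  assumes g: "\<omega> \<in> good"
  shows hitting_time_pos: "0 < hitting_time X 1 \<omega>"
    and hitting_time_le_iff: "\<And>t. 0 < t \<Longrightarrow> hitting_time X 1 \<omega> \<le> t \<longleftrightarrow> 1 \<le> bmax t \<omega>"
proof -
  let ?H = "{t. 0 \<le> t \<and> X t \<omega> = 1}"
  have \<omega>: "\<omega> \<in> space M" "X 0 \<omega> = 0" using g by (auto simp: good_def)
  obtain n where n: "1 \<le> bmax (real (Suc n)) \<omega>" using g by (auto simp: good_def)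
  have reach: "\<exists>v\<in>?H. v \<le> t" if t: "0 < t" "1 \<le> bmax t \<omega>" for t
  proof -
    obtain u where u: "0 \<le> u" "u \<le> t" "X u \<omega> - X 0 \<omega> = bmax t \<omega>" using bmax_attained[OF \<omega>(1) t(1)] by metis
    then obtain v where "0 \<le> v" "v \<le> u" "X v \<omega> = 1" using reaches_one[OF \<omega> u(1)] \<omega> t by auto
    with u show ?thesis by force
  qed
  have ne: "?H \<noteq> {}" using reach[OF _ n] by auto
  have bdd: "bdd_below ?H" by (intro bdd_belowI[of _ 0]) auto
  have "closed {t \<in> {0..}. X t \<omega> = 1}"
    using continuous_closed_preimage_constant[OF continuous_paths[OF \<omega>(1)]] by simp
  then have "closed ?H" by simp
  then have mem: "hitting_time X 1 \<omega> \<in> ?H"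
    unfolding hitting_time_def by (rule closed_contains_Inf[OF ne bdd])
  then have "hitting_time X 1 \<omega> \<noteq> 0" using \<omega> by auto
  with mem show "0 < hitting_time X 1 \<omega>" by auto
  fix t :: real assume t: "0 < t"
  show "hitting_time X 1 \<omega> \<le> t \<longleftrightarrow> 1 \<le> bmax t \<omega>"
  proof
    assume "hitting_time X 1 \<omega> \<le> t"
    then show "1 \<le> bmax t \<omega>" using bmax_upper[OF \<omega>(1) t, of "hitting_time X 1 \<omega>"] mem \<omega> by auto
  next
    assume "1 \<le> bmax t \<omega>"
    then obtain v where "v \<in> ?H" "v \<le> t" using reach t by blast
    then show "hitting_time X 1 \<omega> \<le> t"
      unfolding hitting_time_def using cInf_lower[OF _ bdd] by force
  qed
qed

text \<open>Off \<open>good\<close> the hitting time may be the infimum of the empty set, an unspecified real.\<close>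

definition tau :: "'a \<Rightarrow> real" where
  "tau \<omega> = (if \<omega> \<in> good then hitting_time X 1 \<omega> else 1)"

lemma tau_pos: "0 < tau \<omega>"
  by (simp add: tau_def hitting_time_pos)

lemma tau_le_iff: "\<omega> \<in> good \<Longrightarrow> 0 < t \<Longrightarrow> tau \<omega> \<le> t \<longleftrightarrow> 1 \<le> bmax t \<omega>"
  by (simp add: tau_def hitting_time_le_iff)

lemma measurable_tau [measurable]: "tau \<in> borel_measurable M"
proof (subst borel_measurable_iff_le, intro allI)
  fix t :: real
  show "{\<omega> \<in> space M. tau \<omega> \<le> t} \<in> sets M"
  proof (cases "0 < t")
    case False
    then have "\<not> tau \<omega> \<le> t" for \<omega> using tau_pos[of \<omega>] by linarith
    then have "{\<omega> \<in> space M. tau \<omega> \<le> t} = {}" by blast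
    then show ?thesis by (metis sets.empty_sets)
  next
    case True
    have [measurable]: "bmax t \<in> borel_measurable M" using True by (intro measurable_bmax) simp
    have "{\<omega> \<in> space M. tau \<omega> \<le> t} =
        {\<omega> \<in> space M. (\<omega> \<in> good \<and> 1 \<le> bmax t \<omega>) \<or> (\<omega> \<notin> good \<and> 1 \<le> t)}"
      using tau_le_iff[OF _ True] by (auto simp: tau_def)
    also have "\<dots> \<in> sets M" by measurable
    finally show ?thesis .
  qed
qed

section \<open>Paths evaluated at random times\<close>

lemma measurable_random_time:
  assumes [measurable]: "T \<in> borel_measurable N" "\<phi> \<in> measurable N M"
    and T: "\<And>z. z \<in> space N \<Longrightarrow> 0 \<le> T z"
  shows "(\<lambda>z. X (T z) (\<phi> z)) \<in> borel_measurable N"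
proof (rule borel_measurable_LIMSEQ_real)
  \<comment> \<open>Rounding down to a grid leaves countably many deterministic times, and
    continuity of the path recovers the value at \<open>T z\<close>.\<close>
  let ?q = "\<lambda>n z. nat \<lfloor>real (Suc n) * T z\<rfloor>"
  show "(\<lambda>z. X (real (?q n z) / real (Suc n)) (\<phi> z)) \<in> borel_measurable N" for n
  proof (rule measurable_compose_countable[where g = "?q n"])
    show "?q n \<in> measurable N (count_space UNIV)" by measurable
    show "(\<lambda>z. X (real i / real (Suc n)) (\<phi> z)) \<in> borel_measurable N" for i
      by (rule measurable_compose[OF assms(2) rv]) simp
  qed
  fix z assume z: "z \<in> space N"
  have "continuous_on {0..} (\<lambda>t. X t (\<phi> z))"
    using continuous_paths measurable_space[OF assms(2) z] by blast
  then show "(\<lambda>n. X (real (?q n z) / real (Suc n)) (\<phi> z)) \<longlonglongrightarrow> X (T z) (\<phi> z)"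
    using T[OF z] by (intro continuous_on_tendsto_compose[OF _ floor_grid_tendsto]) auto
qed

text \<open>The separate space \<open>N\<close> covers both uses: \<open>tau\<close> on
  \<open>M\<close> itself, and the time \<open>t / x\<^sup>2\<close> on the product of the levels
  with \<open>M\<close>.\<close>

lemma measurable_seg_random_time:
  assumes [measurable]: "T \<in> borel_measurable N" "\<phi> \<in> measurable N M"
    and T: "\<And>z. z \<in> space N \<Longrightarrow> 0 \<le> T z"
  shows "(\<lambda>z. seg 0 (T z) (\<phi> z)) \<in> measurable N borel_C01"
proof (rule measurable_C01I)
  show "seg 0 (T z) (\<phi> z) \<in> mspace C01" if "z \<in> space N" for z
    using seg_in_C01 T[OF that] measurable_space[OF assms(2) that] by simp
  fix r :: real assume r: "0 \<le> r" "r \<le> 1"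
  have [measurable]: "(\<lambda>z. X (T z * r) (\<phi> z)) \<in> borel_measurable N" "(\<lambda>z. X 0 (\<phi> z)) \<in> borel_measurable N"
    using T r by (auto intro!: measurable_random_time)
  show "(\<lambda>z. seg 0 (T z) (\<phi> z) r) \<in> borel_measurable N"
    using r by (simp add: seg_def)
qed

lemma seg_time_tendsto:
  assumes F: "continuous_map (mtopology_of C01) euclideanreal F"
    and \<omega>: "\<omega> \<in> space M" and t: "0 < t" and T: "\<And>n. 0 < T n" "T \<longlonglongrightarrow> t"
  shows "(\<lambda>n. F (seg 0 (T n) \<omega>)) \<longlonglongrightarrow> F (seg 0 t \<omega>)"
proof (rule C01_tendstoI[OF F])
  show "seg 0 t \<omega> \<in> mspace C01" "seg 0 (T n) \<omega> \<in> mspace C01" for n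
    using seg_in_C01[OF \<omega>] t T(1)[of n] by auto
  fix e :: real assume e: "0 < e"
  \<comment> \<open>A compact box with times bounded away from 0, where division by the square root
    of the time is harmless.\<close>
  let ?K = "{t / 2..2 * t} \<times> {0..1 :: real}"
  let ?Z = "\<lambda>p. (X (fst p * snd p) \<omega> - X 0 \<omega>) / sqrt (fst p)"
  have "continuous_on ?K (\<lambda>p. X (fst p * snd p) \<omega>)"
    by (rule continuous_on_compose2[OF continuous_paths[OF \<omega>]])
      (use t in \<open>auto intro!: continuous_intros\<close>)
  then have "continuous_on ?K ?Z"
    using t by (intro continuous_intros) auto
  then have "uniformly_continuous_on ?K ?Z"
    by (intro compact_uniformly_continuous compact_Times) auto
  then obtain d where d: "0 < d" "\<And>p q. p \<in> ?K \<Longrightarrow> q \<in> ?K \<Longrightarrow> dist q p < d \<Longrightarrow> dist (?Z q) (?Z p) < e"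
    using e unfolding uniformly_continuous_on_def by metis
  have "\<forall>\<^sub>F n in sequentially. dist (T n) t < min d (t / 2)"
    using T(2) d(1) t by (intro tendstoD) auto
  then show "\<forall>\<^sub>F n in sequentially. \<forall>s\<in>{0..1}. \<bar>seg 0 (T n) \<omega> s - seg 0 t \<omega> s\<bar> < e"
  proof eventually_elim
    case (elim n)
    show ?case
    proof
      fix s :: real assume s: "s \<in> {0..1}"
      have "(T n, s) \<in> ?K" "(t, s) \<in> ?K"
        using elim s t unfolding dist_real_def by (auto, linarith+)
      moreover have "dist (T n, s) (t, s) < d" using elim by (simp add: dist_Pair_Pair)
      ultimately have "dist (?Z (T n, s)) (?Z (t, s)) < e" by (intro d(2))
      then show "\<bar>seg 0 (T n) \<omega> s - seg 0 t \<omega> s\<bar> < e"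
        using s by (simp add: seg_def dist_real_def)
    qed
  qed
qed


text \<open>Multiplying the path by \<open>x\<close> and slowing time by \<open>x\<^sup>2\<close>
  turns level 1 into level \<open>x\<close> and \<open>tau\<close> into the hitting time of
  \<open>x\<close>. That time falls into the interval exactly when \<open>x\<close> is above the
  maximum of the scaled path at \<open>t\<close> but not above its maximum at
  \<open>t + h\<close>.\<close>

lemma level_crossing:
  assumes \<omega>: "\<omega> \<in> good" and x: "0 < x" and t: "0 < t" "0 < h"
  shows "x\<^sup>2 * tau \<omega> \<in> {t<..t + h} \<longleftrightarrow>
    x \<in> {sqrt t * psup (seg 0 (t / x\<^sup>2) \<omega>) <..
      max (sqrt t * psup (seg 0 (t / x\<^sup>2) \<omega>))
        (sqrt t * seg 0 (t / x\<^sup>2) \<omega> 1 + sqrt h * psup (seg (t / x\<^sup>2) (h / x\<^sup>2) \<omega>))}"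
proof -
  have \<omega>M: "\<omega> \<in> space M" using \<omega> by (simp add: good_def)
  let ?t = "t / x\<^sup>2" and ?h = "h / x\<^sup>2"
  have pos: "0 < ?t" "0 < ?h" using x t by auto
  have rt: "sqrt ?t = sqrt t / x" "sqrt ?h = sqrt h / x" using x by (auto simp: real_sqrt_divide)
  have "t < x\<^sup>2 * tau \<omega> \<longleftrightarrow> \<not> tau \<omega> \<le> ?t"
    using x by (simp add: not_le divide_less_eq mult.commute)
  also have "\<dots> \<longleftrightarrow> bmax ?t \<omega> < 1"
    using tau_le_iff[OF \<omega> pos(1)] by auto
  also have "\<dots> \<longleftrightarrow> sqrt t * psup (seg 0 ?t \<omega>) < x"
    using x by (simp add: bmax_def rt divide_less_eq)
  finally have 1: "t < x\<^sup>2 * tau \<omega> \<longleftrightarrow> sqrt t * psup (seg 0 ?t \<omega>) < x" .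
  have "x\<^sup>2 * tau \<omega> \<le> t + h \<longleftrightarrow> tau \<omega> \<le> ?t + ?h"
    using x by (simp add: add_divide_distrib[symmetric] le_divide_eq mult.commute)
  also have "\<dots> \<longleftrightarrow> 1 \<le> bmax (?t + ?h) \<omega>"
    using pos by (intro tau_le_iff[OF \<omega>]) simp
  also have "bmax (?t + ?h) \<omega> = max (bmax ?t \<omega>) (sqrt ?t * seg 0 ?t \<omega> 1 + sqrt ?h * psup (seg ?t ?h \<omega>))"
    using bmax_split[OF \<omega>M pos] sqrt_mult_seg[OF pos(1), of 1 0 \<omega>] by simp
  also have "\<dots> = max (sqrt t * psup (seg 0 ?t \<omega>)) (sqrt t * seg 0 ?t \<omega> 1 + sqrt h * psup (seg ?t ?h \<omega>)) / x"
    using x by (simp add: bmax_def rt max_divide_distrib_right add_divide_distrib)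
  also have "1 \<le> \<dots> \<longleftrightarrow> x \<le> max (sqrt t * psup (seg 0 ?t \<omega>)) (sqrt t * seg 0 ?t \<omega> 1 + sqrt h * psup (seg ?t ?h \<omega>))"
    using x by (simp add: le_divide_eq)
  finally show ?thesis using 1 by auto
qed

text \<open>The two segments vary with \<open>x\<close>, but their joint law does not. Under this
  fixed law only the indicator depends on \<open>x\<close>, and its integral is the length of the
  interval of levels passed by the maximum.\<close>

lemma nn_integral_level_crossing:
  assumes F [measurable]: "F \<in> borel_measurable borel_C01" and t: "0 < t" "0 < h"
  shows "(\<integral>\<^sup>+x. indicator {0<..} x *
      (\<integral>\<^sup>+\<omega>. ennreal (F (seg 0 (t / x\<^sup>2) \<omega>)) * indicator {t<..t + h} (x\<^sup>2 * tau \<omega>) \<partial>M) \<partial>lborel) = gain F t h"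
proof -
  interpret W: prob_space wiener by (rule prob_space_wiener)
  interpret WW: pair_prob_space wiener wiener ..
  interpret P: pair_sigma_finite "wiener \<Otimes>\<^sub>M wiener" lborel ..
  have [measurable]: "(\<lambda>f. f 1) \<in> borel_measurable borel_C01" by (intro measurable_eval_C01) auto
  define lo where "lo p = sqrt t * psup (fst p)" for p :: "(real \<Rightarrow> real) \<times> (real \<Rightarrow> real)"
  define hi where "hi p = max (lo p) (sqrt t * fst p 1 + sqrt h * psup (snd p))" for p :: "(real \<Rightarrow> real) \<times> (real \<Rightarrow> real)"
  have lohi [measurable]: "lo \<in> borel_measurable (borel_C01 \<Otimes>\<^sub>M borel_C01)" "hi \<in> borel_measurable (borel_C01 \<Otimes>\<^sub>M borel_C01)"
    unfolding hi_def[abs_def] lo_def[abs_def] by measurable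
  have [measurable]: "Measurable.pred (borel_C01 \<Otimes>\<^sub>M borel_C01) (\<lambda>p. x \<in> {lo p<..hi p})" for x
    unfolding greaterThanAtMost_iff by measurable
  have [measurable]: "Measurable.pred ((borel_C01 \<Otimes>\<^sub>M borel_C01) \<Otimes>\<^sub>M borel) (\<lambda>(p, x). x \<in> {lo p<..hi p})"
    unfolding greaterThanAtMost_iff by measurable
  have "(\<integral>\<^sup>+\<omega>. ennreal (F (seg 0 (t / x\<^sup>2) \<omega>)) * indicator {t<..t + h} (x\<^sup>2 * tau \<omega>) \<partial>M) =
      (\<integral>\<^sup>+p. ennreal (F (fst p)) * indicator {p. x \<in> {lo p<..hi p}} p \<partial>(wiener \<Otimes>\<^sub>M wiener))"
    if x: "0 < x" for x
  proof -
    have pos: "0 < t / x\<^sup>2" "0 < h / x\<^sup>2" using x t by auto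
    have "(\<integral>\<^sup>+\<omega>. ennreal (F (seg 0 (t / x\<^sup>2) \<omega>)) * indicator {t<..t + h} (x\<^sup>2 * tau \<omega>) \<partial>M) =
        (\<integral>\<^sup>+\<omega>. ennreal (F (seg 0 (t / x\<^sup>2) \<omega>)) *
          indicator {p. x \<in> {lo p<..hi p}} (seg 0 (t / x\<^sup>2) \<omega>, seg (t / x\<^sup>2) (h / x\<^sup>2) \<omega>) \<partial>M)"
    proof (rule nn_integral_cong_AE)
      show "AE \<omega> in M. ennreal (F (seg 0 (t / x\<^sup>2) \<omega>)) * indicator {t<..t + h} (x\<^sup>2 * tau \<omega>) =
          ennreal (F (seg 0 (t / x\<^sup>2) \<omega>)) *
          indicator {p. x \<in> {lo p<..hi p}} (seg 0 (t / x\<^sup>2) \<omega>, seg (t / x\<^sup>2) (h / x\<^sup>2) \<omega>)"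
        using AE_good
      proof eventually_elim
        case (elim \<omega>)
        show ?case
          using level_crossing[OF elim x t] unfolding indicator_def mem_Collect_eq lo_def hi_def fst_conv snd_conv
          by simp
      qed
    qed
    also have "\<dots> = (\<integral>\<^sup>+p. ennreal (F (fst p)) * indicator {p. x \<in> {lo p<..hi p}} p \<partial>(wiener \<Otimes>\<^sub>M wiener))"
      by (subst nn_integral_joint[OF _ pos, symmetric]) auto
    finally show ?thesis .
  qed
  then have "(\<integral>\<^sup>+x. indicator {0<..} x *
      (\<integral>\<^sup>+\<omega>. ennreal (F (seg 0 (t / x\<^sup>2) \<omega>)) * indicator {t<..t + h} (x\<^sup>2 * tau \<omega>) \<partial>M) \<partial>lborel) =
      (\<integral>\<^sup>+x. indicator {0<..} x *
        (\<integral>\<^sup>+p. ennreal (F (fst p)) * indicator {p. x \<in> {lo p<..hi p}} p \<partial>(wiener \<Otimes>\<^sub>M wiener)) \<partial>lborel)"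
    by (intro nn_integral_cong) (auto simp: indicator_def[of "{0<..}"])
  also have "\<dots> = (\<integral>\<^sup>+x. \<integral>\<^sup>+p. indicator {0<..} x *
        (ennreal (F (fst p)) * indicator {p. x \<in> {lo p<..hi p}} p) \<partial>(wiener \<Otimes>\<^sub>M wiener) \<partial>lborel)"
    by (intro nn_integral_cong nn_integral_cmult[symmetric]) measurable
  also have "\<dots> = (\<integral>\<^sup>+p. \<integral>\<^sup>+x. indicator {0<..} x *
        (ennreal (F (fst p)) * indicator {p. x \<in> {lo p<..hi p}} p) \<partial>lborel \<partial>(wiener \<Otimes>\<^sub>M wiener))"
    by (rule P.Fubini') measurable
  also have "\<dots> = (\<integral>\<^sup>+p. ennreal (F (fst p)) *
      ennreal (sqrt h * psup (snd p) - sqrt t * (psup (fst p) - fst p 1)) \<partial>(wiener \<Otimes>\<^sub>M wiener))"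
  proof (rule nn_integral_cong_AE)
    \<comment> \<open>Nonnegativity of the maximum places the whole interval of levels among the
      positive \<open>x\<close>.\<close>
    have "AE p in wiener \<Otimes>\<^sub>M wiener. 0 \<le> psup (fst p)"
    proof -
      have "{p \<in> space (wiener \<Otimes>\<^sub>M wiener). 0 \<le> psup (fst p)} \<in> sets (wiener \<Otimes>\<^sub>M wiener)" by measurable
      then show ?thesis
        by (rule WW.AE_pair_measure) (use AE_wiener_nonneg in auto)
    qed
    then show "AE p in wiener \<Otimes>\<^sub>M wiener. (\<integral>\<^sup>+x. indicator {0<..} x *
        (ennreal (F (fst p)) * indicator {p. x \<in> {lo p<..hi p}} p) \<partial>lborel) =
        ennreal (F (fst p)) * ennreal (sqrt h * psup (snd p) - sqrt t * (psup (fst p) - fst p 1))"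
    proof eventually_elim
      case (elim p)
      then have lo: "0 \<le> lo p" "lo p \<le> hi p" using t by (auto simp: lo_def hi_def)
      have "(\<integral>\<^sup>+x. indicator {0<..} x * (ennreal (F (fst p)) * indicator {p. x \<in> {lo p<..hi p}} p) \<partial>lborel) =
          (\<integral>\<^sup>+x. ennreal (F (fst p)) * indicator {lo p<..hi p} x \<partial>lborel)"
        using lo by (intro nn_integral_cong) (auto simp: indicator_def)
      also have "\<dots> = ennreal (F (fst p)) * ennreal (hi p - lo p)"
        using lo by (simp add: nn_integral_cmult)
      also have "ennreal (hi p - lo p) = ennreal (sqrt h * psup (snd p) - sqrt t * (psup (fst p) - fst p 1))"
        by (auto simp: hi_def max_def lo_def right_diff_distrib ennreal_neg)
      finally show ?case .
    qed
  qed
  also have "\<dots> = gain F t h" by (simp add: gain_pair)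
  finally show ?thesis .
qed

text \<open>
  By scaling, \<open>x\<^sup>2 * tau\<close> stands in for the hitting time of level \<open>x\<close>; the sum picks out the grid
  point of \<open>(1, 4]\<close> just before it.
\<close>

definition slot_sum :: "((real \<Rightarrow> real) \<Rightarrow> real) \<Rightarrow> nat \<Rightarrow> real \<times> 'a \<Rightarrow> ennreal" where
  "slot_sum F n = (\<lambda>(x, \<omega>). indicator {0<..} x * (\<Sum>i<n. ennreal (F (seg 0 ((1 + 3 / real n * real i) / x\<^sup>2) \<omega>)) *
     indicator {1 + 3 / real n * real i<..1 + 3 / real n * real i + 3 / real n} (x\<^sup>2 * tau \<omega>)))"

lemma measurable_slot_term:
  assumes [measurable]: "F \<in> borel_measurable borel_C01" and t: "0 < t"
  shows "(\<lambda>p. ennreal (F (seg 0 (t / (fst p)\<^sup>2) (snd p))) * indicator {t<..t + h} ((fst p)\<^sup>2 * tau (snd p)))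
    \<in> borel_measurable (lborel \<Otimes>\<^sub>M M)"
proof -
  have [measurable]: "(\<lambda>p. seg 0 (t / (fst p)\<^sup>2) (snd p)) \<in> measurable (lborel \<Otimes>\<^sub>M M) borel_C01"
    by (rule measurable_seg_random_time) (use t in auto)
  show ?thesis by measurable
qed

lemma slot_pos: "0 < 1 + 3 / real n * real i"
  by (rule add_pos_nonneg) auto

lemma measurable_slot_sum:
  assumes "F \<in> borel_measurable borel_C01"
  shows "slot_sum F n \<in> borel_measurable (lborel \<Otimes>\<^sub>M M)"
  unfolding slot_sum_def case_prod_beta
  by (intro borel_measurable_times_ennreal borel_measurable_sum measurable_slot_term assms slot_pos) measurable

lemma nn_integral_slot_sum:
  assumes F [measurable]: "F \<in> borel_measurable borel_C01"
  shows "(\<integral>\<^sup>+p. slot_sum F n p \<partial>(lborel \<Otimes>\<^sub>M M)) = (\<Sum>i<n. gain F (1 + 3 / real n * real i) (3 / real n))"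
proof -
  interpret P: pair_sigma_finite lborel M ..
  let ?g = "\<lambda>i x \<omega>. ennreal (F (seg 0 ((1 + 3 / real n * real i) / x\<^sup>2) \<omega>)) *
     indicator {1 + 3 / real n * real i<..1 + 3 / real n * real i + 3 / real n} (x\<^sup>2 * tau \<omega>)"
  have m1: "(\<lambda>p. ?g i (fst p) (snd p)) \<in> borel_measurable (lborel \<Otimes>\<^sub>M M)" for i
    by (rule measurable_slot_term[OF F slot_pos])
  have m2: "?g i x \<in> borel_measurable M" for i x
    using measurable_compose_Pair1[OF _ m1, of x i] by simp
  have m3: "(\<lambda>x. \<integral>\<^sup>+\<omega>. ?g i x \<omega> \<partial>M) \<in> borel_measurable lborel" for i
    using borel_measurable_nn_integral_fst[OF m1[of i]] by simp
  have "(\<integral>\<^sup>+p. slot_sum F n p \<partial>(lborel \<Otimes>\<^sub>M M)) = (\<integral>\<^sup>+x. \<integral>\<^sup>+\<omega>. slot_sum F n (x, \<omega>) \<partial>M \<partial>lborel)"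
    by (rule nn_integral_fst[symmetric, OF measurable_slot_sum[OF F]])
  also have "\<dots> = (\<integral>\<^sup>+x. (\<Sum>i<n. indicator {0<..} x * (\<integral>\<^sup>+\<omega>. ?g i x \<omega> \<partial>M)) \<partial>lborel)"
  proof (intro nn_integral_cong)
    fix x :: real
    have "(\<integral>\<^sup>+\<omega>. slot_sum F n (x, \<omega>) \<partial>M) = (\<integral>\<^sup>+\<omega>. indicator {0<..} x * (\<Sum>i<n. ?g i x \<omega>) \<partial>M)"
      by (simp only: slot_sum_def case_prod_conv)
    also have "\<dots> = indicator {0<..} x * (\<integral>\<^sup>+\<omega>. (\<Sum>i<n. ?g i x \<omega>) \<partial>M)"
      by (rule nn_integral_cmult[OF borel_measurable_sum[OF m2]])
    also have "\<dots> = (\<Sum>i<n. indicator {0<..} x * (\<integral>\<^sup>+\<omega>. ?g i x \<omega> \<partial>M))"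
      by (simp only: nn_integral_sum[OF m2] sum_distrib_left)
    finally show "(\<integral>\<^sup>+\<omega>. slot_sum F n (x, \<omega>) \<partial>M) = (\<Sum>i<n. indicator {0<..} x * (\<integral>\<^sup>+\<omega>. ?g i x \<omega> \<partial>M))" .
  qed
  also have "\<dots> = (\<Sum>i<n. \<integral>\<^sup>+x. indicator {0<..} x * (\<integral>\<^sup>+\<omega>. ?g i x \<omega> \<partial>M) \<partial>lborel)"
    by (rule nn_integral_sum[OF borel_measurable_times_ennreal[OF _ m3]]) measurable
  also have "\<dots> = (\<Sum>i<n. gain F (1 + 3 / real n * real i) (3 / real n))"
    by (intro sum.cong refl nn_integral_level_crossing F slot_pos) auto
  finally show ?thesis .
qed

lemma slot_sum_single:
  assumes x: "0 < x" and n: "0 < n" and y: "1 < x\<^sup>2 * tau \<omega>" "x\<^sup>2 * tau \<omega> \<le> 4"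
  shows "\<exists>s. x\<^sup>2 * tau \<omega> - 3 / real n \<le> s \<and> s < x\<^sup>2 * tau \<omega> \<and> 0 < s \<and>
    slot_sum F n (x, \<omega>) = ennreal (F (seg 0 (s / x\<^sup>2) \<omega>))"
proof -
  define y where "y = x\<^sup>2 * tau \<omega>"
  define h where "h = 3 / real n"
  have h: "0 < h" using n by (simp add: h_def)
  \<comment> \<open>Slots are open on the left and closed on the right: rounding up and subtracting
    1 assigns a grid point to the slot that ends there.\<close>
  define i where "i = nat (\<lceil>(y - 1) / h\<rceil> - 1)"
  have q: "0 < (y - 1) / h" using y h by (simp add: y_def)
  have "(y - 1) / h \<le> real n"
    using y n by (simp add: y_def h_def field_simps)
  then have i: "real i < (y - 1) / h" "(y - 1) / h \<le> real i + 1" "i < n"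
    using q unfolding i_def by linarith+
  have iy: "1 + h * real i < y" "y \<le> 1 + h * real i + h"
    using i(1,2) h by (auto simp: field_simps)
  have uniq: "j = i" if "1 + h * real j < y" "y \<le> 1 + h * real j + h" for j
  proof -
    have "h * real j < h * (real i + 1)" "h * real i < h * (real j + 1)" using iy that by (auto simp: ring_distribs)
    then have "real j < real i + 1" "real i < real j + 1" using h by (auto dest: mult_left_less_imp_less)
    then show ?thesis by linarith
  qed
  have ind: "indicator {1 + h * real j<..1 + h * real j + h} y = (if j = i then 1 else 0 :: ennreal)" for j
  proof (cases "j = i")
    case True
    then show ?thesis using iy by simp
  next
    case False
    then have "y \<notin> {1 + h * real j<..1 + h * real j + h}" using uniq[of j] by (meson greaterThanAtMost_iff)
    then show ?thesis using False by simp
  qed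
  have "slot_sum F n (x, \<omega>) = (\<Sum>j<n. ennreal (F (seg 0 ((1 + h * real j) / x\<^sup>2) \<omega>)) * (if j = i then 1 else 0))"
  proof -
    have "indicator {0<..} x = (1 :: ennreal)" using x by simp
    then show ?thesis
      by (simp only: slot_sum_def case_prod_conv h_def[symmetric] y_def[symmetric] ind mult_1)
  qed
  also have "\<dots> = ennreal (F (seg 0 ((1 + h * real i) / x\<^sup>2) \<omega>))"
  proof -
    have "(\<Sum>j<n. ennreal (F (seg 0 ((1 + h * real j) / x\<^sup>2) \<omega>)) * (if j = i then 1 else 0)) =
        (\<Sum>j<n. if j = i then ennreal (F (seg 0 ((1 + h * real j) / x\<^sup>2) \<omega>)) else 0)"
      by (rule sum.cong) auto
    then show ?thesis using i(3) by (simp only: sum.delta finite_lessThan lessThan_iff if_True)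
  qed
  finally show ?thesis
    using iy slot_pos[of n i] unfolding y_def[symmetric] h_def[symmetric]
    by (intro exI[of _ "1 + h * real i"] conjI) linarith+
qed

lemma slot_sum_outside:
  assumes "\<not> (0 < x \<and> 1 < x\<^sup>2 * tau \<omega> \<and> x\<^sup>2 * tau \<omega> \<le> 4)"
  shows "slot_sum F n (x, \<omega>) = 0"
proof (cases "0 < x")
  case True
  have "x\<^sup>2 * tau \<omega> \<notin> {1 + 3 / real n * real i<..1 + 3 / real n * real i + 3 / real n}" if "i < n" for i
  proof
    define h where "h = 3 / real n"
    assume "x\<^sup>2 * tau \<omega> \<in> {1 + 3 / real n * real i<..1 + 3 / real n * real i + 3 / real n}"
    then have *: "1 + h * real i < x\<^sup>2 * tau \<omega>" "x\<^sup>2 * tau \<omega> \<le> 1 + h * real i + h" by (auto simp: h_def)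
    have "0 \<le> h * real i" by (simp add: h_def)
    moreover have "h * (real i + 1) \<le> 3"
      using that by (simp add: h_def field_simps)
    then have "h * real i + h \<le> 3" by (simp add: ring_distribs)
    ultimately have "1 < x\<^sup>2 * tau \<omega>" "x\<^sup>2 * tau \<omega> \<le> 4" using * by linarith+
    with assms True show False by simp
  qed
  then have "indicator {1 + 3 / real n * real i<..1 + 3 / real n * real i + 3 / real n} (x\<^sup>2 * tau \<omega>) = (0 :: ennreal)"
    if "i < n" for i using that by simp
  then have "(\<Sum>i<n. ennreal (F (seg 0 ((1 + 3 / real n * real i) / x\<^sup>2) \<omega>)) *
     indicator {1 + 3 / real n * real i<..1 + 3 / real n * real i + 3 / real n} (x\<^sup>2 * tau \<omega>)) = 0"
    by (intro sum.neutral ballI) (simp only: lessThan_iff mult_zero_right)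
  then show ?thesis unfolding slot_sum_def case_prod_conv by (simp only: mult_zero_right)
qed (simp add: slot_sum_def)

section \<open>Limit of the slot sums and total mass\<close>

definition window :: "real \<times> 'a \<Rightarrow> ennreal" where
  "window = (\<lambda>(x, \<omega>). if 0 < x \<and> 1 < x\<^sup>2 * tau \<omega> \<and> x\<^sup>2 * tau \<omega> \<le> 4 then 1 else 0)"

lemma measurable_window: "window \<in> borel_measurable (lborel \<Otimes>\<^sub>M M)"
  unfolding window_def by measurable

lemma slot_sum_le_window:
  assumes "\<And>f. F f \<le> 1"
  shows "slot_sum F n p \<le> window p"
proof (cases p)
  case (Pair x \<omega>)
  show ?thesis
  proof (cases "0 < x \<and> 1 < x\<^sup>2 * tau \<omega> \<and> x\<^sup>2 * tau \<omega> \<le> 4")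
    case True
    show ?thesis
    proof (cases "0 < n")
      case n: True
      obtain s where "slot_sum F n (x, \<omega>) = ennreal (F (seg 0 (s / x\<^sup>2) \<omega>))"
        using slot_sum_single[of x n \<omega> F] True n by blast
      then show ?thesis using True assms by (simp add: window_def Pair ennreal_le_1)
    qed (simp add: slot_sum_def Pair)
  qed (simp add: slot_sum_outside Pair)
qed

text \<open>The grid time selected lies at most \<open>3 / n\<close> below
  \<open>x\<^sup>2 * tau \<omega>\<close>, and the rescaled path depends continuously on its time
  horizon.\<close>

lemma slot_sum_tendsto:
  assumes F: "continuous_map (mtopology_of C01) euclideanreal F" and \<omega>: "\<omega> \<in> space M"
  shows "(\<lambda>n. slot_sum F n (x, \<omega>)) \<longlonglongrightarrow> ennreal (F (seg 0 (tau \<omega>) \<omega>)) * window (x, \<omega>)"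
proof (cases "0 < x \<and> 1 < x\<^sup>2 * tau \<omega> \<and> x\<^sup>2 * tau \<omega> \<le> 4")
  case False
  then have "window (x, \<omega>) = 0" by (auto simp: window_def)
  then show ?thesis by (simp add: slot_sum_outside[OF False])
next
  case True
  have "\<exists>s. 0 < n \<longrightarrow> (x\<^sup>2 * tau \<omega> - 3 / real n \<le> s \<and> s < x\<^sup>2 * tau \<omega> \<and> 0 < s \<and>
    slot_sum F n (x, \<omega>) = ennreal (F (seg 0 (s / x\<^sup>2) \<omega>)))" for n
    using slot_sum_single[of x n \<omega> F] True by blast
  then obtain s where s: "\<And>n. 0 < n \<Longrightarrow> x\<^sup>2 * tau \<omega> - 3 / real n \<le> s n \<and> s n < x\<^sup>2 * tau \<omega> \<and> 0 < s n \<and>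
    slot_sum F n (x, \<omega>) = ennreal (F (seg 0 (s n / x\<^sup>2) \<omega>))"
    by metis
  have "(\<lambda>n. s (Suc n)) \<longlonglongrightarrow> x\<^sup>2 * tau \<omega>"
  proof (rule real_tendsto_sandwich)
    show "\<forall>\<^sub>F n in sequentially. x\<^sup>2 * tau \<omega> - 3 / real (Suc n) \<le> s (Suc n)"
      using s[OF zero_less_Suc] by (intro always_eventually allI) blast
    show "\<forall>\<^sub>F n in sequentially. s (Suc n) \<le> x\<^sup>2 * tau \<omega>" using s by (simp add: less_imp_le)
    have "(\<lambda>n. x\<^sup>2 * tau \<omega> - 3 * inverse (real (Suc n))) \<longlonglongrightarrow> x\<^sup>2 * tau \<omega> - 3 * 0"
      by (intro tendsto_intros LIMSEQ_inverse_real_of_nat)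
    then show "(\<lambda>n. x\<^sup>2 * tau \<omega> - 3 / real (Suc n)) \<longlonglongrightarrow> x\<^sup>2 * tau \<omega>" by (simp add: inverse_eq_divide)
  qed simp
  then have "(\<lambda>n. s (Suc n) / x\<^sup>2) \<longlonglongrightarrow> x\<^sup>2 * tau \<omega> / x\<^sup>2"
    using True by (intro tendsto_divide) auto
  then have "(\<lambda>n. F (seg 0 (s (Suc n) / x\<^sup>2) \<omega>)) \<longlonglongrightarrow> F (seg 0 (tau \<omega>) \<omega>)"
    using True s tau_pos by (intro seg_time_tendsto[OF F \<omega>]) auto
  then have "(\<lambda>n. slot_sum F (Suc n) (x, \<omega>)) \<longlonglongrightarrow> ennreal (F (seg 0 (tau \<omega>) \<omega>))"
    using s by (simp add: tendsto_ennrealI)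
  from filterlim_sequentially_Suc[THEN iffD1, OF this] show ?thesis using True by (simp add: window_def)
qed

lemma nn_integral_window: "(\<integral>\<^sup>+p. window p \<partial>(lborel \<Otimes>\<^sub>M M)) < \<infinity>"
proof -
  \<comment> \<open>A single slot covers the whole window, so the integral is one gain and therefore
    finite.\<close>
  have "window = slot_sum (\<lambda>_. 1) 1"
    by (auto simp: window_def slot_sum_def indicator_def fun_eq_iff)
  then show ?thesis
    using nn_integral_slot_sum[of "\<lambda>_. 1" 1] by (simp add: gain_one)
qed

text \<open>The levels in question satisfy \<open>1 < x * sqrt (tau \<omega>) \<le> 2\<close>, the
  square root of the time window. This is the origin of the weight in the theorem.\<close>

lemma window_section: "(\<integral>\<^sup>+x. window (x, \<omega>) \<partial>lborel) = ennreal (1 / sqrt (tau \<omega>))"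
proof -
  let ?r = "sqrt (tau \<omega>)"
  have r: "0 < ?r" using tau_pos[of \<omega>] by simp
  have "x\<^sup>2 * tau \<omega> = (x * ?r)\<^sup>2" for x using tau_pos[of \<omega>] by (simp add: power_mult_distrib)
  then have "window (x, \<omega>) = indicator {1 / ?r<..2 / ?r} x" for x
  proof (cases "0 < x")
    case True
    then have "0 < x * ?r" using r by simp
    then have "1 < (x * ?r)\<^sup>2 \<longleftrightarrow> 1 < x * ?r" "(x * ?r)\<^sup>2 \<le> 4 \<longleftrightarrow> x * ?r \<le> 2"
      using abs_le_square_iff[of "x * ?r" 1] abs_le_square_iff[of "x * ?r" 2] by (auto simp: not_le[symmetric])
    with True r \<open>\<And>x. x\<^sup>2 * tau \<omega> = (x * ?r)\<^sup>2\<close> show ?thesis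
      by (simp add: window_def indicator_def divide_less_eq le_divide_eq)
  next
    case False
    have "0 < 1 / ?r" using r by simp
    with False show ?thesis by (auto simp: window_def indicator_def)
  qed
  then have "(\<integral>\<^sup>+x. window (x, \<omega>) \<partial>lborel) = emeasure lborel {1 / ?r<..2 / ?r}" by simp
  also have "\<dots> = ennreal (1 / ?r)"
    using r by (subst emeasure_lborel_Ioc) (auto simp: divide_right_mono diff_divide_distrib[symmetric])
  finally show ?thesis .
qed

text \<open>The slot sum is integrated in two ways: slot by slot over levels and paths it is a sum
  of gains, whereas in the limit the integral over the levels can be carried out for each path
  separately.\<close>

lemma gain_sum_tendsto:
  assumes F: "continuous_map (mtopology_of C01) euclideanreal F" "\<And>f. 0 \<le> F f" "\<And>f. F f \<le> 1"
  shows "(\<lambda>n. \<Sum>i<n. gain F (1 + 3 / real n * real i) (3 / real n)) \<longlonglongrightarrow>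
    (\<integral>\<^sup>+\<omega>. ennreal (F (seg 0 (tau \<omega>) \<omega>)) * ennreal (1 / sqrt (tau \<omega>)) \<partial>M)"
proof -
  interpret P: pair_sigma_finite lborel M ..
  note Fm [measurable] = borel_measurable_continuous_map[OF F(1)]
  have "(\<lambda>\<omega>. seg 0 (tau \<omega>) \<omega>) \<in> measurable M borel_C01"
    by (rule measurable_seg_random_time) (auto simp: less_imp_le tau_pos)
  then have Y [measurable]: "(\<lambda>\<omega>. ennreal (F (seg 0 (tau \<omega>) \<omega>))) \<in> borel_measurable M" by measurable
  note [measurable] = measurable_window
  have "(\<lambda>n. \<integral>\<^sup>+p. slot_sum F n p \<partial>(lborel \<Otimes>\<^sub>M M)) \<longlonglongrightarrow>
      (\<integral>\<^sup>+p. ennreal (F (seg 0 (tau (snd p)) (snd p))) * window p \<partial>(lborel \<Otimes>\<^sub>M M))"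
  proof (rule nn_integral_dominated_convergence[where w = window])
    show "slot_sum F n \<in> borel_measurable (lborel \<Otimes>\<^sub>M M)" for n by (rule measurable_slot_sum[OF Fm])
    show "(\<lambda>p. ennreal (F (seg 0 (tau (snd p)) (snd p))) * window p) \<in> borel_measurable (lborel \<Otimes>\<^sub>M M)"
      using measurable_compose[OF measurable_snd Y] by measurable
    show "AE p in lborel \<Otimes>\<^sub>M M. slot_sum F n p \<le> window p" for n
      by (intro AE_I2 slot_sum_le_window F)
    show "AE p in lborel \<Otimes>\<^sub>M M. (\<lambda>n. slot_sum F n p) \<longlonglongrightarrow> ennreal (F (seg 0 (tau (snd p)) (snd p))) * window p"
      using slot_sum_tendsto[OF F(1)] by (intro AE_I2) (auto simp: space_pair_measure)
  qed (use nn_integral_window in \<open>auto simp: measurable_window\<close>)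
  also have "(\<integral>\<^sup>+p. ennreal (F (seg 0 (tau (snd p)) (snd p))) * window p \<partial>(lborel \<Otimes>\<^sub>M M)) =
      (\<integral>\<^sup>+\<omega>. \<integral>\<^sup>+x. ennreal (F (seg 0 (tau \<omega>) \<omega>)) * window (x, \<omega>) \<partial>lborel \<partial>M)"
    using measurable_compose[OF measurable_snd Y]
    by (subst P.nn_integral_snd[symmetric]) (auto simp: measurable_window)
  also have "\<dots> = (\<integral>\<^sup>+\<omega>. ennreal (F (seg 0 (tau \<omega>) \<omega>)) * ennreal (1 / sqrt (tau \<omega>)) \<partial>M)"
  proof (intro nn_integral_cong)
    fix \<omega> assume "\<omega> \<in> space M"
    then have "(\<lambda>x. window (x, \<omega>)) \<in> borel_measurable lborel"
      using measurable_compose[OF measurable_Pair2' measurable_window] by simp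
    then show "(\<integral>\<^sup>+x. ennreal (F (seg 0 (tau \<omega>) \<omega>)) * window (x, \<omega>) \<partial>lborel) =
        ennreal (F (seg 0 (tau \<omega>) \<omega>)) * ennreal (1 / sqrt (tau \<omega>))"
      by (simp add: nn_integral_cmult window_section)
  qed
  finally show ?thesis unfolding nn_integral_slot_sum[OF Fm] .
qed

text \<open>The mean maximum is proportional to the square root of time, so the sum telescopes to
  the factor \<open>sqrt 4 - sqrt 1 = 1\<close>.\<close>

lemma sum_gain_one:
  assumes n: "0 < n"
  shows "(\<Sum>i<n. gain (\<lambda>_. 1) (1 + 3 / real n * real i) (3 / real n)) = ennreal (sqrt (2 / pi))"
proof -
  let ?s = "\<lambda>i. sqrt (1 + 3 / real n * real i)"
  have "(\<Sum>i<n. gain (\<lambda>_. 1) (1 + 3 / real n * real i) (3 / real n)) =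
      (\<Sum>i<n. ennreal (sqrt (2 / pi) * (?s (Suc i) - ?s i)))"
  proof (intro sum.cong refl)
    fix i
    have "1 + 3 / real n * real i + 3 / real n = 1 + 3 / real n * real (Suc i)"
      by (simp add: ring_distribs add_divide_distrib)
    then show "gain (\<lambda>_. 1) (1 + 3 / real n * real i) (3 / real n) = ennreal (sqrt (2 / pi) * (?s (Suc i) - ?s i))"
      using gain_one[OF slot_pos, of "3 / real n" n i] n by (simp only: of_nat_0_less_iff divide_pos_pos zero_less_numeral simp_thms)
  qed
  also have "\<dots> = ennreal (\<Sum>i<n. sqrt (2 / pi) * (?s (Suc i) - ?s i))"
  proof (intro sum_ennreal mult_nonneg_nonneg)
    fix i
    have "?s i \<le> ?s (Suc i)" by (intro real_sqrt_le_mono add_left_mono mult_left_mono) auto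
    then show "0 \<le> ?s (Suc i) - ?s i" by simp
  qed simp
  also have "(\<Sum>i<n. sqrt (2 / pi) * (?s (Suc i) - ?s i)) = sqrt (2 / pi) * (?s n - ?s 0)"
    using sum_lessThan_telescope[of ?s n] by (simp only: sum_distrib_left[symmetric])
  also have "\<dots> = sqrt (2 / pi)" using n by simp
  finally show ?thesis .
qed

lemma tau_mean: "(\<integral>\<^sup>+\<omega>. ennreal (1 / sqrt (tau \<omega>)) \<partial>M) = ennreal (sqrt (2 / pi))"
proof (rule LIMSEQ_unique)
  show "(\<lambda>n. \<Sum>i<n. gain (\<lambda>_. 1) (1 + 3 / real n * real i) (3 / real n)) \<longlonglongrightarrow>
      (\<integral>\<^sup>+\<omega>. ennreal (1 / sqrt (tau \<omega>)) \<partial>M)"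
    using gain_sum_tendsto[of "\<lambda>_. 1"] by simp
  show "(\<lambda>n. \<Sum>i<n. gain (\<lambda>_. 1) (1 + 3 / real n * real i) (3 / real n)) \<longlonglongrightarrow> ennreal (sqrt (2 / pi))"
    by (rule tendsto_eventually) (rule eventually_mono[OF eventually_gt_at_top[of 0] sum_gain_one])
qed

end

text \<open>With two decompositions of one finite mass, the larger part has the smaller complement.
  This turns an upper bound for \<open>1 - F\<close> into a lower bound for
  \<open>F\<close>.\<close>

lemma ennreal_summand_antimono:
  fixes a a' b b' s :: ennreal
  assumes "a + a' = s" "b + b' = s" "a' \<le> b'" "s \<noteq> \<infinity>"
  shows "b \<le> a"
proof -
  have "b' \<le> s" using assms(2) by (metis add.commute le_iff_add)
  then have "b' \<noteq> \<infinity>" using assms(4) by (auto simp: top_unique)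
  moreover have "b' + b \<le> b' + a"
    using assms(1-3) add_left_mono[of a' b' a] by (simp add: add.commute)
  ultimately show ?thesis by (simp add: ennreal_add_left_cancel_le)
qed

context standard_brownian_motion
begin

subsection \<open>Comparison with the conditioned path\<close>

abbreviation drawdown :: "(real \<Rightarrow> real) \<Rightarrow> real" where
  "drawdown f \<equiv> psup f - f 1"

lemma drawdown_nonneg: "f \<in> mspace C01 \<Longrightarrow> 0 \<le> drawdown f"
  using le_psup[of f 1] by simp

lemma measurable_drawdown [measurable]: "drawdown \<in> borel_measurable borel_C01"
  by (intro borel_measurable_diff measurable_psup measurable_eval_C01) auto

text \<open>
  The conditional expectations are controlled only for \<open>v < \<eta>\<close>; the last term pays for \<open>v \<ge> \<eta>\<close>, where
  a drawdown of that size has to be overcome by the next increment of the maximum.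
\<close>

lemma inner_gain_le:
  fixes C :: ennreal
  assumes F [measurable]: "F \<in> borel_measurable borel_C01" and F1: "\<And>f. F f \<le> 1"
    and t: "1 \<le> t"
    and near: "\<And>v. 0 < v \<Longrightarrow> v < \<eta> \<Longrightarrow> (\<integral>\<^sup>+f. ennreal (F f) * indicator {f. drawdown f < v} f \<partial>wiener) \<le>
      C * emeasure wiener {f \<in> mspace C01. drawdown f < v}"
  shows "(\<integral>\<^sup>+f. ennreal (F f) * ennreal (a - sqrt t * drawdown f) \<partial>wiener) \<le>
    C * (\<integral>\<^sup>+f. ennreal (a - sqrt t * drawdown f) \<partial>wiener) + ennreal (a - \<eta>)"
proof -
  interpret W: prob_space wiener by (rule prob_space_wiener)
  define \<mu> where "\<mu> = density wiener (\<lambda>f. ennreal (F f))"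
  \<comment> \<open>For \<open>x < 0\<close> the event \<open>x < Y f\<close> says that the drawdown
    is below \<open>- x / sqrt t\<close>, which is the form that \<open>near\<close>
    controls.\<close>
  define Y where "Y f = - sqrt t * drawdown f" for f
  have [measurable]: "Y \<in> borel_measurable borel_C01" unfolding Y_def[abs_def] by measurable
  have sets_\<mu> [measurable_cong, simp]: "sets \<mu> = sets borel_C01" by (simp add: \<mu>_def)
  have space_\<mu>: "space \<mu> = mspace C01" by (simp add: \<mu>_def)
  have \<mu>_le: "emeasure \<mu> A \<le> 1" if [measurable]: "A \<in> sets borel_C01" for A
  proof -
    have "emeasure \<mu> A = (\<integral>\<^sup>+f. ennreal (F f) * indicator A f \<partial>wiener)"
      unfolding \<mu>_def by (subst emeasure_density) auto
    also have "\<dots> \<le> (\<integral>\<^sup>+f. 1 \<partial>wiener)"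
      using F1 by (intro nn_integral_mono) (auto simp: indicator_def ennreal_le_1)
    finally show ?thesis by (simp add: W.emeasure_space_1[simplified])
  qed
  interpret \<mu>: finite_measure \<mu>
    using \<mu>_le[of "mspace C01"] sets.top[of borel_C01] by (intro finite_measureI) (auto simp: space_\<mu> top_unique)
  have pointwise: "emeasure \<mu> {f \<in> space \<mu>. x < Y f} \<le>
      C * emeasure wiener {f \<in> space wiener. x < Y f} + indicator {..-\<eta>} x" for x
  proof -
    have "{f \<in> space borel_C01. x < Y f} \<in> sets borel_C01" by measurable
    then have S: "{f \<in> mspace C01. x < Y f} \<in> sets borel_C01" by simp
    consider "0 \<le> x" | "x < 0" "- x / sqrt t < \<eta>" | "x < 0" "\<eta> \<le> - x / sqrt t" by linarith
    then show ?thesis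
    proof cases
      case 1
      have "\<not> x < Y f" if "f \<in> mspace C01" for f
      proof -
        have "0 \<le> sqrt t * drawdown f" using drawdown_nonneg[OF that] t by (intro mult_nonneg_nonneg) auto
        with 1 show ?thesis by (simp add: Y_def)
      qed
      then have "{f \<in> space \<mu>. x < Y f} = {}" by (auto simp: space_\<mu>)
      then show ?thesis by (simp only: emeasure_empty zero_le)
    next
      case 2
      let ?v = "- x / sqrt t"
      have iff: "x < Y f \<longleftrightarrow> drawdown f < ?v" for f
      proof -
        have "0 < sqrt t" using t by simp
        then have "drawdown f < ?v \<longleftrightarrow> drawdown f * sqrt t < - x" by (rule pos_less_divide_eq)
        moreover have "Y f = - (drawdown f * sqrt t)" by (simp add: Y_def mult.commute)
        ultimately show ?thesis by linarith
      qed
      have v: "0 < ?v" using 2(1) t by (intro divide_pos_pos) auto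
      have "emeasure \<mu> {f \<in> space \<mu>. x < Y f} =
          (\<integral>\<^sup>+f. ennreal (F f) * indicator {f \<in> mspace C01. x < Y f} f \<partial>wiener)"
        unfolding space_\<mu> unfolding \<mu>_def by (rule emeasure_density) (use S in auto)
      also have "\<dots> = (\<integral>\<^sup>+f. ennreal (F f) * indicator {f. drawdown f < ?v} f \<partial>wiener)"
      proof (rule nn_integral_cong)
        fix f assume "f \<in> space wiener"
        then have "f \<in> {f \<in> mspace C01. x < Y f} \<longleftrightarrow> f \<in> {f. drawdown f < ?v}"
          unfolding mem_Collect_eq iff by simp
        then show "ennreal (F f) * indicator {f \<in> mspace C01. x < Y f} f = ennreal (F f) * indicator {f. drawdown f < ?v} f"
          unfolding indicator_def by (simp only:)
      qed
      also have "\<dots> \<le> C * emeasure wiener {f \<in> mspace C01. drawdown f < ?v}" by (rule near[OF v 2(2)])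
      also have "{f \<in> mspace C01. drawdown f < ?v} = {f \<in> space wiener. x < Y f}"
        unfolding iff space_wiener ..
      finally show ?thesis by (rule order_trans) simp
    next
      case 3
      \<comment> \<open>Because \<open>t\<close> is at least 1, a threshold of at least
        \<open>\<eta>\<close> forces \<open>x \<le> - \<eta>\<close>. The mass is then bounded by
        1.\<close>
      have "- x / sqrt t \<le> - x / 1" using 3(1) t by (intro divide_left_mono) auto
      with 3(2) have "x \<le> - \<eta>" by linarith
      then have "indicator {..-\<eta>} x = (1 :: ennreal)" by simp
      then have "emeasure \<mu> {f \<in> space \<mu>. x < Y f} \<le> indicator {..-\<eta>} x"
        using \<mu>_le[OF S] by (simp only: space_\<mu>)
      also have "\<dots> \<le> C * emeasure wiener {f \<in> space wiener. x < Y f} + indicator {..-\<eta>} x"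
        by (rule add_increasing) auto
      finally show ?thesis .
    qed
  qed
  have "{p \<in> space (borel \<Otimes>\<^sub>M borel_C01). fst p < Y (snd p)} \<in> sets (borel \<Otimes>\<^sub>M borel_C01)" by measurable
  also have "{p \<in> space (borel \<Otimes>\<^sub>M borel_C01). fst p < Y (snd p)} =
      {p \<in> space (borel \<Otimes>\<^sub>M wiener). snd p \<in> {f \<in> space wiener. fst p < Y f}}"
    by (auto simp: space_pair_measure)
  also have "sets (borel \<Otimes>\<^sub>M borel_C01) = sets ((borel :: real measure) \<Otimes>\<^sub>M wiener)"
    by (intro sets_pair_measure_cong) auto
  finally have [measurable]: "(\<lambda>x. emeasure wiener {f \<in> space wiener. x < Y f}) \<in> borel_measurable borel"
    by (intro W.measurable_emeasure) auto
  define q where "q x = emeasure wiener {f \<in> space wiener. x < Y f}" for x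
  have [measurable]: "q \<in> borel_measurable borel" unfolding q_def[abs_def] by measurable
  have Y_eq: "Y f - (- a) = a - sqrt t * drawdown f" for f by (simp add: Y_def)
  have "(\<integral>\<^sup>+f. ennreal (Y f - (- a)) \<partial>\<mu>) = (\<integral>\<^sup>+f. ennreal (F f) * ennreal (Y f - (- a)) \<partial>wiener)"
    unfolding \<mu>_def by (rule nn_integral_density) measurable
  then have "(\<integral>\<^sup>+f. ennreal (F f) * ennreal (a - sqrt t * drawdown f) \<partial>wiener) = (\<integral>\<^sup>+f. ennreal (Y f - (- a)) \<partial>\<mu>)"
    unfolding Y_eq by (rule sym)
  also have "\<dots> = (\<integral>\<^sup>+x. indicator {-a<..} x * emeasure \<mu> {f \<in> space \<mu>. x < Y f} \<partial>lborel)"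
    by (rule \<mu>.nn_integral_excess(1)) measurable
  also have "\<dots> \<le> (\<integral>\<^sup>+x. indicator {-a<..} x * (C * q x + indicator {..-\<eta>} x) \<partial>lborel)"
    unfolding q_def by (intro nn_integral_mono mult_left_mono pointwise) simp
  also have "\<dots> = (\<integral>\<^sup>+x. C * (indicator {-a<..} x * q x) + indicator {-a<..-\<eta>} x \<partial>lborel)"
    by (intro nn_integral_cong) (auto simp: indicator_def)
  also have "\<dots> = (\<integral>\<^sup>+x. C * (indicator {-a<..} x * q x) \<partial>lborel) + (\<integral>\<^sup>+x. indicator {-a<..-\<eta>} x \<partial>lborel)"
    by (rule nn_integral_add) measurable
  also have "(\<integral>\<^sup>+x. C * (indicator {-a<..} x * q x) \<partial>lborel) = C * (\<integral>\<^sup>+x. indicator {-a<..} x * q x \<partial>lborel)"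
    by (rule nn_integral_cmult) measurable
  also have "(\<integral>\<^sup>+x. indicator {-a<..-\<eta>} x \<partial>lborel) = emeasure lborel {-a<..-\<eta>}"
    by simp
  also have "(\<integral>\<^sup>+x. indicator {-a<..} x * q x \<partial>lborel) = (\<integral>\<^sup>+f. ennreal (Y f - (- a)) \<partial>wiener)"
    unfolding q_def
  proof (rule W.nn_integral_excess(1)[symmetric])
    show "Y \<in> borel_measurable wiener" by measurable
  qed
  \<comment> \<open>For \<open>a < \<eta>\<close> the interval is empty and the truncation on the
    right gives 0 as well.\<close>
  also have "emeasure lborel {-a<..-\<eta>} = ennreal (a - \<eta>)"
    by (cases "\<eta> \<le> a") (auto simp: ennreal_neg)
  finally show ?thesis unfolding Y_eq .
qed

text \<open>The inner bound is applied with \<open>a = sqrt h * psup g\<close>. The mean excess of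
  this value over \<open>\<eta>\<close> is \<open>sqrt h\<close> times a tail at
  \<open>K = \<eta> / sqrt h\<close>, of smaller order than the time step.\<close>

lemma gain_le:
  fixes C :: ennreal
  assumes F [measurable]: "F \<in> borel_measurable borel_C01" and F1: "\<And>f. F f \<le> 1"
    and t: "1 \<le> t" and h: "0 < h" and \<eta>: "0 < \<eta>"
    and near: "\<And>v. 0 < v \<Longrightarrow> v < \<eta> \<Longrightarrow> (\<integral>\<^sup>+f. ennreal (F f) * indicator {f. drawdown f < v} f \<partial>wiener) \<le>
      C * emeasure wiener {f \<in> mspace C01. drawdown f < v}"
  shows "gain F t h \<le> C * gain (\<lambda>_. 1) t h + ennreal (sqrt h * (4 * h / \<eta>\<^sup>2))"
proof -
  interpret W: prob_space wiener by (rule prob_space_wiener)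
  have m: "(\<lambda>g. \<integral>\<^sup>+f. ennreal (sqrt h * psup g - sqrt t * drawdown f) \<partial>wiener) \<in> borel_measurable wiener"
    by measurable
  have "gain F t h \<le> (\<integral>\<^sup>+g. C * (\<integral>\<^sup>+f. ennreal (sqrt h * psup g - sqrt t * drawdown f) \<partial>wiener) +
      ennreal (sqrt h * psup g - \<eta>) \<partial>wiener)"
    unfolding gain_def by (intro nn_integral_mono inner_gain_le[OF F F1 t near])
  also have "\<dots> = C * gain (\<lambda>_. 1) t h + (\<integral>\<^sup>+g. ennreal (sqrt h * psup g - \<eta>) \<partial>wiener)"
    using m by (simp add: nn_integral_add nn_integral_cmult gain_def)
  also have "(\<integral>\<^sup>+g. ennreal (sqrt h * psup g - \<eta>) \<partial>wiener) =
      (\<integral>\<^sup>+g. ennreal (sqrt h) * ennreal (psup g - \<eta> / sqrt h) \<partial>wiener)"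
    using h by (intro nn_integral_cong) (simp add: ennreal_mult'[symmetric] right_diff_distrib)
  also have "\<dots> = ennreal (sqrt h) * (\<integral>\<^sup>+g. ennreal (psup g - \<eta> / sqrt h) \<partial>wiener)"
    by (rule nn_integral_cmult) measurable
  also have "\<dots> \<le> ennreal (sqrt h) * ennreal (4 / (\<eta> / sqrt h)\<^sup>2)"
    using h \<eta> by (intro mult_left_mono psup_tail) auto
  also have "\<dots> = ennreal (sqrt h * (4 * h / \<eta>\<^sup>2))"
    using h by (subst ennreal_mult[symmetric]) (auto simp: power_divide)
  finally show ?thesis by (simp add: add_left_mono)
qed

text \<open>Here \<open>C\<close> is any bound for the conditional expectations at small thresholds.
  With \<open>n\<close> steps of length \<open>3 / n\<close> the errors add up to order
  \<open>1 / sqrt n\<close>.\<close>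

lemma gain_limit_le:
  fixes C :: ennreal
  assumes F: "continuous_map (mtopology_of C01) euclideanreal F" "\<And>f. 0 \<le> F f" "\<And>f. F f \<le> 1"
    and C: "C \<noteq> \<infinity>" and \<eta>: "0 < \<eta>"
    and near: "\<And>v. 0 < v \<Longrightarrow> v < \<eta> \<Longrightarrow> (\<integral>\<^sup>+f. ennreal (F f) * indicator {f. drawdown f < v} f \<partial>wiener) \<le>
      C * emeasure wiener {f \<in> mspace C01. drawdown f < v}"
  shows "(\<integral>\<^sup>+\<omega>. ennreal (F (seg 0 (tau \<omega>) \<omega>)) * ennreal (1 / sqrt (tau \<omega>)) \<partial>M) \<le> C * ennreal (sqrt (2 / pi))"
proof -
  \<comment> \<open>The 12 is \<open>4 * 3\<close>, from \<open>n\<close> error terms that each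
    contain \<open>4 * (3 / n)\<close>.\<close>
  let ?e = "\<lambda>n. sqrt (3 / real n) * (12 / \<eta>\<^sup>2)"
  note Fm = borel_measurable_continuous_map[OF F(1)]
  have bound: "(\<Sum>i<n. gain F (1 + 3 / real n * real i) (3 / real n)) \<le>
      C * ennreal (sqrt (2 / pi)) + ennreal (?e n)" if n: "0 < n" for n
  proof -
    have "(\<Sum>i<n. gain F (1 + 3 / real n * real i) (3 / real n)) \<le>
        (\<Sum>i<n. C * gain (\<lambda>_. 1) (1 + 3 / real n * real i) (3 / real n) +
          ennreal (sqrt (3 / real n) * (4 * (3 / real n) / \<eta>\<^sup>2)))"
      using n by (intro sum_mono gain_le[OF Fm F(3) _ _ \<eta> near]) auto
    also have "\<dots> = C * (\<Sum>i<n. gain (\<lambda>_. 1) (1 + 3 / real n * real i) (3 / real n)) +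
        of_nat n * ennreal (sqrt (3 / real n) * (4 * (3 / real n) / \<eta>\<^sup>2))"
      by (simp add: sum.distrib sum_distrib_left)
    also have "(\<Sum>i<n. gain (\<lambda>_. 1) (1 + 3 / real n * real i) (3 / real n)) = ennreal (sqrt (2 / pi))"
      by (rule sum_gain_one[OF n])
    also have "of_nat n * ennreal (sqrt (3 / real n) * (4 * (3 / real n) / \<eta>\<^sup>2)) =
        ennreal (real n * (sqrt (3 / real n) * (4 * (3 / real n) / \<eta>\<^sup>2)))"
      unfolding ennreal_of_nat_eq_real_of_nat by (rule ennreal_mult[symmetric]) auto
    also have "real n * (sqrt (3 / real n) * (4 * (3 / real n) / \<eta>\<^sup>2)) = ?e n"
      using n by (simp add: field_simps)
    finally show ?thesis .
  qed
  have "(\<lambda>n. 3 / real n) \<longlonglongrightarrow> 0" by (rule lim_const_over_n)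
  then have "(\<lambda>n. ?e n) \<longlonglongrightarrow> sqrt 0 * (12 / \<eta>\<^sup>2)"
    by (intro tendsto_mult tendsto_real_sqrt tendsto_const)
  then have "(\<lambda>n. ennreal (?e n)) \<longlonglongrightarrow> ennreal 0" by (intro tendsto_ennrealI) simp
  then have lim: "(\<lambda>n. C * ennreal (sqrt (2 / pi)) + ennreal (?e n)) \<longlonglongrightarrow> C * ennreal (sqrt (2 / pi)) + ennreal 0"
    by (intro tendsto_add tendsto_const)
  have "(\<integral>\<^sup>+\<omega>. ennreal (F (seg 0 (tau \<omega>) \<omega>)) * ennreal (1 / sqrt (tau \<omega>)) \<partial>M) \<le>
      C * ennreal (sqrt (2 / pi)) + ennreal 0"
    by (rule tendsto_le[OF _ lim gain_sum_tendsto[OF F]])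
      (use bound in \<open>auto intro!: eventually_mono[OF eventually_gt_at_top[of 0]]\<close>)
  then show ?thesis by simp
qed

section \<open>The near-maximum law as conditioned Wiener measure\<close>

lemma unit_path_in_C01: "\<omega> \<in> space M \<Longrightarrow> unit_path X \<omega> \<in> mspace C01"
  using continuous_on_subset[OF continuous_paths, of \<omega> "{0..1}"]
  by (simp add: mspace_C01 unit_path_def cong: continuous_on_cong_simp)

lemma measurable_unit_path: "unit_path X \<in> measurable M borel_C01"
  by (rule measurable_C01I) (use unit_path_in_C01 rv in \<open>auto simp: unit_path_def\<close>)

lemma nn_integral_unit_path:
  assumes [measurable]: "f \<in> borel_measurable borel_C01"
  shows "(\<integral>\<^sup>+\<omega>. f (unit_path X \<omega>) \<partial>M) = (\<integral>\<^sup>+w. f w \<partial>wiener)"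
proof -
  have "(\<integral>\<^sup>+\<omega>. f (unit_path X \<omega>) \<partial>M) = (\<integral>\<^sup>+\<omega>. f (seg 0 1 \<omega>) \<partial>M)"
    using start by (intro nn_integral_cong_AE) (auto elim!: eventually_mono simp: unit_path_def seg_def)
  then show ?thesis by (simp add: nn_integral_seg)
qed

text \<open>A conditional expectation multiplied by the probability of its condition. The product
  form also covers a null event, for which both sides vanish.\<close>

lemma near_max_law_integral:
  assumes F [measurable]: "F \<in> borel_measurable borel_C01" and bnd: "\<And>f. 0 \<le> F f" "\<And>f. F f \<le> 1"
  shows "(\<integral>\<^sup>+f. ennreal (F f) * indicator {f. drawdown f < v} f \<partial>wiener) =
    ennreal (\<integral>f. F f \<partial>near_max_law M X v) * emeasure wiener {f \<in> mspace C01. drawdown f < v}"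
proof -
  note [measurable] = measurable_unit_path
  define E where "E = {\<omega> \<in> space M. running_sup X 1 \<omega> - X 1 \<omega> < v}"
  have E_eq: "E = {\<omega> \<in> space M. drawdown (unit_path X \<omega>) < v}"
  proof -
    have "running_sup X 1 \<omega> = psup (unit_path X \<omega>)" for \<omega>
      unfolding running_sup_def psup_def by (intro SUP_cong) (auto simp: unit_path_def)
    then show ?thesis by (simp add: E_def unit_path_def)
  qed
  have E [measurable]: "E \<in> sets M" unfolding E_eq by measurable
  have ind: "(\<integral>\<^sup>+f. g f * indicator {f. drawdown f < v} f \<partial>wiener) = (\<integral>\<^sup>+\<omega>. g (unit_path X \<omega>) * indicator E \<omega> \<partial>M)"
    if [measurable]: "g \<in> borel_measurable borel_C01" for g
    by (subst nn_integral_unit_path[symmetric]) (auto intro!: nn_integral_cong simp: E_eq indicator_def)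
  have pE: "emeasure wiener {f \<in> mspace C01. drawdown f < v} = emeasure M E"
  proof -
    have "{f \<in> space borel_C01. drawdown f < v} \<in> sets borel_C01" by measurable
    then have "emeasure wiener {f \<in> mspace C01. drawdown f < v} =
        (\<integral>\<^sup>+f. indicator {f \<in> mspace C01. drawdown f < v} f \<partial>wiener)" by simp
    also have "\<dots> = (\<integral>\<^sup>+f. 1 * indicator {f. drawdown f < v} f \<partial>wiener)"
    proof (rule nn_integral_cong)
      fix f assume "f \<in> space wiener"
      then show "indicator {f \<in> mspace C01. drawdown f < v} f = (1 * indicator {f. drawdown f < v} f :: ennreal)"
        by (simp add: indicator_def)
    qed
    also have "\<dots> = emeasure M E" by (subst ind) auto
    finally show ?thesis .
  qed
  have "(\<integral>\<^sup>+f. ennreal (F f) \<partial>near_max_law M X v) = (\<integral>\<^sup>+\<omega>. ennreal (F (unit_path X \<omega>)) * indicator E \<omega> \<partial>M) / emeasure M E"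
    unfolding near_max_law_def E_def[symmetric]
    by (subst nn_integral_distr) (auto simp: nn_integral_uniform_measure)
  moreover have "ennreal (\<integral>f. F f \<partial>near_max_law M X v) = (\<integral>\<^sup>+f. ennreal (F f) \<partial>near_max_law M X v)"
    if "emeasure M E \<noteq> 0"
  proof -
    interpret U: prob_space "uniform_measure M E"
      using that by (intro prob_space_uniform_measure) auto
    interpret L: prob_space "near_max_law M X v"
      unfolding near_max_law_def E_def[symmetric] by (rule U.prob_space_distr) measurable
    have "integrable (near_max_law M X v) F"
      using bnd by (intro L.integrable_const_bound[where B = 1]) (auto simp: near_max_law_def)
    then show ?thesis using bnd by (simp add: nn_integral_eq_integral)
  qed
  moreover have "(\<integral>\<^sup>+\<omega>. ennreal (F (unit_path X \<omega>)) * indicator E \<omega> \<partial>M) = 0" if "emeasure M E = 0"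
  proof -
    have "AE \<omega> in M. \<omega> \<notin> E" using that by (intro AE_not_in) (auto simp: null_sets_def)
    then have "(\<integral>\<^sup>+\<omega>. ennreal (F (unit_path X \<omega>)) * indicator E \<omega> \<partial>M) = (\<integral>\<^sup>+\<omega>. 0 \<partial>M)"
      by (intro nn_integral_cong_AE) (auto elim!: eventually_mono)
    then show ?thesis by simp
  qed
  moreover have "(\<integral>\<^sup>+f. ennreal (F f) * indicator {f. drawdown f < v} f \<partial>wiener) =
      (\<integral>\<^sup>+\<omega>. ennreal (F (unit_path X \<omega>)) * indicator E \<omega> \<partial>M)"
    by (rule ind) measurable
  ultimately show ?thesis
    unfolding pE
    by (cases "emeasure M E = 0")
      (auto simp: ennreal_divide_times ennreal_times_divide ennreal_mult_divide_eq)
qed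

text \<open>Weak convergence keeps the conditional expectations below \<open>c + d\<close> at all
  small thresholds, which supplies the constant for \<open>gain_limit_le\<close>.\<close>

lemma ascent_integral_ge:
  fixes a :: "real \<Rightarrow> 'b \<Rightarrow> real"
  assumes asc: "brownian_ascent M X N a"
    and F: "continuous_map (mtopology_of C01) euclideanreal F" "\<And>f. 0 \<le> F f" "\<And>f. F f \<le> 1"
  shows "(\<integral>\<^sup>+\<omega>. ennreal (F (seg 0 (tau \<omega>) \<omega>)) * ennreal (1 / sqrt (tau \<omega>)) \<partial>M) \<le>
    ennreal (sqrt (2 / pi)) * (\<integral>\<^sup>+\<omega>. ennreal (F (unit_path a \<omega>)) \<partial>N)"
proof -
  interpret N: prob_space N using asc by (simp add: brownian_ascent_def)
  note Fm [measurable] = borel_measurable_continuous_map[OF F(1)]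
  have am [measurable]: "unit_path a \<in> measurable N borel_C01" using asc by (simp add: brownian_ascent_def)
  define c where "c = (\<integral>f. F f \<partial>distr N borel_C01 (unit_path a))"
  have c: "(\<integral>\<^sup>+\<omega>. ennreal (F (unit_path a \<omega>)) \<partial>N) = ennreal c" and c0: "0 \<le> c"
  proof -
    have "c = (\<integral>\<omega>. F (unit_path a \<omega>) \<partial>N)" unfolding c_def by (rule integral_distr) auto
    moreover have "integrable N (\<lambda>\<omega>. F (unit_path a \<omega>))"
      using F by (intro N.integrable_const_bound[where B = 1]) auto
    ultimately show "(\<integral>\<^sup>+\<omega>. ennreal (F (unit_path a \<omega>)) \<partial>N) = ennreal c" "0 \<le> c"
      using F by (auto simp: nn_integral_eq_integral)
  qed
  have "bounded (F ` topspace (mtopology_of C01))"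
    using F by (intro boundedI[of _ 1]) auto
  then have lim: "((\<lambda>v. \<integral>f. F f \<partial>near_max_law M X v) \<longlongrightarrow> c) (at_right 0)"
    using asc F(1) by (simp add: brownian_ascent_def weakly_converges_def c_def)
  have "(\<integral>\<^sup>+\<omega>. ennreal (F (seg 0 (tau \<omega>) \<omega>)) * ennreal (1 / sqrt (tau \<omega>)) \<partial>M) \<le>
      ennreal (sqrt (2 / pi)) * ennreal c + ennreal e" if e: "0 < e" for e
  proof -
    \<comment> \<open>Multiplication by the total mass \<open>sqrt (2 / pi)\<close> turns this
      \<open>d\<close> into \<open>e\<close>.\<close>
    define d where "d = e / sqrt (2 / pi)"
    have d: "0 < d" using e by (simp add: d_def)
    have "\<forall>\<^sub>F v in at_right 0. (\<integral>f. F f \<partial>near_max_law M X v) < c + d"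
      using order_tendstoD(2)[OF lim, of "c + d"] d by simp
    then obtain \<eta> where \<eta>: "0 < \<eta>" "\<And>v. 0 < v \<Longrightarrow> v < \<eta> \<Longrightarrow> (\<integral>f. F f \<partial>near_max_law M X v) < c + d"
      unfolding eventually_at_right_field by auto
    have "(\<integral>\<^sup>+\<omega>. ennreal (F (seg 0 (tau \<omega>) \<omega>)) * ennreal (1 / sqrt (tau \<omega>)) \<partial>M) \<le>
        ennreal (c + d) * ennreal (sqrt (2 / pi))"
    proof (rule gain_limit_le[OF F _ \<eta>(1)])
      fix v :: real assume v: "0 < v" "v < \<eta>"
      show "(\<integral>\<^sup>+f. ennreal (F f) * indicator {f. drawdown f < v} f \<partial>wiener) \<le>
          ennreal (c + d) * emeasure wiener {f \<in> mspace C01. drawdown f < v}"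
        unfolding near_max_law_integral[OF Fm F(2,3)]
        using \<eta>(2)[OF v] by (intro mult_right_mono ennreal_leI) auto
    qed simp
    also have "\<dots> = ennreal (sqrt (2 / pi)) * ennreal c + ennreal (sqrt (2 / pi)) * ennreal d"
      using c0 d by (simp add: ring_distribs mult.commute)
    also have "ennreal (sqrt (2 / pi)) * ennreal d = ennreal e"
      using e by (subst ennreal_mult[symmetric]) (auto simp: d_def)
    finally show ?thesis .
  qed
  then show ?thesis unfolding c by (rule ennreal_le_epsilon)
qed

text \<open>The reverse inequality is the same bound for \<open>1 - F\<close>: both sides are
  additive in \<open>F\<close> and give the constant 1 the same mass
  \<open>sqrt (2 / pi)\<close>.\<close>

lemma ascent_integral_eq:
  fixes a :: "real \<Rightarrow> 'b \<Rightarrow> real"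
  assumes asc: "brownian_ascent M X N a"
    and F: "continuous_map (mtopology_of C01) euclideanreal F" "\<And>f. 0 \<le> F f" "\<And>f. F f \<le> 1"
  shows "(\<integral>\<^sup>+\<omega>. ennreal (F (seg 0 (tau \<omega>) \<omega>)) * ennreal (1 / sqrt (tau \<omega>)) \<partial>M) =
    ennreal (sqrt (2 / pi)) * (\<integral>\<^sup>+\<omega>. ennreal (F (unit_path a \<omega>)) \<partial>N)"
proof (rule antisym[OF ascent_integral_ge[OF asc F]])
  interpret N: prob_space N using asc by (simp add: brownian_ascent_def)
  note Fm [measurable] = borel_measurable_continuous_map[OF F(1)]
  have am [measurable]: "unit_path a \<in> measurable N borel_C01" using asc by (simp add: brownian_ascent_def)
  have Ym [measurable]: "(\<lambda>\<omega>. seg 0 (tau \<omega>) \<omega>) \<in> measurable M borel_C01"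
    by (rule measurable_seg_random_time) (auto simp: less_imp_le tau_pos)
  let ?A = "\<lambda>F. \<integral>\<^sup>+\<omega>. ennreal (F (seg 0 (tau \<omega>) \<omega>)) * ennreal (1 / sqrt (tau \<omega>)) \<partial>M"
  let ?B = "\<lambda>F. ennreal (sqrt (2 / pi)) * (\<integral>\<^sup>+\<omega>. ennreal (F (unit_path a \<omega>)) \<partial>N)"
  let ?G = "\<lambda>f. 1 - F f"
  have split: "ennreal (F f) + ennreal (1 - F f) = 1" for f
    using F by (subst ennreal_plus[symmetric]) auto
  show "?B F \<le> ?A F"
  proof (rule ennreal_summand_antimono)
    show "?A F + ?A ?G = ennreal (sqrt (2 / pi))"
      unfolding tau_mean[symmetric]
      by (subst nn_integral_add[symmetric]) (auto simp: distrib_right[symmetric] split)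
    show "?B F + ?B ?G = ennreal (sqrt (2 / pi))"
      unfolding distrib_left[symmetric]
      by (subst nn_integral_add[symmetric]) (auto simp: split N.emeasure_space_1)
    show "?A ?G \<le> ?B ?G"
      by (rule ascent_integral_ge[OF asc]) (use F in \<open>auto intro!: continuous_map_diff\<close>)
  qed simp
qed

text \<open>Agreement on continuous test functions becomes equality of measures; this is the passage
  to arbitrary measurable functionals.\<close>

lemma ascent_law:
  fixes a :: "real \<Rightarrow> 'b \<Rightarrow> real"
  assumes asc: "brownian_ascent M X N a"
  shows "distr N borel_C01 (unit_path a) =
    distr (density M (\<lambda>\<omega>. ennreal (sqrt (pi / 2)) * ennreal (1 / sqrt (tau \<omega>)))) borel_C01 (\<lambda>\<omega>. seg 0 (tau \<omega>) \<omega>)"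
proof -
  interpret N: prob_space N using asc by (simp add: brownian_ascent_def)
  have am [measurable]: "unit_path a \<in> measurable N borel_C01" using asc by (simp add: brownian_ascent_def)
  have Ym [measurable]: "(\<lambda>\<omega>. seg 0 (tau \<omega>) \<omega>) \<in> measurable M borel_C01"
    by (rule measurable_seg_random_time) (auto simp: less_imp_le tau_pos)
  have one: "ennreal (sqrt (pi / 2)) * ennreal (sqrt (2 / pi)) = 1"
    by (subst ennreal_mult[symmetric]) (auto simp: real_sqrt_mult[symmetric])
  show ?thesis
  proof (rule measure_eqI_continuous[where m = C01])
    show "finite_measure (distr N borel_C01 (unit_path a))"
      by (intro prob_space.finite_measure N.prob_space_distr am)
    show "finite_measure (distr (density M (\<lambda>\<omega>. ennreal (sqrt (pi / 2)) * ennreal (1 / sqrt (tau \<omega>)))) borel_C01 (\<lambda>\<omega>. seg 0 (tau \<omega>) \<omega>))"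
    proof (intro finite_measure.finite_measure_distr finite_measureI)
      show "emeasure (density M (\<lambda>\<omega>. ennreal (sqrt (pi / 2)) * ennreal (1 / sqrt (tau \<omega>))))
          (space (density M (\<lambda>\<omega>. ennreal (sqrt (pi / 2)) * ennreal (1 / sqrt (tau \<omega>))))) \<noteq> \<infinity>"
        by (simp add: emeasure_density nn_integral_cmult tau_mean one cong: nn_integral_cong_simp)
    qed simp
    fix F :: "(real \<Rightarrow> real) \<Rightarrow> real"
    assume F: "continuous_map (mtopology_of C01) euclideanreal F" "\<And>f. 0 \<le> F f" "\<And>f. F f \<le> 1"
    note Fm [measurable] = borel_measurable_continuous_map[OF F(1)]
    have "(\<integral>\<^sup>+f. ennreal (F f) \<partial>distr (density M (\<lambda>\<omega>. ennreal (sqrt (pi / 2)) * ennreal (1 / sqrt (tau \<omega>)))) borel_C01 (\<lambda>\<omega>. seg 0 (tau \<omega>) \<omega>)) =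
        (\<integral>\<^sup>+\<omega>. ennreal (sqrt (pi / 2)) * (ennreal (F (seg 0 (tau \<omega>) \<omega>)) * ennreal (1 / sqrt (tau \<omega>))) \<partial>M)"
      by (simp add: nn_integral_distr nn_integral_density mult.assoc mult.commute mult.left_commute)
    also have "\<dots> = ennreal (sqrt (pi / 2)) * (ennreal (sqrt (2 / pi)) * (\<integral>\<^sup>+\<omega>. ennreal (F (unit_path a \<omega>)) \<partial>N))"
      by (subst nn_integral_cmult) (auto simp: ascent_integral_eq[OF asc F])
    also have "\<dots> = (\<integral>\<^sup>+f. ennreal (F f) \<partial>distr N borel_C01 (unit_path a))"
      by (simp add: mult.assoc[symmetric] one nn_integral_distr)
    finally show "(\<integral>\<^sup>+f. ennreal (F f) \<partial>distr N borel_C01 (unit_path a)) =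
      (\<integral>\<^sup>+f. ennreal (F f) \<partial>distr (density M (\<lambda>\<omega>. ennreal (sqrt (pi / 2)) * ennreal (1 / sqrt (tau \<omega>)))) borel_C01 (\<lambda>\<omega>. seg 0 (tau \<omega>) \<omega>))"
      by simp
  qed simp_all
qed

end

theorem proposition6p4:
  fixes M :: "'a measure" and X :: "real \<Rightarrow> 'a \<Rightarrow> real"
    and N :: "'b measure" and a :: "real \<Rightarrow> 'b \<Rightarrow> real"
    and F :: "(real \<Rightarrow> real) \<Rightarrow> real"
  assumes "standard_brownian_motion M X"
    and "brownian_ascent M X N a"
    and "F \<in> borel_measurable borel_C01"
    and "\<And>f. f \<in> mspace C01 \<Longrightarrow> 0 \<le> F f"
  shows "(\<integral>\<^sup>+ \<omega>. ennreal (F (unit_path a \<omega>)) \<partial>N) =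
    ennreal (sqrt (pi / 2)) *
    (\<integral>\<^sup>+ \<omega>. ennreal
       (F (unit_path (\<lambda>s \<omega>. X (s * hitting_time X 1 \<omega>) \<omega> / sqrt (hitting_time X 1 \<omega>)) \<omega>)
        * (1 / sqrt (hitting_time X 1 \<omega>))) \<partial>M)"
proof -
  interpret standard_brownian_motion M X by fact
  note F [measurable] = assms(3)
  have am [measurable]: "unit_path a \<in> measurable N borel_C01" using assms(2) by (simp add: brownian_ascent_def)
  have Ym [measurable]: "(\<lambda>\<omega>. seg 0 (tau \<omega>) \<omega>) \<in> measurable M borel_C01"
    by (rule measurable_seg_random_time) (auto simp: less_imp_le tau_pos)
  have "(\<integral>\<^sup>+\<omega>. ennreal (F (unit_path a \<omega>)) \<partial>N) = (\<integral>\<^sup>+f. ennreal (F f) \<partial>distr N borel_C01 (unit_path a))"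
    by (simp add: nn_integral_distr)
  also have "\<dots> = (\<integral>\<^sup>+\<omega>. ennreal (sqrt (pi / 2)) * (ennreal (F (seg 0 (tau \<omega>) \<omega>)) * ennreal (1 / sqrt (tau \<omega>))) \<partial>M)"
    unfolding ascent_law[OF assms(2)]
    by (simp add: nn_integral_distr nn_integral_density mult.assoc mult.commute mult.left_commute)
  also have "\<dots> = ennreal (sqrt (pi / 2)) * (\<integral>\<^sup>+\<omega>. ennreal (F (seg 0 (tau \<omega>) \<omega>)) * ennreal (1 / sqrt (tau \<omega>)) \<partial>M)"
    by (rule nn_integral_cmult) measurable
  also have "(\<integral>\<^sup>+\<omega>. ennreal (F (seg 0 (tau \<omega>) \<omega>)) * ennreal (1 / sqrt (tau \<omega>)) \<partial>M) =
    (\<integral>\<^sup>+ \<omega>. ennreal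
       (F (unit_path (\<lambda>s \<omega>. X (s * hitting_time X 1 \<omega>) \<omega> / sqrt (hitting_time X 1 \<omega>)) \<omega>)
        * (1 / sqrt (hitting_time X 1 \<omega>))) \<partial>M)"
  \<comment> \<open>On \<open>good\<close>, \<open>tau\<close> is the hitting time and the path
    starts at 0, so that \<open>seg 0 (tau \<omega>) \<omega>\<close> is the rescaled path of the
    theorem.\<close>
  proof (rule nn_integral_cong_AE)
    show "AE \<omega> in M. ennreal (F (seg 0 (tau \<omega>) \<omega>)) * ennreal (1 / sqrt (tau \<omega>)) = ennreal
       (F (unit_path (\<lambda>s \<omega>. X (s * hitting_time X 1 \<omega>) \<omega> / sqrt (hitting_time X 1 \<omega>)) \<omega>)
        * (1 / sqrt (hitting_time X 1 \<omega>)))"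
      using AE_good
    proof eventually_elim
      case (elim \<omega>)
      then have "tau \<omega> = hitting_time X 1 \<omega>" "X 0 \<omega> = 0" by (auto simp: tau_def good_def)
      then have "unit_path (\<lambda>s \<omega>. X (s * hitting_time X 1 \<omega>) \<omega> / sqrt (hitting_time X 1 \<omega>)) \<omega> = seg 0 (tau \<omega>) \<omega>"
        by (simp add: unit_path_def seg_def mult.commute)
      moreover have "0 \<le> 1 / sqrt (hitting_time X 1 \<omega>)"
        using hitting_time_pos[OF elim] by simp
      ultimately show ?case using \<open>tau \<omega> = hitting_time X 1 \<omega>\<close> by (simp only: ennreal_mult'')
    qed
  qed
  finally show ?thesis .
qed

end
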